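(* In the setting described in the context suppose that $s=1$ and $r\ge2$. Let $\Lambda=(\lambda_1,\dots,\lambda_r,-\frac1{n_1})$ be a polarization for $(W,G)$ and let $\tilde\Lambda=(\alpha_1,\dots,\alpha_r,-\frac1{n_1})$ be the associated polarization for $(\mathbf{W},\mathbf{G})$. If all $\alpha_i>0$ and if $$\lambda_2\ \ge\ \frac{a_{21}}{n_1}\,c_1(m_2,\dots,m_r),$$ then $\zeta^{-1}(\mathbf{W}^{ss}(\mathbf{G},\tilde\Lambda))=W^{ss}(G,\Lambda)$ and $\zeta^{-1}(\mathbf{W}^{s}(\mathbf{G},\tilde\Lambda))=W^{s}(G,\Lambda)$.
   Context: Setting (case $s=1$). Over $\mathbb{C}$, let $A_{ji}$ ($1\le i\le j\le r$) and $H_{1i}$ ($1\le i\le r$) be finite dimensional vector spaces, $A_{ii}=\mathbb{C}$, with linear composition maps $H_{1j}\otimes A_{ji}\to H_{1i}$ and $A_{kj}\otimes A_{ji}\to A_{ki}$ (for $i\le j\le k$), which are identities when a factor is $A_{ii}$ and are associative in all possible combinations. These maps and the induced maps $H_{1i}^*\otimes A_{ji}\to H_{1j}^*$ are assumed surjective. Let $M_1,\dots,M_r,N_1$ be finite dimensional vector spaces; lower-case letters denote dimensions ($a_{ji}=\dim A_{ji}$, $m_i=\dim M_i$, $n_1=\dim N_1$). $W=\bigoplus_i\mathrm{Hom}(M_i,N_1\otimes H_{1i})=\bigoplus_i\mathrm{Hom}(H_{1i}^*\otimes M_i,N_1)$, with elements $w=(\phi_{1i})$. $G_L$ is the group of lower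 triangular matrices with diagonal entries $g_i\in GL(M_i)$ and entries $u_{ji}\in\mathrm{Hom}(M_i,M_j\otimes A_{ji})$, $i<j$, multiplied as matrices using the compositions. $G=G_L\times GL(N_1)$ acts on $W$ by $(g,h).w=h\,w\,g^{-1}$. $H\subset G$ is the unipotent subgroup with all $g_i=\mathrm{id}$ and $h=\mathrm{id}$; $G_{red}=\prod GL(M_i)\times GL(N_1)$. $P_i=\bigoplus_{j\ge i}M_j\otimes A_{ji}$; $\xi_i:P_i\otimes A_{i,i-1}\to P_{i-1}$ ($2\le i\le r$) is induced by the compositions. $\mathbf{W}=\bigoplus_{2\le i\le r}\mathrm{Hom}(P_i\otimes A_{i,i-1},P_{i-1})\oplus\mathrm{Hom}(P_1\otimes H_{11}^*,N_1)$, with the natural action of $\mathbf{G}=\prod_iGL(P_i)\times GL(N_1)$. For $w=(\phi_{1i})$, $\gamma(w)\in\mathrm{Hom}(P_1,N_1\otimes H_{11})$ has components $M_i\otimes A_{i1}\to N_1\otimes H_{1i}\otimes A_{i1}\to N_1\otimes H_{11}$. $\zeta(w)=(\xi_2,\dots,\xi_r,\gamma(w))$. Polarizations. A polarization is $\Lambda=(\lambda_1,\dots,\lambda_r,-\mu_1)$ with rational entries, $\sum\lambda_im_i=\mu_1n_1=1$ (so $\mu_1=1/n_1$). The associated polarization is $\tilde\Lambda=(\alpha_1,\dots,\alpha_r,-\mu_1)$ with $\lambda_j=\sum_{i\le j}a_{ji}\alpha_i$. Stability. $w\in W$ is $G_{red}$-semi-stable (resp. stable) if $\sum\lambda_i\dim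 M_i'-\mu_1\dim N_1'\le0$ (resp. $<0$) for all families of subspaces $M_i'\subset M_i$, $N_1'\subset N_1$, not all zero and not all full, with $\phi_{1i}(H_{1i}^*\otimes M_i')\subset N_1'$ for all $i$. $w$ is $G$-semi-stable (resp. $G$-stable) if all points of $Hw$ are $G_{red}$-semi-stable (resp. stable); the sets are $W^{ss}(G,\Lambda)$, $W^s(G,\Lambda)$. A point $(x_2,\dots,x_r,\psi)\in\mathbf{W}$ is semi-stable (resp. stable) w.r.t. $\tilde\Lambda$ if $\sum\alpha_i\dim P_i'-\mu_1\dim Q_1'\le0$ (resp. $<0$) for all families $P_i'\subset P_i$, $Q_1'\subset N_1$, not all zero and not all full, with $x_i(P_i'\otimes A_{i,i-1})\subset P_{i-1}'$ and $\psi(P_1'\otimes H_{11}^* )\subset Q_1'$; the sets are $\mathbf{W}^{ss}(\mathbf{G},\tilde\Lambda)$, $\mathbf{W}^{s}(\mathbf{G},\tilde\Lambda)$. Constant. Let $\delta_1:\bigoplus_{i\ge2}M_i\otimes A_{i1}\otimes H_{11}^*\to\bigoplus_{i\ge2}M_i\otimes H_{1i}^*$ be induced by $A_{i1}\otimes H_{11}^*\to H_{1i}^*$. Let $\mathcal{K}$ be the family of proper linear subspaces $K\subset\bigoplus_{i\ge2}M_i\otimes A_{i1}$ not contained in $\bigoplus_{i\ge2}M_i'\otimes A_{i1}$ for any family of subspaces $(M_i')\ne(M_i)$. Then $c_1(m_2,\dots,m_r)=\sup_{K\in\mathcal{K}}\mathrm{codim}(\delta_1(K\otimes H_{11}^*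 ))/\mathrm{codim}(K)$ (supremum of the empty set is $0$).
   Formalization: It is additionally assumed that M_2 is nonzero when r > 2; if M_2 = 0 is allowed the claim fails, e.g. r = 3, M_1 = M_2 = 0, M_3 = N_1 = C, with a nonzero z in A_32 satisfying z∘A_21 = 0 and H_13∘z = 0. *)

theory Defs
  imports Complex_Main "HOL-Library.Function_Algebras"
begin

section \<open>Complex vector spaces\<close>

text \<open>
  The finite dimensional spaces of a family whose dimensions vary with an index are linear
  subspaces of an ambient complex vector space. This is no restriction, since a family of vector
  spaces embeds into its direct sum.
\<close>

class complex_vector = ab_group_add +
  fixes scaleC :: "complex \<Rightarrow> 'a \<Rightarrow> 'a"  (infixr "*\<^sub>C" 75)
  assumes scaleC_add_right: "c *\<^sub>C (x + y) = c *\<^sub>C x + c *\<^sub>C y"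
    and scaleC_add_left: "(c + d) *\<^sub>C x = c *\<^sub>C x + d *\<^sub>C x"
    and scaleC_scaleC: "c *\<^sub>C (d *\<^sub>C x) = (c * d) *\<^sub>C x"
    and scaleC_one: "1 *\<^sub>C x = x"

instantiation complex :: complex_vector
begin
definition scaleC_complex :: "complex \<Rightarrow> complex \<Rightarrow> complex"
  where "scaleC_complex c x = c * x"
instance
  by standard (simp_all add: scaleC_complex_def algebra_simps)
end

instantiation "fun" :: (type, complex_vector) complex_vector
begin
definition scaleC_fun :: "complex \<Rightarrow> ('a \<Rightarrow> 'b) \<Rightarrow> 'a \<Rightarrow> 'b"
  where "scaleC_fun c f = (\<lambda>x. c *\<^sub>C f x)"
instance
  by standard
    (simp_all add: scaleC_fun_def fun_eq_iff scaleC_add_right scaleC_add_left scaleC_scaleC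
      scaleC_one)
end

global_interpretation cvec: vector_space "scaleC :: complex \<Rightarrow> 'a \<Rightarrow> 'a::complex_vector"
  by unfold_locales (simp_all add: scaleC_add_right scaleC_add_left scaleC_scaleC scaleC_one)

definition fin_dim :: "'a::complex_vector set \<Rightarrow> bool"
  where "fin_dim V \<longleftrightarrow> (\<exists>B. finite B \<and> V = cvec.span B)"

abbreviation dimr :: "'a::complex_vector set \<Rightarrow> real"
  where "dimr V \<equiv> real (cvec.dim V)"

text \<open>
  Linear maps between subspaces are extended by \<open>0\<close> outside their domain, so that
  equality of functions is equality of linear maps and \<open>Hom U V\<close> is again a subspace of a function
  space (in particular \<open>dual U\<close> has the right dimension).
\<close>

definition Hom :: "'a::complex_vector set \<Rightarrow> 'b::complex_vector set \<Rightarrow> ('a \<Rightarrow> 'b) set"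
  where "Hom U V = {f. (\<forall>x\<in>U. f x \<in> V) \<and> (\<forall>x\<in>U. \<forall>y\<in>U. f (x + y) = f x + f y) \<and>
    (\<forall>c. \<forall>x\<in>U. f (c *\<^sub>C x) = c *\<^sub>C f x) \<and> (\<forall>x. x \<notin> U \<longrightarrow> f x = 0)}"

definition restr :: "'a set \<Rightarrow> ('a \<Rightarrow> 'b::complex_vector) \<Rightarrow> 'a \<Rightarrow> 'b"
  where "restr U f = (\<lambda>x. if x \<in> U then f x else 0)"

definition dual :: "'a::complex_vector set \<Rightarrow> ('a \<Rightarrow> complex) set"
  where "dual U = Hom U UNIV"

definition GL :: "'a::complex_vector set \<Rightarrow> ('a \<Rightarrow> 'a) set"
  where "GL U = {f \<in> Hom U U. bij_betw f U U}"

definition dsum :: "nat set \<Rightarrow> (nat \<Rightarrow> 'a::complex_vector set) \<Rightarrow> (nat \<Rightarrow> 'a) set"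
  where "dsum I V = {x. (\<forall>i\<in>I. x i \<in> V i) \<and> (\<forall>i. i \<notin> I \<longrightarrow> x i = 0)}"


section \<open>Tensor products\<close>

text \<open>
  The pure tensor \<open>u \<otimes> v\<close> is the bilinear form \<open>(f, g) \<mapsto> f u * g v\<close> on pairs of linear functionals.
  Over a field this embeds the tensor product; lemma \<open>tensor_universal\<close> below is its universal
  property. If \<open>U' \<subseteq> U\<close> then \<open>U' \<otimes>\<^sub>S V\<close> is literally a subspace of \<open>U \<otimes>\<^sub>S V\<close>.
\<close>

type_synonym ('u, 'v) tensor = "('u \<Rightarrow> complex) \<Rightarrow> ('v \<Rightarrow> complex) \<Rightarrow> complex"

definition tens :: "'u::complex_vector \<Rightarrow> 'v::complex_vector \<Rightarrow> ('u, 'v) tensor"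
    (infixl "\<otimes>" 75)
  where "u \<otimes> v = (\<lambda>f g. if f \<in> dual UNIV \<and> g \<in> dual UNIV then f u * g v else 0)"

definition tspace :: "'u::complex_vector set \<Rightarrow> 'v::complex_vector set \<Rightarrow> ('u, 'v) tensor set"
    (infixl "\<otimes>\<^sub>S" 75)
  where "U \<otimes>\<^sub>S V = cvec.span {u \<otimes> v |u v. u \<in> U \<and> v \<in> V}"

definition bilin_on ::
    "'u::complex_vector set \<Rightarrow> 'v::complex_vector set \<Rightarrow> ('u \<Rightarrow> 'v \<Rightarrow> 'x::complex_vector) \<Rightarrow> bool"
  where "bilin_on U V b \<longleftrightarrow>
    (\<forall>u\<in>U. \<forall>u'\<in>U. \<forall>v\<in>V. b (u + u') v = b u v + b u' v) \<and>
    (\<forall>u\<in>U. \<forall>v\<in>V. \<forall>v'\<in>V. b u (v + v') = b u v + b u v') \<and>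
    (\<forall>c. \<forall>u\<in>U. \<forall>v\<in>V. b (c *\<^sub>C u) v = c *\<^sub>C b u v \<and> b u (c *\<^sub>C v) = c *\<^sub>C b u v)"

text \<open>The linear map on \<open>U \<otimes>\<^sub>S V\<close> induced by a bilinear map \<open>b\<close>.\<close>

definition tlift ::
    "'u::complex_vector set \<Rightarrow> 'v::complex_vector set \<Rightarrow> ('u \<Rightarrow> 'v \<Rightarrow> 'x::complex_vector)
      \<Rightarrow> ('u, 'v) tensor \<Rightarrow> 'x"
  where "tlift U V b = (THE f. f \<in> Hom (U \<otimes>\<^sub>S V) UNIV \<and> (\<forall>u\<in>U. \<forall>v\<in>V. f (u \<otimes> v) = b u v))"

text \<open>\<open>id\<^sub>U \<otimes> f\<close> and \<open>f \<otimes> id\<^sub>V\<close> for a linear map \<open>f\<close> on \<open>V\<close>, respectively \<open>U\<close>.\<close>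

definition tmap_right ::
    "'u::complex_vector set \<Rightarrow> 'v::complex_vector set \<Rightarrow> ('v \<Rightarrow> 'x::complex_vector)
      \<Rightarrow> ('u, 'v) tensor \<Rightarrow> ('u, 'x) tensor"
  where "tmap_right U V f = tlift U V (\<lambda>u v. u \<otimes> f v)"

definition tmap_left ::
    "'u::complex_vector set \<Rightarrow> 'v::complex_vector set \<Rightarrow> ('u \<Rightarrow> 'x::complex_vector)
      \<Rightarrow> ('u, 'v) tensor \<Rightarrow> ('x, 'v) tensor"
  where "tmap_left U V f = tlift U V (\<lambda>u v. f u \<otimes> v)"

text \<open>
  \<open>flat U N H\<close> is the identification of \<open>Hom U (N \<otimes>\<^sub>S H)\<close> with \<open>Hom (U \<otimes>\<^sub>S dual H) N\<close>.
  The two factors of the source are always written in this order.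
\<close>

definition flat ::
    "'u::complex_vector set \<Rightarrow> 'n::complex_vector set \<Rightarrow> 'h::complex_vector set
      \<Rightarrow> ('u \<Rightarrow> ('n, 'h) tensor) \<Rightarrow> ('u, 'h \<Rightarrow> complex) tensor \<Rightarrow> 'n"
  where "flat U N H \<phi> = tlift U (dual H) (\<lambda>u \<eta>. tlift N H (\<lambda>n h. \<eta> h *\<^sub>C n) (\<phi> u))"

text \<open>
  For \<open>f \<in> Hom U (X \<otimes>\<^sub>S B)\<close> and a composition \<open>c\<close> defined on \<open>B \<otimes>\<^sub>S A\<close> with values in \<open>C\<close>, the map
  \<open>U \<otimes>\<^sub>S A \<rightarrow> X \<otimes>\<^sub>S B \<otimes>\<^sub>S A \<rightarrow> X \<otimes>\<^sub>S C\<close>.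
\<close>

definition ext_comp ::
    "'u::complex_vector set \<Rightarrow> 'a::complex_vector set \<Rightarrow> 'x::complex_vector set
      \<Rightarrow> 'b::complex_vector set \<Rightarrow> (('b, 'a) tensor \<Rightarrow> 'c::complex_vector)
      \<Rightarrow> ('u \<Rightarrow> ('x, 'b) tensor) \<Rightarrow> ('u, 'a) tensor \<Rightarrow> ('x, 'c) tensor"
  where "ext_comp U A X B c f = tlift U A (\<lambda>u a. tmap_right X B (\<lambda>b. c (b \<otimes> a)) (f u))"


subsection \<open>Universal property\<close>

lemma dual_UNIV_linear:
  assumes "f \<in> dual (UNIV :: 'a::complex_vector set)"
  shows "f (x + y) = f x + f y" "f (c *\<^sub>C x) = c * f x"
  using assms by (auto simp: dual_def Hom_def scaleC_complex_def)

lemma bilin_on_tens: "bilin_on U V tens"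
  by (auto simp: bilin_on_def tens_def fun_eq_iff dual_UNIV_linear algebra_simps
      scaleC_fun_def scaleC_complex_def)

lemma bilin_on_eqI:
  assumes "bilin_on U V b" "bilin_on U V b'" "cvec.subspace U" "cvec.subspace V"
    and "B \<subseteq> U" "U \<subseteq> cvec.span B" "C \<subseteq> V" "V \<subseteq> cvec.span C"
    and eq: "\<And>x y. x \<in> B \<Longrightarrow> y \<in> C \<Longrightarrow> b x y = b' x y"
    and "u \<in> U" "v \<in> V"
  shows "b u v = b' u v"
proof -
  have b0: "d 0 y = 0" "d x 0 = 0" if "bilin_on U V d" "x \<in> U" "y \<in> V" for d x y
  proof -
    have "d (0 *\<^sub>C x) y = 0 *\<^sub>C d x y" "d x (0 *\<^sub>C y) = 0 *\<^sub>C d x y"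
      using that unfolding bilin_on_def by blast+
    then show "d 0 y = 0" "d x 0 = 0" by simp_all
  qed
  have 1: "b u y = b' u y" if y: "y \<in> C" "y \<in> V" for y
  proof -
    let ?S = "{x \<in> U. b x y = b' x y}"
    have "cvec.subspace ?S"
      unfolding cvec.subspace_def
    proof (intro conjI ballI allI)
      show "0 \<in> ?S"
        using b0(1)[OF assms(1) \<open>u \<in> U\<close> y(2)] b0(1)[OF assms(2) \<open>u \<in> U\<close> y(2)] assms(3)
        by (simp add: cvec.subspace_0)
    next
      fix p q assume "p \<in> ?S" "q \<in> ?S"
      then show "p + q \<in> ?S"
        using assms(1-3) y(2) by (simp add: bilin_on_def cvec.subspace_add)
    next
      fix c p assume "p \<in> ?S"
      then show "c *\<^sub>C p \<in> ?S"
        using assms(1-3) y(2) by (simp add: bilin_on_def cvec.subspace_scale)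
    qed
    moreover have "B \<subseteq> ?S" using assms(5) eq y by auto
    ultimately have "cvec.span B \<subseteq> ?S" by (rule cvec.span_minimal[rotated])
    then show ?thesis using assms(6,10) by auto
  qed
  let ?S = "{y \<in> V. b u y = b' u y}"
  have "cvec.subspace ?S"
    unfolding cvec.subspace_def
  proof (intro conjI ballI allI)
    show "0 \<in> ?S"
      using b0(2)[OF assms(1) assms(10) assms(11)] b0(2)[OF assms(2) assms(10) assms(11)] assms(4)
      by (simp add: cvec.subspace_0)
  next
    fix p q assume "p \<in> ?S" "q \<in> ?S"
    then show "p + q \<in> ?S"
      using assms(1,2,4,10) by (simp add: bilin_on_def cvec.subspace_add)
  next
    fix c p assume "p \<in> ?S"
    then show "c *\<^sub>C p \<in> ?S"
      using assms(1,2,4,10) by (simp add: bilin_on_def cvec.subspace_scale)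
  qed
  moreover have "C \<subseteq> ?S" using assms(7) 1 by auto
  ultimately have "cvec.span C \<subseteq> ?S" by (rule cvec.span_minimal[rotated])
  then show ?thesis using assms(8,11) by auto
qed

lemma ex_coordinate_functional:
  assumes "cvec.independent (B :: 'a::complex_vector set)" "x \<in> B"
  obtains f where "f \<in> dual UNIV" "f x = 1" "\<And>y. y \<in> B \<Longrightarrow> y \<noteq> x \<Longrightarrow> f y = 0"
proof -
  interpret p: vector_space_pair "scaleC :: complex \<Rightarrow> 'a \<Rightarrow> 'a"
    "scaleC :: complex \<Rightarrow> complex \<Rightarrow> complex" by unfold_locales
  obtain f :: "'a \<Rightarrow> complex" where f: "Vector_Spaces.linear scaleC scaleC f"
    and eq: "\<forall>y\<in>B. f y = (if y = x then 1 else 0)"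
    using p.linear_independent_extend[OF assms(1), of "\<lambda>y. if y = x then 1 else 0"] by blast
  have "f \<in> dual UNIV"
    using p.linear_add[OF f] p.linear_scale[OF f] by (auto simp: dual_def Hom_def)
  with eq assms(2) that show thesis by auto
qed

theorem tensor_universal:
  fixes b :: "'u::complex_vector \<Rightarrow> 'v::complex_vector \<Rightarrow> 'x::complex_vector"
  assumes U: "cvec.subspace U" and V: "cvec.subspace V" and b: "bilin_on U V b"
  shows "\<exists>!f. f \<in> Hom (U \<otimes>\<^sub>S V) UNIV \<and> (\<forall>u\<in>U. \<forall>v\<in>V. f (u \<otimes> v) = b u v)"
proof (rule ex_ex1I)
  obtain B where B: "B \<subseteq> U" "cvec.independent B" "U \<subseteq> cvec.span B"
    by (rule cvec.basis_exists[of U])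
  obtain C where C: "C \<subseteq> V" "cvec.independent C" "V \<subseteq> cvec.span C"
    by (rule cvec.basis_exists[of V])
  let ?t = "\<lambda>(u::'u, v::'v). u \<otimes> v"
  have ev: "\<exists>f g. (x \<otimes> y) f g = 1 \<and>
      (\<forall>x'\<in>B. \<forall>y'\<in>C. (x', y') \<noteq> (x, y) \<longrightarrow> (x' \<otimes> y') f g = 0)" if xy: "x \<in> B" "y \<in> C" for x y
  proof -
    obtain f where "f \<in> dual UNIV" "f x = 1" "\<And>y. y \<in> B \<Longrightarrow> y \<noteq> x \<Longrightarrow> f y = 0"
      using ex_coordinate_functional[OF B(2) xy(1)] by blast
    moreover obtain g where "g \<in> dual UNIV" "g y = 1" "\<And>z. z \<in> C \<Longrightarrow> z \<noteq> y \<Longrightarrow> g z = 0"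
      using ex_coordinate_functional[OF C(2) xy(2)] by blast
    ultimately show ?thesis by (intro exI[of _ f] exI[of _ g]) (auto simp: tens_def)
  qed
  have inj: "inj_on ?t (B \<times> C)"
  proof (rule inj_onI, clarify)
    fix x y x' y' assume xy: "x \<in> B" "y \<in> C" "x' \<in> B" "y' \<in> C" "x \<otimes> y = x' \<otimes> y'"
    obtain f g where "(x \<otimes> y) f g = 1"
      "\<And>x' y'. x' \<in> B \<Longrightarrow> y' \<in> C \<Longrightarrow> (x', y') \<noteq> (x, y) \<Longrightarrow> (x' \<otimes> y') f g = 0"
      using ev[OF xy(1,2)] by blast
    with xy show "x = x' \<and> y = y'" by fastforce
  qed
  have ind: "cvec.independent (?t ` (B \<times> C))"
  proof
    assume "cvec.dependent (?t ` (B \<times> C))"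
    then obtain x y where xy: "x \<in> B" "y \<in> C"
      and sp: "x \<otimes> y \<in> cvec.span (?t ` (B \<times> C) - {x \<otimes> y})"
      unfolding cvec.dependent_def by auto
    obtain f g where fg: "(x \<otimes> y) f g = 1"
      "\<And>x' y'. x' \<in> B \<Longrightarrow> y' \<in> C \<Longrightarrow> (x', y') \<noteq> (x, y) \<Longrightarrow> (x' \<otimes> y') f g = 0"
      using ev[OF xy] by blast
    have "cvec.subspace {t :: ('u, 'v) tensor. t f g = 0}"
      by (auto simp: cvec.subspace_def scaleC_fun_def scaleC_complex_def)
    moreover have "?t ` (B \<times> C) - {x \<otimes> y} \<subseteq> {t. t f g = 0}"
      using fg(2) by auto
    ultimately have "(x \<otimes> y) f g = 0" using sp cvec.span_minimal by blast
    with fg(1) show False by simp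
  qed
  interpret p: vector_space_pair "scaleC :: complex \<Rightarrow> ('u, 'v) tensor \<Rightarrow> ('u, 'v) tensor"
    "scaleC :: complex \<Rightarrow> 'x \<Rightarrow> 'x" by unfold_locales
  obtain F where F: "Vector_Spaces.linear scaleC scaleC F"
    and Feq: "\<forall>t\<in>?t ` (B \<times> C). F t = (\<lambda>(u, v). b u v) (inv_into (B \<times> C) ?t t)"
    using p.linear_independent_extend[OF ind,
        of "\<lambda>t. (\<lambda>(u, v). b u v) (inv_into (B \<times> C) ?t t)"] by blast
  have FBC: "F (x \<otimes> y) = b x y" if "x \<in> B" "y \<in> C" for x y
    using bspec[OF Feq, of "?t (x, y)"] inv_into_f_f[OF inj, of "(x, y)"] that by auto
  have "bilin_on U V (\<lambda>u v. F (u \<otimes> v))"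
    using bilin_on_tens[of U V] unfolding bilin_on_def
    by (auto simp: p.linear_add[OF F] p.linear_scale[OF F])
  then have FUV: "F (u \<otimes> v) = b u v" if "u \<in> U" "v \<in> V" for u v
    using bilin_on_eqI[OF _ b U V B(1,3) C(1,3) _ that, of "\<lambda>u v. F (u \<otimes> v)"] FBC by blast
  have "\<And>u v. u \<in> U \<Longrightarrow> v \<in> V \<Longrightarrow> u \<otimes> v \<in> U \<otimes>\<^sub>S V"
    unfolding tspace_def by (rule cvec.span_base) blast
  moreover have "x + y \<in> U \<otimes>\<^sub>S V" "c *\<^sub>C x \<in> U \<otimes>\<^sub>S V"
    if "x \<in> U \<otimes>\<^sub>S V" "y \<in> U \<otimes>\<^sub>S V" for x y c
    using that unfolding tspace_def by (auto intro: cvec.span_add cvec.span_scale)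
  ultimately show "\<exists>f. f \<in> Hom (U \<otimes>\<^sub>S V) UNIV \<and> (\<forall>u\<in>U. \<forall>v\<in>V. f (u \<otimes> v) = b u v)"
    by (intro exI[of _ "restr (U \<otimes>\<^sub>S V) F"])
      (auto simp: Hom_def restr_def FUV p.linear_add[OF F] p.linear_scale[OF F])
next
  fix f f' :: "('u, 'v) tensor \<Rightarrow> 'x"
  assume f: "f \<in> Hom (U \<otimes>\<^sub>S V) UNIV \<and> (\<forall>u\<in>U. \<forall>v\<in>V. f (u \<otimes> v) = b u v)"
    and f': "f' \<in> Hom (U \<otimes>\<^sub>S V) UNIV \<and> (\<forall>u\<in>U. \<forall>v\<in>V. f' (u \<otimes> v) = b u v)"
  have sub: "cvec.subspace (U \<otimes>\<^sub>S V)" by (simp add: tspace_def)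
  have zero: "d 0 = 0" if "d \<in> Hom (U \<otimes>\<^sub>S V) UNIV" for d :: "('u, 'v) tensor \<Rightarrow> 'x"
  proof -
    have "d (0 *\<^sub>C 0) = 0 *\<^sub>C d 0"
      using that cvec.subspace_0[OF sub] unfolding Hom_def by blast
    then show ?thesis by simp
  qed
  let ?S = "{t \<in> U \<otimes>\<^sub>S V. f t = f' t}"
  have "cvec.subspace ?S"
    unfolding cvec.subspace_def using f f' zero[of f] zero[of f'] sub
    by (auto simp: Hom_def cvec.subspace_0 cvec.subspace_add cvec.subspace_scale)
  moreover have "{u \<otimes> v |u v. u \<in> U \<and> v \<in> V} \<subseteq> ?S"
    using f f' by (auto simp: tspace_def intro: cvec.span_base)
  ultimately have "cvec.span {u \<otimes> v |u v. u \<in> U \<and> v \<in> V} \<subseteq> ?S"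
    by (rule cvec.span_minimal[rotated])
  then have S: "U \<otimes>\<^sub>S V \<subseteq> ?S" by (simp only: tspace_def)
  show "f = f'"
  proof
    fix t
    show "f t = f' t"
    proof (cases "t \<in> U \<otimes>\<^sub>S V")
      case True
      then show ?thesis using S by blast
    next
      case False
      then show ?thesis using f f' by (simp add: Hom_def)
    qed
  qed
qed

corollary tlift:
  assumes "cvec.subspace U" "cvec.subspace V" "bilin_on U V b"
  shows "tlift U V b \<in> Hom (U \<otimes>\<^sub>S V) UNIV"
    and "u \<in> U \<Longrightarrow> v \<in> V \<Longrightarrow> tlift U V b (u \<otimes> v) = b u v"
  using theI'[OF tensor_universal[OF assms]] unfolding tlift_def by auto


section \<open>The setting\<close>

text \<open>
  Indices run over \<open>1 \<le> i \<le> j \<le> k \<le> rk D\<close>. \<open>spA D j i\<close>, \<open>spH D i\<close>, \<open>spM D i\<close>, \<open>spN D\<close> stand for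
  \<open>A\<^sub>j\<^sub>i\<close>, \<open>H\<^sub>1\<^sub>i\<close>, \<open>M\<^sub>i\<close>, \<open>N\<^sub>1\<close>; \<open>unitA D i\<close> is the number \<open>1\<close> in \<open>A\<^sub>i\<^sub>i = \<complex>\<close>;
  \<open>compA D k j i\<close> and \<open>compH D j i\<close> are the compositions \<open>A\<^sub>k\<^sub>j \<otimes> A\<^sub>j\<^sub>i \<rightarrow> A\<^sub>k\<^sub>i\<close> and
  \<open>H\<^sub>1\<^sub>j \<otimes> A\<^sub>j\<^sub>i \<rightarrow> H\<^sub>1\<^sub>i\<close>.
\<close>

record ('a, 'h, 'm, 'n) comp_data =
  rk :: nat
  spA :: "nat \<Rightarrow> nat \<Rightarrow> 'a set"
  spH :: "nat \<Rightarrow> 'h set"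
  spM :: "nat \<Rightarrow> 'm set"
  spN :: "'n set"
  unitA :: "nat \<Rightarrow> 'a"
  compA :: "nat \<Rightarrow> nat \<Rightarrow> nat \<Rightarrow> ('a, 'a) tensor \<Rightarrow> 'a"
  compH :: "nat \<Rightarrow> nat \<Rightarrow> ('h, 'a) tensor \<Rightarrow> 'h"

text \<open>The induced map \<open>H\<^sub>1\<^sub>i\<^sup>* \<otimes> A\<^sub>j\<^sub>i \<rightarrow> H\<^sub>1\<^sub>j\<^sup>*\<close>.\<close>

definition ind_dual ::
    "('a::complex_vector, 'h::complex_vector, 'm, 'n) comp_data \<Rightarrow> nat \<Rightarrow> nat
      \<Rightarrow> ('h \<Rightarrow> complex, 'a) tensor \<Rightarrow> 'h \<Rightarrow> complex"
  where "ind_dual D j i = tlift (dual (spH D i)) (spA D j i)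
    (\<lambda>\<eta> a. restr (spH D j) (\<lambda>h. \<eta> (compH D j i (h \<otimes> a))))"

locale comp_setting =
  fixes D :: "('a::complex_vector, 'h::complex_vector, 'm::complex_vector, 'n::complex_vector)
    comp_data"
  assumes fin_dim_A: "1 \<le> i \<Longrightarrow> i \<le> j \<Longrightarrow> j \<le> rk D \<Longrightarrow> fin_dim (spA D j i)"
    and fin_dim_H: "1 \<le> i \<Longrightarrow> i \<le> rk D \<Longrightarrow> fin_dim (spH D i)"
    and fin_dim_M: "1 \<le> i \<Longrightarrow> i \<le> rk D \<Longrightarrow> fin_dim (spM D i)"
    and fin_dim_N: "fin_dim (spN D)"
    and A_diag: "1 \<le> i \<Longrightarrow> i \<le> rk D \<Longrightarrow>
      unitA D i \<noteq> 0 \<and> spA D i i = cvec.span {unitA D i}"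
    and compA_hom: "1 \<le> i \<Longrightarrow> i \<le> j \<Longrightarrow> j \<le> k \<Longrightarrow> k \<le> rk D \<Longrightarrow>
      compA D k j i \<in> Hom (spA D k j \<otimes>\<^sub>S spA D j i) (spA D k i)"
    and compH_hom: "1 \<le> i \<Longrightarrow> i \<le> j \<Longrightarrow> j \<le> rk D \<Longrightarrow>
      compH D j i \<in> Hom (spH D j \<otimes>\<^sub>S spA D j i) (spH D i)"
    and unit_left: "1 \<le> i \<Longrightarrow> i \<le> j \<Longrightarrow> j \<le> rk D \<Longrightarrow> a \<in> spA D j i \<Longrightarrow>
      compA D j j i (unitA D j \<otimes> a) = a"
    and unit_right: "1 \<le> i \<Longrightarrow> i \<le> j \<Longrightarrow> j \<le> rk D \<Longrightarrow> a \<in> spA D j i \<Longrightarrow>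
      compA D j i i (a \<otimes> unitA D i) = a"
    and unit_H: "1 \<le> i \<Longrightarrow> i \<le> rk D \<Longrightarrow> h \<in> spH D i \<Longrightarrow> compH D i i (h \<otimes> unitA D i) = h"
    and assoc_A: "1 \<le> i \<Longrightarrow> i \<le> j \<Longrightarrow> j \<le> k \<Longrightarrow> k \<le> l \<Longrightarrow> l \<le> rk D \<Longrightarrow>
      c \<in> spA D l k \<Longrightarrow> b \<in> spA D k j \<Longrightarrow> a \<in> spA D j i \<Longrightarrow>
      compA D l j i (compA D l k j (c \<otimes> b) \<otimes> a) = compA D l k i (c \<otimes> compA D k j i (b \<otimes> a))"
    and assoc_H: "1 \<le> i \<Longrightarrow> i \<le> j \<Longrightarrow> j \<le> k \<Longrightarrow> k \<le> rk D \<Longrightarrow>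
      h \<in> spH D k \<Longrightarrow> b \<in> spA D k j \<Longrightarrow> a \<in> spA D j i \<Longrightarrow>
      compH D j i (compH D k j (h \<otimes> b) \<otimes> a) = compH D k i (h \<otimes> compA D k j i (b \<otimes> a))"
    and compA_surj: "1 \<le> i \<Longrightarrow> i \<le> j \<Longrightarrow> j \<le> k \<Longrightarrow> k \<le> rk D \<Longrightarrow>
      compA D k j i ` (spA D k j \<otimes>\<^sub>S spA D j i) = spA D k i"
    and compH_surj: "1 \<le> i \<Longrightarrow> i \<le> j \<Longrightarrow> j \<le> rk D \<Longrightarrow>
      compH D j i ` (spH D j \<otimes>\<^sub>S spA D j i) = spH D i"
    and ind_dual_surj: "1 \<le> i \<Longrightarrow> i \<le> j \<Longrightarrow> j \<le> rk D \<Longrightarrow>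
      ind_dual D j i ` (dual (spH D i) \<otimes>\<^sub>S spA D j i) = dual (spH D j)"


section \<open>The space \<open>W\<close> and the group \<open>G\<close>\<close>

definition W_space ::
    "('a, 'h::complex_vector, 'm::complex_vector, 'n::complex_vector) comp_data
      \<Rightarrow> (nat \<Rightarrow> 'm \<Rightarrow> ('n, 'h) tensor) set"
  where "W_space D = dsum {1..rk D} (\<lambda>i. Hom (spM D i) (spN D \<otimes>\<^sub>S spH D i))"

text \<open>For \<open>\<phi>\<^sub>1\<^sub>j\<close> a component of \<open>w\<close>, the map
  \<open>M\<^sub>j \<otimes> A\<^sub>j\<^sub>i \<rightarrow> N\<^sub>1 \<otimes> H\<^sub>1\<^sub>j \<otimes> A\<^sub>j\<^sub>i \<rightarrow> N\<^sub>1 \<otimes> H\<^sub>1\<^sub>i\<close>.\<close>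

definition ext_W ::
    "('a::complex_vector, 'h::complex_vector, 'm::complex_vector, 'n::complex_vector) comp_data
      \<Rightarrow> (nat \<Rightarrow> 'm \<Rightarrow> ('n, 'h) tensor) \<Rightarrow> nat \<Rightarrow> nat \<Rightarrow> ('m, 'a) tensor \<Rightarrow> ('n, 'h) tensor"
  where "ext_W D w j i =
    ext_comp (spM D j) (spA D j i) (spN D) (spH D j) (compH D j i) (w j)"

text \<open>
  The entry of a lower triangular matrix in row \<open>j\<close> and column \<open>i \<le> j\<close> is an element of
  \<open>Hom (M\<^sub>i) (M\<^sub>j \<otimes> A\<^sub>j\<^sub>i)\<close>; on the diagonal \<open>M\<^sub>i \<otimes> A\<^sub>i\<^sub>i\<close> is identified with \<open>M\<^sub>i\<close> by
  \<open>m \<otimes> 1 \<mapsto> m\<close>.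
\<close>

type_synonym ('m, 'a) lmat = "nat \<Rightarrow> nat \<Rightarrow> 'm \<Rightarrow> ('m, 'a) tensor"

definition G_L ::
    "('a::complex_vector, 'h, 'm::complex_vector, 'n) comp_data \<Rightarrow> ('m, 'a) lmat set"
  where "G_L D = {g.
    (\<forall>j i. 1 \<le> i \<and> i \<le> j \<and> j \<le> rk D \<longrightarrow> g j i \<in> Hom (spM D i) (spM D j \<otimes>\<^sub>S spA D j i)) \<and>
    (\<forall>j i. \<not> (1 \<le> i \<and> i \<le> j \<and> j \<le> rk D) \<longrightarrow> g j i = 0) \<and>
    (\<forall>i\<in>{1..rk D}. \<exists>f\<in>GL (spM D i). g i i = restr (spM D i) (\<lambda>m. f m \<otimes> unitA D i))}"

definition lmat_mult ::
    "('a::complex_vector, 'h, 'm::complex_vector, 'n) comp_data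
      \<Rightarrow> ('m, 'a) lmat \<Rightarrow> ('m, 'a) lmat \<Rightarrow> ('m, 'a) lmat"
  where "lmat_mult D g g' = (\<lambda>k i. if 1 \<le> i \<and> i \<le> k \<and> k \<le> rk D
    then (\<lambda>m. \<Sum>j=i..k.
      ext_comp (spM D j) (spA D j i) (spM D k) (spA D k j) (compA D k j i) (g k j) (g' j i m))
    else 0)"

definition lmat_one ::
    "('a::complex_vector, 'h, 'm::complex_vector, 'n) comp_data \<Rightarrow> ('m, 'a) lmat"
  where "lmat_one D = (\<lambda>j i. if j = i \<and> i \<in> {1..rk D}
    then restr (spM D i) (\<lambda>m. m \<otimes> unitA D i) else 0)"

definition lmat_inv ::
    "('a::complex_vector, 'h, 'm::complex_vector, 'n) comp_data \<Rightarrow> ('m, 'a) lmat \<Rightarrow> ('m, 'a) lmat"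
  where "lmat_inv D g = (THE g'. g' \<in> G_L D \<and>
    lmat_mult D g g' = lmat_one D \<and> lmat_mult D g' g = lmat_one D)"

definition G_grp ::
    "('a::complex_vector, 'h, 'm::complex_vector, 'n::complex_vector) comp_data
      \<Rightarrow> (('m, 'a) lmat \<times> ('n \<Rightarrow> 'n)) set"
  where "G_grp D = G_L D \<times> GL (spN D)"

definition H_grp ::
    "('a::complex_vector, 'h, 'm::complex_vector, 'n::complex_vector) comp_data
      \<Rightarrow> (('m, 'a) lmat \<times> ('n \<Rightarrow> 'n)) set"
  where "H_grp D = {(g, h) \<in> G_grp D.
    (\<forall>i\<in>{1..rk D}. g i i = lmat_one D i i) \<and> h = restr (spN D) (\<lambda>n. n)}"

text \<open>\<open>(g, h).w = h w g\<^sup>-\<^sup>1\<close>, where \<open>w\<close> is a row.\<close>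

definition act ::
    "('a::complex_vector, 'h::complex_vector, 'm::complex_vector, 'n::complex_vector) comp_data
      \<Rightarrow> ('m, 'a) lmat \<times> ('n \<Rightarrow> 'n) \<Rightarrow> (nat \<Rightarrow> 'm \<Rightarrow> ('n, 'h) tensor)
      \<Rightarrow> (nat \<Rightarrow> 'm \<Rightarrow> ('n, 'h) tensor)"
  where "act D = (\<lambda>(g, h) w i. if i \<in> {1..rk D}
    then (\<lambda>m. tmap_left (spN D) (spH D i) h
      (\<Sum>j=i..rk D. ext_W D w j i (lmat_inv D g j i m)))
    else 0)"


section \<open>The space \<open>\<^bold>W\<close> and the map \<open>\<zeta>\<close>\<close>

type_synonym ('m, 'a) pvec = "nat \<Rightarrow> ('m, 'a) tensor"

definition P_space ::
    "('a::complex_vector, 'h, 'm::complex_vector, 'n) comp_data \<Rightarrow> nat \<Rightarrow> ('m, 'a) pvec set"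
  where "P_space D i = dsum {i..rk D} (\<lambda>j. spM D j \<otimes>\<^sub>S spA D j i)"

definition xi ::
    "('a::complex_vector, 'h, 'm::complex_vector, 'n) comp_data
      \<Rightarrow> nat \<Rightarrow> (('m, 'a) pvec, 'a) tensor \<Rightarrow> ('m, 'a) pvec"
  where "xi D i = tlift (P_space D i) (spA D i (i - 1))
    (\<lambda>p a j. if j \<in> {i..rk D}
      then tmap_right (spM D j) (spA D j i) (\<lambda>b. compA D j i (i - 1) (b \<otimes> a)) (p j) else 0)"

definition bW_space ::
    "('a::complex_vector, 'h::complex_vector, 'm::complex_vector, 'n::complex_vector) comp_data
      \<Rightarrow> ((nat \<Rightarrow> (('m, 'a) pvec, 'a) tensor \<Rightarrow> ('m, 'a) pvec) \<times>
         ((('m, 'a) pvec, 'h \<Rightarrow> complex) tensor \<Rightarrow> 'n)) set"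
  where "bW_space D =
    dsum {2..rk D} (\<lambda>i. Hom (P_space D i \<otimes>\<^sub>S spA D i (i - 1)) (P_space D (i - 1))) \<times>
    Hom (P_space D 1 \<otimes>\<^sub>S dual (spH D 1)) (spN D)"

definition gamma_map ::
    "('a::complex_vector, 'h::complex_vector, 'm::complex_vector, 'n::complex_vector) comp_data
      \<Rightarrow> (nat \<Rightarrow> 'm \<Rightarrow> ('n, 'h) tensor) \<Rightarrow> ('m, 'a) pvec \<Rightarrow> ('n, 'h) tensor"
  where "gamma_map D w = restr (P_space D 1) (\<lambda>p. \<Sum>i=1..rk D. ext_W D w i 1 (p i))"

definition zeta ::
    "('a::complex_vector, 'h::complex_vector, 'm::complex_vector, 'n::complex_vector) comp_data
      \<Rightarrow> (nat \<Rightarrow> 'm \<Rightarrow> ('n, 'h) tensor)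
      \<Rightarrow> (nat \<Rightarrow> (('m, 'a) pvec, 'a) tensor \<Rightarrow> ('m, 'a) pvec) \<times>
         ((('m, 'a) pvec, 'h \<Rightarrow> complex) tensor \<Rightarrow> 'n)"
  where "zeta D w =
    ((\<lambda>i. if i \<in> {2..rk D} then xi D i else 0),
     flat (P_space D 1) (spN D) (spH D 1) (gamma_map D w))"


section \<open>Polarizations and stability\<close>

text \<open>A polarization \<open>(l 1, \<dots>, l r, - mu)\<close>; only the values \<open>l i\<close> with \<open>1 \<le> i \<le> rk D\<close> matter.\<close>

definition polarization ::
    "('a, 'h, 'm::complex_vector, 'n::complex_vector) comp_data \<Rightarrow> (nat \<Rightarrow> real) \<Rightarrow> real \<Rightarrow> bool"
  where "polarization D l mu \<longleftrightarrow> (\<forall>i\<in>{1..rk D}. l i \<in> \<rat>) \<and> mu \<in> \<rat> \<and>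
    (\<Sum>i=1..rk D. l i * dimr (spM D i)) = 1 \<and> mu * dimr (spN D) = 1"

definition associated_polarization ::
    "('a::complex_vector, 'h, 'm, 'n) comp_data \<Rightarrow> (nat \<Rightarrow> real) \<Rightarrow> (nat \<Rightarrow> real) \<Rightarrow> bool"
  where "associated_polarization D l al \<longleftrightarrow>
    (\<forall>j\<in>{1..rk D}. l j = (\<Sum>i=1..j. dimr (spA D j i) * al i))"

text \<open>Families of subspaces \<open>V' i \<subseteq> V i\<close>, \<open>Q' \<subseteq> Q\<close>, not all zero and not all full.\<close>

definition proper_families ::
    "nat \<Rightarrow> (nat \<Rightarrow> 'v::complex_vector set) \<Rightarrow> 'q::complex_vector set
      \<Rightarrow> ((nat \<Rightarrow> 'v set) \<times> 'q set) set"
  where "proper_families r V Q = {(V', Q').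
    (\<forall>i\<in>{1..r}. cvec.subspace (V' i) \<and> V' i \<subseteq> V i) \<and> cvec.subspace Q' \<and> Q' \<subseteq> Q \<and>
    \<not> ((\<forall>i\<in>{1..r}. V' i = {0}) \<and> Q' = {0}) \<and>
    \<not> ((\<forall>i\<in>{1..r}. V' i = V i) \<and> Q' = Q)}"

definition invariant_families_W ::
    "('a, 'h::complex_vector, 'm::complex_vector, 'n::complex_vector) comp_data
      \<Rightarrow> (nat \<Rightarrow> 'm \<Rightarrow> ('n, 'h) tensor) \<Rightarrow> ((nat \<Rightarrow> 'm set) \<times> 'n set) set"
  where "invariant_families_W D w = {(M', N') \<in> proper_families (rk D) (spM D) (spN D).
    \<forall>i\<in>{1..rk D}.
      flat (spM D i) (spN D) (spH D i) (w i) ` (M' i \<otimes>\<^sub>S dual (spH D i)) \<subseteq> N'}"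

definition Gred_semistable ::
    "('a, 'h::complex_vector, 'm::complex_vector, 'n::complex_vector) comp_data
      \<Rightarrow> (nat \<Rightarrow> real) \<Rightarrow> real \<Rightarrow> (nat \<Rightarrow> 'm \<Rightarrow> ('n, 'h) tensor) \<Rightarrow> bool"
  where "Gred_semistable D l mu w \<longleftrightarrow> (\<forall>(M', N')\<in>invariant_families_W D w.
    (\<Sum>i=1..rk D. l i * dimr (M' i)) - mu * dimr N' \<le> 0)"

definition Gred_stable ::
    "('a, 'h::complex_vector, 'm::complex_vector, 'n::complex_vector) comp_data
      \<Rightarrow> (nat \<Rightarrow> real) \<Rightarrow> real \<Rightarrow> (nat \<Rightarrow> 'm \<Rightarrow> ('n, 'h) tensor) \<Rightarrow> bool"
  where "Gred_stable D l mu w \<longleftrightarrow> (\<forall>(M', N')\<in>invariant_families_W D w.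
    (\<Sum>i=1..rk D. l i * dimr (M' i)) - mu * dimr N' < 0)"

definition W_semistable ::
    "('a::complex_vector, 'h::complex_vector, 'm::complex_vector, 'n::complex_vector) comp_data
      \<Rightarrow> (nat \<Rightarrow> real) \<Rightarrow> real \<Rightarrow> (nat \<Rightarrow> 'm \<Rightarrow> ('n, 'h) tensor) set"
  where "W_semistable D l mu =
    {w \<in> W_space D. \<forall>u\<in>H_grp D. Gred_semistable D l mu (act D u w)}"

definition W_stable ::
    "('a::complex_vector, 'h::complex_vector, 'm::complex_vector, 'n::complex_vector) comp_data
      \<Rightarrow> (nat \<Rightarrow> real) \<Rightarrow> real \<Rightarrow> (nat \<Rightarrow> 'm \<Rightarrow> ('n, 'h) tensor) set"
  where "W_stable D l mu =
    {w \<in> W_space D. \<forall>u\<in>H_grp D. Gred_stable D l mu (act D u w)}"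

definition invariant_families_bW ::
    "('a::complex_vector, 'h::complex_vector, 'm::complex_vector, 'n::complex_vector) comp_data
      \<Rightarrow> (nat \<Rightarrow> (('m, 'a) pvec, 'a) tensor \<Rightarrow> ('m, 'a) pvec) \<times>
         ((('m, 'a) pvec, 'h \<Rightarrow> complex) tensor \<Rightarrow> 'n)
      \<Rightarrow> ((nat \<Rightarrow> ('m, 'a) pvec set) \<times> 'n set) set"
  where "invariant_families_bW D = (\<lambda>(x, \<psi>).
    {(P', Q') \<in> proper_families (rk D) (P_space D) (spN D).
      (\<forall>i\<in>{2..rk D}. x i ` (P' i \<otimes>\<^sub>S spA D i (i - 1)) \<subseteq> P' (i - 1)) \<and>
      \<psi> ` (P' 1 \<otimes>\<^sub>S dual (spH D 1)) \<subseteq> Q'})"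

definition bW_semistable ::
    "('a::complex_vector, 'h::complex_vector, 'm::complex_vector, 'n::complex_vector) comp_data
      \<Rightarrow> (nat \<Rightarrow> real) \<Rightarrow> real
      \<Rightarrow> ((nat \<Rightarrow> (('m, 'a) pvec, 'a) tensor \<Rightarrow> ('m, 'a) pvec) \<times>
         ((('m, 'a) pvec, 'h \<Rightarrow> complex) tensor \<Rightarrow> 'n)) set"
  where "bW_semistable D al mu = {y \<in> bW_space D. \<forall>(P', Q')\<in>invariant_families_bW D y.
    (\<Sum>i=1..rk D. al i * dimr (P' i)) - mu * dimr Q' \<le> 0}"

definition bW_stable ::
    "('a::complex_vector, 'h::complex_vector, 'm::complex_vector, 'n::complex_vector) comp_data
      \<Rightarrow> (nat \<Rightarrow> real) \<Rightarrow> real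
      \<Rightarrow> ((nat \<Rightarrow> (('m, 'a) pvec, 'a) tensor \<Rightarrow> ('m, 'a) pvec) \<times>
         ((('m, 'a) pvec, 'h \<Rightarrow> complex) tensor \<Rightarrow> 'n)) set"
  where "bW_stable D al mu = {y \<in> bW_space D. \<forall>(P', Q')\<in>invariant_families_bW D y.
    (\<Sum>i=1..rk D. al i * dimr (P' i)) - mu * dimr Q' < 0}"


section \<open>The constant \<open>c\<^sub>1\<close>\<close>

definition MA_sum ::
    "('a::complex_vector, 'h, 'm::complex_vector, 'n) comp_data \<Rightarrow> (nat \<Rightarrow> 'm set)
      \<Rightarrow> ('m, 'a) pvec set"
  where "MA_sum D M' = dsum {2..rk D} (\<lambda>i. M' i \<otimes>\<^sub>S spA D i 1)"

definition MH_sum ::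
    "('a, 'h::complex_vector, 'm::complex_vector, 'n) comp_data
      \<Rightarrow> (nat \<Rightarrow> ('m, 'h \<Rightarrow> complex) tensor) set"
  where "MH_sum D = dsum {2..rk D} (\<lambda>i. spM D i \<otimes>\<^sub>S dual (spH D i))"

text \<open>The map \<open>\<delta>\<^sub>1\<close>, its source being written as \<open>MA_sum D (spM D) \<otimes>\<^sub>S dual (spH D 1)\<close>.\<close>

definition delta1 ::
    "('a::complex_vector, 'h::complex_vector, 'm::complex_vector, 'n) comp_data
      \<Rightarrow> (('m, 'a) pvec, 'h \<Rightarrow> complex) tensor \<Rightarrow> nat \<Rightarrow> ('m, 'h \<Rightarrow> complex) tensor"
  where "delta1 D = tlift (MA_sum D (spM D)) (dual (spH D 1))
    (\<lambda>q \<eta> i. if i \<in> {2..rk D}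
      then tmap_right (spM D i) (spA D i 1) (\<lambda>a. ind_dual D i 1 (\<eta> \<otimes> a)) (q i) else 0)"

definition K_family ::
    "('a::complex_vector, 'h, 'm::complex_vector, 'n) comp_data \<Rightarrow> ('m, 'a) pvec set set"
  where "K_family D = {K. cvec.subspace K \<and> K \<subset> MA_sum D (spM D) \<and>
    (\<forall>M'. (\<forall>i\<in>{2..rk D}. cvec.subspace (M' i) \<and> M' i \<subseteq> spM D i) \<and>
      (\<exists>i\<in>{2..rk D}. M' i \<noteq> spM D i) \<longrightarrow> \<not> K \<subseteq> MA_sum D M')}"

definition c1 :: "('a::complex_vector, 'h::complex_vector, 'm::complex_vector, 'n) comp_data \<Rightarrow> real"
  where "c1 D = (if K_family D = {} then 0 else
    (SUP K\<in>K_family D.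
      (dimr (MH_sum D) - dimr (delta1 D ` (K \<otimes>\<^sub>S dual (spH D 1)))) /
      (dimr (MA_sum D (spM D)) - dimr K)))"

end

theory Submission
  imports Defs
begin

text \<open>
  A family \<open>M'\<close> invariant under \<open>w\<close> generates the invariant family \<open>P'\<^sub>i = \<Oplus>\<^sub>j M'\<^sub>j \<otimes> A\<^sub>j\<^sub>i\<close> of \<open>\<zeta>(w)\<close>,
  and both have the same value because \<open>\<lambda>\<^sub>j = \<Sum>\<^sub>i a\<^sub>j\<^sub>i \<alpha>\<^sub>i\<close>; unipotent translates of \<open>w\<close> are handled by the
  corresponding automorphism of \<open>P\<^sub>1\<close>. So (semi-)stability of \<open>\<zeta>(w)\<close> implies that of \<open>w\<close>.

  The converse first uses the bound on \<open>\<lambda>\<^sub>2\<close> to get rid of \<open>M\<^sub>j\<close> for \<open>j > 2\<close>. If \<open>M\<^sub>2\<close> and \<open>M\<^sub>j\<close> are both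
  nonzero, then \<open>c\<^sub>1 \<ge> h\<^sub>1\<^sub>j / a\<^sub>j\<^sub>1\<close>, and positivity of the \<open>\<alpha>\<^sub>i\<close> together with
  \<open>a\<^sub>j\<^sub>1 \<le> a\<^sub>j\<^sub>2 a\<^sub>2\<^sub>1\<close> yields \<open>\<lambda>\<^sub>j > h\<^sub>1\<^sub>j / n\<^sub>1\<close>; but the family generated by one vector of \<open>M\<^sub>j\<close> shows
  \<open>\<lambda>\<^sub>j \<le> h\<^sub>1\<^sub>j / n\<^sub>1\<close> for semi-stable \<open>w\<close>.

  When only \<open>M\<^sub>1\<close> and \<open>M\<^sub>2\<close> remain, let \<open>(P', Q')\<close> be invariant under \<open>\<zeta>(w)\<close>, let
  \<open>K = P'\<^sub>1 \<inter> (M\<^sub>2 \<otimes> A\<^sub>2\<^sub>1)\<close>, let \<open>M'\<^sub>1\<close> be the projection of \<open>P'\<^sub>1\<close> to \<open>M\<^sub>1\<close>, and \<open>M'\<^sub>2\<close> minimal with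
  \<open>K \<subseteq> M'\<^sub>2 \<otimes> A\<^sub>2\<^sub>1\<close>. A linear lift of \<open>M'\<^sub>1\<close> to \<open>P'\<^sub>1\<close> defines a unipotent translate of \<open>w\<close> under which
  \<open>M'\<close> and \<open>N' = Q' + \<phi>\<^sub>1\<^sub>2(H\<^sub>1\<^sub>2\<^sup>* \<otimes> M'\<^sub>2)\<close> are invariant. With \<open>d\<close> the codimension of \<open>K\<close> in
  \<open>M'\<^sub>2 \<otimes> A\<^sub>2\<^sub>1\<close> one has \<open>dim N' \<le> dim Q' + c\<^sub>1 d\<close> and \<open>a\<^sub>2\<^sub>1 dim P'\<^sub>2 \<le> a\<^sub>2\<^sub>1 dim M'\<^sub>2 - d\<close>, so the bound on
  \<open>\<lambda>\<^sub>2\<close> makes the value of \<open>(M', N')\<close> at least that of \<open>(P', Q')\<close>.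
\<close>

section \<open>Linear algebra on subspaces\<close>

text \<open>The bound on \<lambda>_2 is exactly the exchange rate of the comparison. Invariance of
  (P', Q') only sends the products of K with H_11^* into Q', whereas the test family needs the image
  of all of M'_2 \<otimes> H_12^*; the quotient in c_1 measures what is missing per unit of d, a
  loss of at most c_1 d / n_1. The gain is \<alpha>_1 d in degree 1 and at least \<alpha>_2 d / a_21
  in degree 2, together \<lambda>_2 d / a_21.

  The obstacle is the size of H: lifting M'_1 corrects only entries that start in M_1, while a
  nonzero M_j with j > 2 brings in further entries. Once these M_j vanish, H is reduced to the
  single entry M_1 -> M_2 \<otimes> A_21. The first implication uses this too: it treats only
  translates by such entries, but w itself is one of them, its semi-stability forces the vanishing,
  and so the whole orbit is covered.

  Stability needs extra care because an equality of values is possible; in that case the test family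
  has to be neither zero nor full.\<close>

definition lin_on :: "'a::complex_vector set \<Rightarrow> ('a \<Rightarrow> 'b::complex_vector) \<Rightarrow> bool"
  where "lin_on U f \<longleftrightarrow> (\<forall>x\<in>U. \<forall>y\<in>U. f (x + y) = f x + f y) \<and> (\<forall>c. \<forall>x\<in>U. f (c *\<^sub>C x) = c *\<^sub>C f x)"

lemma lin_onI:
  assumes "\<And>x y. x \<in> U \<Longrightarrow> y \<in> U \<Longrightarrow> f (x + y) = f x + f y"
    and "\<And>c x. x \<in> U \<Longrightarrow> f (c *\<^sub>C x) = c *\<^sub>C f x"
  shows "lin_on U f"
  using assms by (simp add: lin_on_def)

lemma lin_on_add: "lin_on U f \<Longrightarrow> x \<in> U \<Longrightarrow> y \<in> U \<Longrightarrow> f (x + y) = f x + f y"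
  by (simp add: lin_on_def)

lemma lin_on_scale: "lin_on U f \<Longrightarrow> x \<in> U \<Longrightarrow> f (c *\<^sub>C x) = c *\<^sub>C f x"
  by (simp add: lin_on_def)

lemma lin_on_zero: "lin_on U f \<Longrightarrow> cvec.subspace U \<Longrightarrow> f 0 = 0"
  using lin_on_scale[of U f 0 0] cvec.subspace_0[of U] by simp

lemma lin_on_neg: "lin_on U f \<Longrightarrow> x \<in> U \<Longrightarrow> f (- x) = - f x"
  using lin_on_scale[of U f x "- 1"] by simp

lemma lin_on_diff:
  assumes "lin_on U f" "cvec.subspace U" "x \<in> U" "y \<in> U"
  shows "f (x - y) = f x - f y"
  using lin_on_add[OF assms(1,3) cvec.subspace_neg[OF assms(2,4)]] lin_on_neg[OF assms(1,4)] by simp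

lemma lin_on_sum:
  assumes "lin_on U f" "cvec.subspace U" "\<And>i. i \<in> I \<Longrightarrow> g i \<in> U"
  shows "f (sum g I) = (\<Sum>i\<in>I. f (g i))"
proof (cases "finite I")
  case True
  then show ?thesis
    using assms(3)
  proof (induction I)
    case empty
    then show ?case using lin_on_zero[OF assms(1,2)] by simp
  next
    case (insert i I)
    moreover have "sum g I \<in> U" using insert.prems by (intro cvec.subspace_sum[OF assms(2)]) auto
    ultimately show ?case by (simp add: lin_on_add[OF assms(1)])
  qed
next
  case False
  then show ?thesis using lin_on_zero[OF assms(1,2)] by simp
qed

lemma lin_on_subset: "lin_on U f \<Longrightarrow> V \<subseteq> U \<Longrightarrow> lin_on V f"
  unfolding lin_on_def by (simp add: subset_iff)

lemma lin_on_compose: "lin_on U f \<Longrightarrow> f ` U \<subseteq> V \<Longrightarrow> lin_on V g \<Longrightarrow> lin_on U (\<lambda>x. g (f x))"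
  by (auto simp: lin_on_def image_subset_iff)

lemma lin_on_plus: "lin_on U f \<Longrightarrow> lin_on U g \<Longrightarrow> lin_on U (\<lambda>x. f x + g x)"
  by (simp add: lin_on_def scaleC_add_right algebra_simps)

lemma lin_on_zero_fun: "lin_on U (\<lambda>x. 0)"
  by (simp add: lin_on_def)

lemma lin_on_scaleC: "lin_on U f \<Longrightarrow> lin_on U (\<lambda>x. c *\<^sub>C f x)"
  by (simp add: lin_on_def scaleC_add_right scaleC_scaleC mult.commute)

lemma lin_on_sum_fun: "(\<And>i. i \<in> I \<Longrightarrow> lin_on U (f i)) \<Longrightarrow> lin_on U (\<lambda>x. \<Sum>i\<in>I. f i x)"
  by (induction I rule: infinite_finite_induct) (simp_all add: lin_on_zero_fun lin_on_plus)

lemma Hom_iff: "f \<in> Hom U V \<longleftrightarrow> lin_on U f \<and> f ` U \<subseteq> V \<and> (\<forall>x. x \<notin> U \<longrightarrow> f x = 0)"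
  by (auto simp: Hom_def lin_on_def)

lemma lin_on_span_mem:
  assumes "lin_on (cvec.span S) f" "f ` S \<subseteq> W" "cvec.subspace W" "x \<in> cvec.span S"
  shows "f x \<in> W"
proof -
  let ?T = "{x \<in> cvec.span S. f x \<in> W}"
  have "cvec.subspace ?T"
    unfolding cvec.subspace_def
    using assms(1,3) lin_on_zero[OF assms(1)]
    by (auto simp: lin_on_add lin_on_scale cvec.subspace_0 cvec.subspace_add cvec.subspace_scale
        cvec.span_zero cvec.span_add cvec.span_scale)
  moreover have "S \<subseteq> ?T" using assms(2) by (auto intro: cvec.span_base)
  ultimately have "cvec.span S \<subseteq> ?T" by (rule cvec.span_minimal[rotated])
  with assms(4) show ?thesis by auto
qed

lemma lin_on_span_eqI:
  assumes "lin_on (cvec.span S) f" "lin_on (cvec.span S) g" "\<And>x. x \<in> S \<Longrightarrow> f x = g x"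
    and "x \<in> cvec.span S"
  shows "f x = g x"
proof -
  have "lin_on (cvec.span S) (\<lambda>x. f x + (- 1) *\<^sub>C g x)"
    by (intro lin_on_plus lin_on_scaleC assms)
  then have "f x + (- 1) *\<^sub>C g x \<in> {0}"
    by (rule lin_on_span_mem) (use assms in auto)
  then show ?thesis by simp
qed

lemma lin_on_subspace_image:
  assumes "lin_on U f" "cvec.subspace U"
  shows "cvec.subspace (f ` U)"
  unfolding cvec.subspace_def
proof (intro conjI ballI allI)
  show "0 \<in> f ` U" using lin_on_zero[OF assms] cvec.subspace_0[OF assms(2)] by force
next
  fix x y assume "x \<in> f ` U" "y \<in> f ` U"
  then obtain a b where "a \<in> U" "b \<in> U" "x = f a" "y = f b" by blast
  then show "x + y \<in> f ` U"
    using lin_on_add[OF assms(1)] cvec.subspace_add[OF assms(2)] by (metis imageI)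
next
  fix c x assume "x \<in> f ` U"
  then obtain a where "a \<in> U" "x = f a" by blast
  then show "c *\<^sub>C x \<in> f ` U"
    using lin_on_scale[OF assms(1)] cvec.subspace_scale[OF assms(2)] by (metis imageI)
qed

lemma lin_on_subspace_vimage:
  assumes "lin_on U f" "cvec.subspace U" "cvec.subspace W"
  shows "cvec.subspace {x \<in> U. f x \<in> W}"
  unfolding cvec.subspace_def
  using assms lin_on_zero[OF assms(1,2)]
  by (auto simp: lin_on_add lin_on_scale cvec.subspace_0 cvec.subspace_add cvec.subspace_scale)

lemma lin_on_image_span:
  assumes "lin_on (cvec.span S) f"
  shows "f ` cvec.span S = cvec.span (f ` S)"
proof
  show "f ` cvec.span S \<subseteq> cvec.span (f ` S)"
    using lin_on_span_mem[OF assms, of "cvec.span (f ` S)"] by (auto intro: cvec.span_base)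
  show "cvec.span (f ` S) \<subseteq> f ` cvec.span S"
    using cvec.span_superset[of S] lin_on_subspace_image[OF assms]
    by (intro cvec.span_minimal) auto
qed

section \<open>Finite dimension, complements and rank-nullity\<close>

lemma fin_dim_subspace: "fin_dim V \<Longrightarrow> cvec.subspace V"
  by (auto simp: fin_dim_def)

lemma fin_dim_basis:
  assumes "fin_dim V"
  obtains B where "finite B" "B \<subseteq> V" "cvec.independent B" "cvec.span B = V" "card B = cvec.dim V"
proof -
  obtain C where C: "finite C" "V = cvec.span C" using assms by (auto simp: fin_dim_def)
  obtain B where B: "B \<subseteq> V" "cvec.independent B" "V \<subseteq> cvec.span B" "card B = cvec.dim V"
    by (rule cvec.basis_exists)
  moreover have "finite B" using cvec.independent_span_bound[OF C(1) B(2)] B(1) C(2) by auto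
  moreover have "cvec.span B = V"
    using B(1,3) C(2) by (metis cvec.span_minimal cvec.subspace_span subset_antisym)
  ultimately show thesis using that by blast
qed

lemma basis_extend:
  assumes "fin_dim V" "B \<subseteq> V" "cvec.independent B"
  obtains C where "B \<subseteq> C" "finite C" "C \<subseteq> V" "cvec.independent C" "cvec.span C = V"
proof -
  obtain T where T: "finite T" "V = cvec.span T" using assms by (auto simp: fin_dim_def)
  obtain C where C: "B \<subseteq> C" "C \<subseteq> V" "cvec.independent C" "V \<subseteq> cvec.span C"
    by (rule cvec.maximal_independent_subset_extend[OF assms(2,3)])
  moreover have "finite C" using cvec.independent_span_bound[OF T(1) C(3)] C(2) T(2) by auto
  moreover have "cvec.span C = V"
    using C(2,4) T(2) by (metis cvec.span_minimal cvec.subspace_span subset_antisym)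
  ultimately show thesis using that by blast
qed

lemma fin_dim_subset:
  assumes "fin_dim V" "cvec.subspace U" "U \<subseteq> V"
  shows "fin_dim U"
proof -
  obtain T where T: "finite T" "V = cvec.span T" using assms by (auto simp: fin_dim_def)
  obtain B where B: "B \<subseteq> U" "cvec.independent B" "U \<subseteq> cvec.span B"
    by (rule cvec.maximal_independent_subset)
  have "finite B" using cvec.independent_span_bound[OF T(1) B(2)] B(1) T(2) assms(3) by auto
  moreover have "U = cvec.span B" using B assms(2) by (simp add: cvec.span_minimal subset_antisym)
  ultimately show ?thesis by (auto simp: fin_dim_def)
qed

lemma fin_dim_zero: "fin_dim {0}"
  unfolding fin_dim_def by (intro exI[of _ "{}"]) simp

lemma fin_dim_image:
  assumes "lin_on U f" "fin_dim U"
  shows "fin_dim (f ` U)"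
proof -
  obtain B where "finite B" "U = cvec.span B" using assms by (auto simp: fin_dim_def)
  then show ?thesis
    using lin_on_image_span[of B f] assms(1) unfolding fin_dim_def by (intro exI[of _ "f ` B"]) auto
qed

lemma dim_zero: "cvec.dim {0 :: 'a::complex_vector} = 0"
  using cvec.dim_span_eq_card_independent[of "{} :: 'a set"] by (simp add: cvec.independent_empty)

lemma dim_mono: "fin_dim V \<Longrightarrow> U \<subseteq> V \<Longrightarrow> cvec.dim U \<le> cvec.dim V"
  by (metis fin_dim_basis cvec.dim_le_card)

lemma dim_eq_imp_eq:
  assumes "fin_dim V" "cvec.subspace U" "U \<subseteq> V" "cvec.dim V \<le> cvec.dim U"
  shows "U = V"
proof -
  obtain B where B: "finite B" "B \<subseteq> U" "cvec.independent B" "cvec.span B = U" "card B = cvec.dim U"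
    by (rule fin_dim_basis[OF fin_dim_subset[OF assms(1-3)]])
  obtain C where C: "B \<subseteq> C" "finite C" "C \<subseteq> V" "cvec.independent C" "cvec.span C = V"
    by (rule basis_extend[OF assms(1) _ B(3)]) (use B(2) assms(3) in auto)
  have "card C = cvec.dim V" using C cvec.dim_span_eq_card_independent by metis
  then have "B = C" using C(1,2) assms(4) B(5) by (metis card_seteq)
  with B(4) C(5) show ?thesis by simp
qed

lemma dim_eq_0_imp: "fin_dim V \<Longrightarrow> cvec.dim V = 0 \<Longrightarrow> V = {0}"
  using dim_eq_imp_eq[of V "{0}"] cvec.subspace_0[OF fin_dim_subspace] by (auto simp: cvec.subspace_def)

text \<open>The map is linear on the whole type even if \<open>B\<close> spans a proper subspace, so
  no domain conditions arise; \<open>restr\<close> cuts it down when an element of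
  \<open>Hom\<close> is wanted.\<close>

lemma lin_on_from_basis:
  fixes g :: "'a::complex_vector \<Rightarrow> 'b::complex_vector"
  assumes "cvec.independent B"
  obtains f where "lin_on UNIV f" "\<And>b. b \<in> B \<Longrightarrow> f b = g b"
proof -
  interpret p: vector_space_pair "scaleC :: complex \<Rightarrow> 'a \<Rightarrow> 'a"
    "scaleC :: complex \<Rightarrow> 'b \<Rightarrow> 'b" by unfold_locales
  obtain f where f: "Vector_Spaces.linear scaleC scaleC f" and eq: "\<forall>b\<in>B. f b = g b"
    using p.linear_independent_extend[OF assms] by blast
  have "lin_on UNIV f" using p.linear_add[OF f] p.linear_scale[OF f] by (simp add: lin_on_def)
  with eq that show thesis by blast
qed

lemma lin_on_UNIV_iff: "lin_on UNIV f \<longleftrightarrow> Vector_Spaces.linear scaleC scaleC f"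
proof -
  have "vector_space (scaleC :: complex \<Rightarrow> 'x \<Rightarrow> 'x::complex_vector)" by unfold_locales
  then show ?thesis by (auto simp: lin_on_def Vector_Spaces.linear_iff cvec.vector_space_axioms)
qed

lemma complement_exists:
  assumes "fin_dim V" "cvec.subspace U" "U \<subseteq> V"
  obtains W where "cvec.subspace W" "W \<subseteq> V" "cvec.dim U + cvec.dim W = cvec.dim V"
    "\<And>x. x \<in> V \<Longrightarrow> \<exists>u\<in>U. \<exists>w\<in>W. x = u + w" "U \<inter> W = {0}"
proof -
  obtain B where B: "finite B" "B \<subseteq> U" "cvec.independent B" "cvec.span B = U" "card B = cvec.dim U"
    by (rule fin_dim_basis[OF fin_dim_subset[OF assms]])
  obtain C where C: "B \<subseteq> C" "finite C" "C \<subseteq> V" "cvec.independent C" "cvec.span C = V"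
    by (rule basis_extend[OF assms(1) _ B(3)]) (use B(2) assms(3) in auto)
  let ?W = "cvec.span (C - B)"
  have ind: "cvec.independent (C - B)" using C(4) by (meson Diff_subset cvec.independent_mono)
  have "cvec.subspace ?W" by simp
  moreover have "?W \<subseteq> V" using C(5) by (metis Diff_subset cvec.span_mono)
  moreover have "cvec.dim U + cvec.dim ?W = cvec.dim V"
  proof -
    have "cvec.dim ?W = card (C - B)" by (rule cvec.dim_span_eq_card_independent[OF ind])
    moreover have "cvec.dim V = card C" using C cvec.dim_span_eq_card_independent by metis
    ultimately show ?thesis
      using B(1,5) card_mono[OF C(2,1)] by (simp add: card_Diff_subset C(1))
  qed
  moreover have "\<exists>u\<in>U. \<exists>w\<in>?W. x = u + w" if "x \<in> V" for x
  proof -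
    have "C = B \<union> (C - B)" using C(1) by auto
    then have "V = {x + y |x y. x \<in> cvec.span B \<and> y \<in> ?W}"
      using cvec.span_Un[of B "C - B"] C(5) by simp
    then show ?thesis using that B(4) by auto
  qed
  moreover have "U \<inter> ?W = {0}"
  proof -
    \<comment> \<open>The projection along the complement: it fixes \<open>U\<close> and kills the
      span of \<open>C - B\<close>, so a common vector is 0.\<close>
    obtain f where f: "lin_on UNIV f" "\<And>b. b \<in> C \<Longrightarrow> f b = (if b \<in> B then b else 0)"
      using lin_on_from_basis[OF C(4), of "\<lambda>b. if b \<in> B then b else 0"] by blast
    have "x = 0" if x: "x \<in> U" "x \<in> ?W" for x
    proof -
      have "f x = x"
        by (rule lin_on_span_eqI[of B]) (use f x C(1) B(4) in \<open>auto simp: lin_on_def\<close>)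
      moreover have "f x = 0"
        by (rule lin_on_span_eqI[of "C - B"]) (use f x C(1) B(4) in \<open>auto simp: lin_on_def\<close>)
      ultimately show ?thesis by simp
    qed
    then show ?thesis using assms(2) by (auto simp: cvec.subspace_0 cvec.span_zero)
  qed
  ultimately show thesis using that by blast
qed

lemma dim_image_inj:
  assumes "lin_on U f" "fin_dim U" "\<And>x. x \<in> U \<Longrightarrow> f x = 0 \<Longrightarrow> x = 0"
  shows "cvec.dim (f ` U) = cvec.dim U"
proof -
  obtain B where B: "finite B" "B \<subseteq> U" "cvec.independent B" "cvec.span B = U" "card B = cvec.dim U"
    by (rule fin_dim_basis[OF assms(2)])
  \<comment> \<open>\<open>f\<close> is linear on \<open>U\<close> only; \<open>F\<close> is linear
    everywhere and agrees with it on \<open>U\<close>, so it sends the basis to an independent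
    set.\<close>
  obtain F where F: "lin_on UNIV F" "\<And>b. b \<in> B \<Longrightarrow> F b = f b"
    using lin_on_from_basis[OF B(3), of f] by blast
  have Ff: "F x = f x" if "x \<in> U" for x
    by (rule lin_on_span_eqI[of B]) (use F assms(1) B(4) that in \<open>auto intro: lin_on_subset\<close>)
  have sub: "cvec.subspace U" by (rule fin_dim_subspace[OF assms(2)])
  have inj: "inj_on F U"
  proof (rule inj_onI)
    fix x y assume xy: "x \<in> U" "y \<in> U" "F x = F y"
    then have "f (x - y) = 0" using lin_on_diff[OF assms(1) sub] Ff by simp
    then have "x - y = 0" using assms(3) cvec.subspace_diff[OF sub] xy by blast
    then show "x = y" by simp
  qed
  interpret p: vector_space_pair "scaleC :: complex \<Rightarrow> 'a \<Rightarrow> 'a"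
    "scaleC :: complex \<Rightarrow> 'b \<Rightarrow> 'b" by unfold_locales
  have "cvec.independent (F ` B)"
    using p.linear_independent_injective_image[OF F(1)[unfolded lin_on_UNIV_iff] B(3)] B(4) inj
    by simp
  moreover have "f ` U = cvec.span (F ` B)"
    using lin_on_image_span[of B F] B(4) F(1) Ff lin_on_subset[of UNIV F]
    by (metis image_cong top_greatest)
  moreover have "card (F ` B) = card B" using inj B(2) by (meson card_image inj_on_subset)
  ultimately show ?thesis using B(5) by (metis cvec.dim_span_eq_card_independent)
qed

text \<open>A complement of the kernel has the same image as \<open>U\<close> and meets the kernel
  in 0, so \<open>f\<close> preserves its dimension.\<close>

theorem rank_nullity:
  assumes "lin_on U f" "fin_dim U"
  shows "cvec.dim U = cvec.dim (f ` U) + cvec.dim {x \<in> U. f x = 0}"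
proof -
  have sub: "cvec.subspace U" by (rule fin_dim_subspace[OF assms(2)])
  let ?K = "{x \<in> U. f x = 0}"
  have K: "cvec.subspace ?K" using lin_on_subspace_vimage[OF assms(1) sub, of "{0}"] by simp
  obtain W where W: "cvec.subspace W" "W \<subseteq> U" "cvec.dim ?K + cvec.dim W = cvec.dim U"
    "\<And>x. x \<in> U \<Longrightarrow> \<exists>u\<in>?K. \<exists>w\<in>W. x = u + w" "?K \<inter> W = {0}"
    by (rule complement_exists[OF assms(2) K]) blast+
  have "f ` U = f ` W"
  proof
    show "f ` U \<subseteq> f ` W"
    proof
      fix y assume "y \<in> f ` U"
      then obtain x where "x \<in> U" "y = f x" by auto
      then show "y \<in> f ` W" using W(2) W(4)[of x] lin_on_add[OF assms(1)] by (auto simp: subset_iff)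
    qed
    show "f ` W \<subseteq> f ` U" using W(2) by auto
  qed
  moreover have "cvec.dim (f ` W) = cvec.dim W"
    by (rule dim_image_inj[OF lin_on_subset[OF assms(1) W(2)] fin_dim_subset[OF assms(2) W(1,2)]])
      (use W(2,5) in auto)
  ultimately show ?thesis using W(3) by simp
qed

lemma dim_image_le:
  assumes "lin_on U f" "fin_dim U"
  shows "cvec.dim (f ` U) \<le> cvec.dim U"
  using rank_nullity[OF assms] by simp

section \<open>Sums and direct sums of subspaces\<close>

definition ssum :: "'a::complex_vector set \<Rightarrow> 'a set \<Rightarrow> 'a set"
  where "ssum U V = {u + v |u v. u \<in> U \<and> v \<in> V}"

lemma ssum_subspace: "cvec.subspace U \<Longrightarrow> cvec.subspace V \<Longrightarrow> cvec.subspace (ssum U V)"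
  unfolding ssum_def by (rule cvec.subspace_sums)

lemma ssum_mem: "u \<in> U \<Longrightarrow> v \<in> V \<Longrightarrow> u + v \<in> ssum U V"
  unfolding ssum_def by blast

lemma ssum_sup1: "cvec.subspace V \<Longrightarrow> U \<subseteq> ssum U V"
  unfolding ssum_def by (force dest: cvec.subspace_0)

lemma ssum_sup2: "cvec.subspace U \<Longrightarrow> V \<subseteq> ssum U V"
  unfolding ssum_def by (force dest: cvec.subspace_0)

lemma ssum_least: "cvec.subspace W \<Longrightarrow> U \<subseteq> W \<Longrightarrow> V \<subseteq> W \<Longrightarrow> ssum U V \<subseteq> W"
  unfolding ssum_def by (auto intro: cvec.subspace_add)

lemma ssum_fin_dim:
  assumes "fin_dim U" "fin_dim V"
  shows "fin_dim (ssum U V)" "cvec.dim (ssum U V) \<le> cvec.dim U + cvec.dim V"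
proof -
  obtain B where B: "finite B" "B \<subseteq> U" "cvec.independent B" "cvec.span B = U" "card B = cvec.dim U"
    by (rule fin_dim_basis[OF assms(1)])
  obtain C where C: "finite C" "C \<subseteq> V" "cvec.independent C" "cvec.span C = V" "card C = cvec.dim V"
    by (rule fin_dim_basis[OF assms(2)])
  have eq: "ssum U V = cvec.span (B \<union> C)"
    using cvec.span_Un[of B C] B(4) C(4) by (simp add: ssum_def)
  with B(1) C(1) show "fin_dim (ssum U V)" by (auto simp: fin_dim_def)
  have "cvec.dim (ssum U V) \<le> card (B \<union> C)"
    using B(1) C(1) eq by (intro cvec.dim_le_card) auto
  then show "cvec.dim (ssum U V) \<le> cvec.dim U + cvec.dim V"
    using card_Un_le[of B C] B(5) C(5) by simp
qed

lemma dsum_subspace: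
  assumes "\<And>i. i \<in> I \<Longrightarrow> cvec.subspace (V i)"
  shows "cvec.subspace (dsum I V)"
  using assms
  by (auto simp: dsum_def cvec.subspace_def scaleC_fun_def)

lemma dsum_mono: "(\<And>i. i \<in> I \<Longrightarrow> V i \<subseteq> V' i) \<Longrightarrow> dsum I V \<subseteq> dsum I V'"
  by (auto simp: dsum_def)

lemma dsumI: "(\<And>i. i \<in> I \<Longrightarrow> x i \<in> V i) \<Longrightarrow> (\<And>i. i \<notin> I \<Longrightarrow> x i = 0) \<Longrightarrow> x \<in> dsum I V"
  by (simp add: dsum_def)

lemma dsumD: "x \<in> dsum I V \<Longrightarrow> i \<in> I \<Longrightarrow> x i \<in> V i"
  "x \<in> dsum I V \<Longrightarrow> i \<notin> I \<Longrightarrow> x i = 0"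
  by (auto simp: dsum_def)

definition single :: "nat \<Rightarrow> 'a \<Rightarrow> nat \<Rightarrow> 'a::zero"
  where "single k t = (\<lambda>i. if i = k then t else 0)"

lemma single_same [simp]: "single k t k = t"
  by (simp add: single_def)

lemma single_other: "i \<noteq> k \<Longrightarrow> single k t i = 0"
  by (simp add: single_def)

lemma single_lin_on: "lin_on U (single k)"
  by (auto simp: lin_on_def single_def fun_eq_iff scaleC_fun_def)

lemma proj_lin_on: "lin_on U (\<lambda>p. p k)"
  by (simp add: lin_on_def scaleC_fun_def)

lemma single_mem_dsum:
  "k \<in> I \<Longrightarrow> t \<in> V k \<Longrightarrow> (\<And>i. i \<in> I \<Longrightarrow> cvec.subspace (V i)) \<Longrightarrow> single k t \<in> dsum I V"
  by (auto simp: dsum_def single_def cvec.subspace_0)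

text \<open>Induction by rank-nullity for the projection to the new coordinate \<open>k\<close>: the
  image is \<open>V k\<close>, and the kernel is the sum over the old indices because vectors vanish
  outside their index set.\<close>

lemma dsum_fin_dim:
  assumes "finite I" "\<And>i. i \<in> I \<Longrightarrow> fin_dim (V i)"
  shows "fin_dim (dsum I V) \<and> cvec.dim (dsum I V) = (\<Sum>i\<in>I. cvec.dim (V i))"
  using assms
proof (induction I)
  case empty
  have "dsum {} V = {0}" by (auto simp: dsum_def fun_eq_iff)
  then show ?case by (simp add: fin_dim_zero dim_zero)
next
  case (insert k I)
  have sub: "cvec.subspace (V i)" if "i \<in> insert k I" for i
    using insert.prems that fin_dim_subspace by blast
  have im: "(\<lambda>p. p k) ` dsum (insert k I) V = V k"
  proof
    show "V k \<subseteq> (\<lambda>p. p k) ` dsum (insert k I) V"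
    proof
      fix t assume "t \<in> V k"
      then have "single k t \<in> dsum (insert k I) V" by (intro single_mem_dsum sub) auto
      then show "t \<in> (\<lambda>p. p k) ` dsum (insert k I) V" by (metis imageI single_same)
    qed
  qed (auto simp: dsum_def)
  have ker: "{p \<in> dsum (insert k I) V. p k = 0} = dsum I V"
    using insert.hyps(2) cvec.subspace_0[OF sub[of k]] by (auto simp: dsum_def)
  have eq: "dsum (insert k I) V = ssum (single k ` V k) (dsum I V)"
  proof
    show "dsum (insert k I) V \<subseteq> ssum (single k ` V k) (dsum I V)"
    proof
      fix p assume p: "p \<in> dsum (insert k I) V"
      have "p = single k (p k) + (\<lambda>i. if i = k then 0 else p i)"
        by (auto simp: fun_eq_iff single_def)
      moreover have "(\<lambda>i. if i = k then 0 else p i) \<in> dsum I V"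
        using p insert.hyps(2) by (auto simp: dsum_def)
      moreover have "single k (p k) \<in> single k ` V k" using p by (auto simp: dsum_def)
      ultimately show "p \<in> ssum (single k ` V k) (dsum I V)" by (metis ssum_mem)
    qed
    show "ssum (single k ` V k) (dsum I V) \<subseteq> dsum (insert k I) V"
    proof (rule ssum_least)
      show "cvec.subspace (dsum (insert k I) V)" by (intro dsum_subspace sub)
      show "dsum I V \<subseteq> dsum (insert k I) V"
        using insert.hyps(2) cvec.subspace_0[OF sub[of k]] by (auto simp: dsum_def)
    qed (auto intro!: single_mem_dsum sub)
  qed
  have IH: "fin_dim (dsum I V)" "cvec.dim (dsum I V) = (\<Sum>i\<in>I. cvec.dim (V i))"
    using insert by auto
  have fd: "fin_dim (dsum (insert k I) V)"
    unfolding eq using insert.prems IH(1) by (intro ssum_fin_dim fin_dim_image single_lin_on) auto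
  then show ?case
    using rank_nullity[OF proj_lin_on fd, of k] im ker IH(2) insert.hyps by simp
qed

section \<open>Tensor products of subspaces\<close>

lemma bilin_on_iff:
  "bilin_on U V b \<longleftrightarrow> (\<forall>v\<in>V. lin_on U (\<lambda>u. b u v)) \<and> (\<forall>u\<in>U. lin_on V (b u))"
  unfolding bilin_on_def lin_on_def by blast

lemma bilin_onI:
  "(\<And>v. v \<in> V \<Longrightarrow> lin_on U (\<lambda>u. b u v)) \<Longrightarrow> (\<And>u. u \<in> U \<Longrightarrow> lin_on V (b u)) \<Longrightarrow> bilin_on U V b"
  by (simp add: bilin_on_iff)

lemma tens_lin_left: "lin_on U (\<lambda>u. u \<otimes> v)"
  and tens_lin_right: "lin_on V (\<lambda>v. u \<otimes> v)"
  using bilin_on_tens[of UNIV UNIV] lin_on_subset[OF _ subset_UNIV]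
  unfolding bilin_on_iff by (metis UNIV_I)+

lemma tens_zero [simp]: "0 \<otimes> v = 0" "u \<otimes> 0 = 0"
  using lin_on_zero[OF tens_lin_left[of UNIV v]] lin_on_zero[OF tens_lin_right[of UNIV u]] by simp_all

lemma tens_scale: "(c *\<^sub>C u) \<otimes> v = c *\<^sub>C (u \<otimes> v)" "u \<otimes> (c *\<^sub>C v) = c *\<^sub>C (u \<otimes> v)"
  using lin_on_scale[OF tens_lin_left[of UNIV v]] lin_on_scale[OF tens_lin_right[of UNIV u]]
  by simp_all

lemma tens_add: "(u + u') \<otimes> v = u \<otimes> v + u' \<otimes> v" "u \<otimes> (v + v') = u \<otimes> v + u \<otimes> v'"
  using lin_on_add[OF tens_lin_left[of UNIV v]] lin_on_add[OF tens_lin_right[of UNIV u]]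
  by simp_all

lemma tspace_subspace [simp]: "cvec.subspace (U \<otimes>\<^sub>S V)"
  by (simp add: tspace_def)

lemma tens_mem: "u \<in> U \<Longrightarrow> v \<in> V \<Longrightarrow> u \<otimes> v \<in> U \<otimes>\<^sub>S V"
  unfolding tspace_def by (rule cvec.span_base) blast

lemma tspace_mono: "U \<subseteq> U' \<Longrightarrow> V \<subseteq> V' \<Longrightarrow> U \<otimes>\<^sub>S V \<subseteq> U' \<otimes>\<^sub>S V'"
  unfolding tspace_def by (rule cvec.span_mono) blast

lemma tspace_eqI:
  assumes "lin_on (U \<otimes>\<^sub>S V) f" "lin_on (U \<otimes>\<^sub>S V) g" "t \<in> U \<otimes>\<^sub>S V"
    and "\<And>u v. u \<in> U \<Longrightarrow> v \<in> V \<Longrightarrow> f (u \<otimes> v) = g (u \<otimes> v)"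
  shows "f t = g t"
  using lin_on_span_eqI[of "{u \<otimes> v |u v. u \<in> U \<and> v \<in> V}" f g t] assms
  by (auto simp: tspace_def)

lemma tspace_mapI:
  assumes "lin_on (U \<otimes>\<^sub>S V) f" "cvec.subspace W" "t \<in> U \<otimes>\<^sub>S V"
    and "\<And>u v. u \<in> U \<Longrightarrow> v \<in> V \<Longrightarrow> f (u \<otimes> v) \<in> W"
  shows "f t \<in> W"
  using lin_on_span_mem[of "{u \<otimes> v |u v. u \<in> U \<and> v \<in> V}" f W t] assms
  by (auto simp: tspace_def)

lemma tspace_least:
  assumes "cvec.subspace W" "\<And>u v. u \<in> U \<Longrightarrow> v \<in> V \<Longrightarrow> u \<otimes> v \<in> W"
  shows "U \<otimes>\<^sub>S V \<subseteq> W"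
  unfolding tspace_def using assms by (intro cvec.span_minimal) auto

lemma tspace_zero [simp]: "{0} \<otimes>\<^sub>S V = {0}" "U \<otimes>\<^sub>S {0} = {0}"
proof -
  have "{0} \<otimes>\<^sub>S V \<subseteq> {0}" "U \<otimes>\<^sub>S {0} \<subseteq> {0}" by (rule tspace_least; simp)+
  then show "{0} \<otimes>\<^sub>S V = {0}" "U \<otimes>\<^sub>S {0} = {0}"
    using cvec.subspace_0[OF tspace_subspace] by blast+
qed

section \<open>Maps induced on tensor products\<close>

lemma tlift_lin:
  assumes "cvec.subspace U" "cvec.subspace V" "bilin_on U V b"
  shows "lin_on (U \<otimes>\<^sub>S V) (tlift U V b)"
  using tlift(1)[OF assms] by (simp add: Hom_iff)

lemma tlift_Hom:
  assumes "cvec.subspace U" "cvec.subspace V" "bilin_on U V b" "cvec.subspace W"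
    and "\<And>u v. u \<in> U \<Longrightarrow> v \<in> V \<Longrightarrow> b u v \<in> W"
  shows "tlift U V b \<in> Hom (U \<otimes>\<^sub>S V) W"
  using tlift(1)[OF assms(1-3)] tspace_mapI[OF tlift_lin[OF assms(1-3)] assms(4)] assms(5)
    tlift(2)[OF assms(1-3)]
  by (auto simp: Hom_iff)

lemma bilin_on_right: "lin_on V f \<Longrightarrow> bilin_on U V (\<lambda>u v. u \<otimes> f v)"
  by (rule bilin_onI, rule tens_lin_left)
    (rule lin_on_compose[OF _ subset_UNIV tens_lin_right], assumption)

lemma bilin_on_left: "lin_on U f \<Longrightarrow> bilin_on U V (\<lambda>u v. f u \<otimes> v)"
  by (rule bilin_onI, rule lin_on_compose[OF _ subset_UNIV tens_lin_left], assumption)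
    (rule tens_lin_right)

context
  fixes U :: "'u::complex_vector set" and V :: "'v::complex_vector set"
    and f :: "'v \<Rightarrow> 'x::complex_vector"
  assumes sub: "cvec.subspace U" "cvec.subspace V" and f: "lin_on V f"
begin

lemma tmap_right_lin: "lin_on (U \<otimes>\<^sub>S V) (tmap_right U V f)"
  unfolding tmap_right_def by (rule tlift_lin[OF sub bilin_on_right[OF f]])

lemma tmap_right_tens: "u \<in> U \<Longrightarrow> v \<in> V \<Longrightarrow> tmap_right U V f (u \<otimes> v) = u \<otimes> f v"
  unfolding tmap_right_def by (rule tlift(2)[OF sub bilin_on_right[OF f]])

lemma tmap_right_mem:
  assumes "U' \<subseteq> U" "V' \<subseteq> V" "f ` V' \<subseteq> W" "t \<in> U' \<otimes>\<^sub>S V'"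
  shows "tmap_right U V f t \<in> U' \<otimes>\<^sub>S W"
proof (rule tspace_mapI[OF lin_on_subset[OF tmap_right_lin tspace_mono[OF assms(1,2)]]
      tspace_subspace assms(4)])
  fix u v assume "u \<in> U'" "v \<in> V'"
  then show "tmap_right U V f (u \<otimes> v) \<in> U' \<otimes>\<^sub>S W"
    using assms(1-3) by (subst tmap_right_tens) (auto intro: tens_mem)
qed

end

lemma tmap_left_id:
  assumes "cvec.subspace U" "cvec.subspace V" "t \<in> U \<otimes>\<^sub>S V"
  shows "tmap_left U V (restr U (\<lambda>u. u)) t = t"
proof -
  have r: "lin_on U (restr U (\<lambda>u. u))"
    using assms(1) by (auto simp: lin_on_def restr_def cvec.subspace_add cvec.subspace_scale)
  note b = bilin_on_left[OF r, of V]
  show ?thesis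
    unfolding tmap_left_def
    by (rule tspace_eqI[OF tlift_lin[OF assms(1,2) b] _ assms(3)])
      (simp_all add: tlift(2)[OF assms(1,2) b], simp_all add: restr_def lin_on_def)
qed

section \<open>Dual spaces and coordinate functionals\<close>

lemma dualD:
  "\<eta> \<in> dual U \<Longrightarrow> lin_on U \<eta>" "\<eta> \<in> dual U \<Longrightarrow> x \<notin> U \<Longrightarrow> \<eta> x = 0"
  by (auto simp: dual_def Hom_iff)

lemma dual_subspace [simp]: "cvec.subspace U \<Longrightarrow> cvec.subspace (dual U)"
  by (auto simp: dual_def Hom_def cvec.subspace_def scaleC_fun_def scaleC_complex_def algebra_simps)

lemma dual_restr: "lin_on U f \<Longrightarrow> cvec.subspace U \<Longrightarrow> restr U f \<in> dual U"
  by (auto simp: dual_def Hom_iff lin_on_def restr_def cvec.subspace_add cvec.subspace_scale)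

lemma dual_UNIV_lin: "f \<in> dual UNIV \<Longrightarrow> lin_on U f"
  by (rule lin_on_subset[OF dualD(1) subset_UNIV])

lemma sum_apply: "(\<Sum>i\<in>I. f i) x = (\<Sum>i\<in>I. f i x)"
  by (induction I rule: infinite_finite_induct) simp_all

lemma coordinate_expansion:
  assumes "finite B" "\<And>b. b \<in> B \<Longrightarrow> f b \<in> dual UNIV"
    and "\<And>b c. b \<in> B \<Longrightarrow> c \<in> B \<Longrightarrow> f b c = (if c = b then 1 else 0)"
    and "v \<in> cvec.span B"
  shows "v = (\<Sum>b\<in>B. f b v *\<^sub>C b)"
proof -
  show ?thesis
  proof (rule lin_on_span_eqI[of B "\<lambda>v. v", OF _ _ _ assms(4)])
    show "lin_on (cvec.span B) (\<lambda>v. \<Sum>b\<in>B. f b v *\<^sub>C b)"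
      using assms(2)
      by (intro lin_on_sum_fun)
        (auto simp: lin_on_def dual_UNIV_linear scaleC_add_left scaleC_scaleC)
    show "lin_on (cvec.span B) (\<lambda>v. v)" by (simp add: lin_on_def)
    fix c assume c: "c \<in> B"
    then have "(\<Sum>b\<in>B. f b c *\<^sub>C b) = (\<Sum>b\<in>B. if c = b then b else 0)"
      using assms(3) by (intro sum.cong) (auto simp: scaleC_one)
    then show "c = (\<Sum>b\<in>B. f b c *\<^sub>C b)" using assms(1) c by simp
  qed
qed

lemma coordinate_functionals:
  assumes "cvec.independent B"
  obtains f where "\<And>b. b \<in> B \<Longrightarrow> f b \<in> dual UNIV"
    "\<And>b c. b \<in> B \<Longrightarrow> c \<in> B \<Longrightarrow> f b c = (if c = b then 1 else 0)"
proof -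
  have "\<forall>b\<in>B. \<exists>f. f \<in> dual UNIV \<and> (\<forall>c\<in>B. f c = (if c = b then 1 else 0))"
  proof
    fix b assume "b \<in> B"
    then obtain f where "f \<in> dual UNIV" "f b = 1" "\<And>y. y \<in> B \<Longrightarrow> y \<noteq> b \<Longrightarrow> f y = 0"
      using ex_coordinate_functional[OF assms] by blast
    then show "\<exists>f. f \<in> dual UNIV \<and> (\<forall>c\<in>B. f c = (if c = b then 1 else 0))" by auto
  qed
  then show thesis using that by metis
qed

lemma functional_exists:
  assumes "v \<noteq> 0"
  obtains f where "f \<in> dual UNIV" "f v = 1"
  using ex_coordinate_functional[of "{v}" v] assms by auto

text \<open>The coordinate functionals of a basis of \<open>U\<close> span the dual once they are
  cut off outside \<open>U\<close>, where elements of \<open>dual U\<close> are 0.\<close>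

lemma fin_dim_dual:
  assumes "fin_dim U"
  shows "fin_dim (dual U)"
proof -
  obtain B where B: "finite B" "B \<subseteq> U" "cvec.independent B" "cvec.span B = U" "card B = cvec.dim U"
    by (rule fin_dim_basis[OF assms])
  have sub: "cvec.subspace U" by (rule fin_dim_subspace[OF assms])
  obtain f where f: "\<And>b. b \<in> B \<Longrightarrow> f b \<in> dual UNIV"
    "\<And>b c. b \<in> B \<Longrightarrow> c \<in> B \<Longrightarrow> f b c = (if c = b then 1 else 0)"
    using coordinate_functionals[OF B(3)] by metis
  have mem: "restr U (f b) \<in> dual U" if "b \<in> B" for b
    using f(1)[OF that] by (intro dual_restr dual_UNIV_lin sub)
  have "\<eta> \<in> cvec.span ((\<lambda>b. restr U (f b)) ` B)" if \<eta>: "\<eta> \<in> dual U" for \<eta>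
  proof -
    have "\<eta> x = (\<Sum>b\<in>B. \<eta> b *\<^sub>C restr U (f b)) x" for x
    proof (cases "x \<in> U")
      case True
      then have x: "x = (\<Sum>b\<in>B. f b x *\<^sub>C b)"
        using coordinate_expansion[OF B(1) f] B(4) by blast
      have "\<eta> x = (\<Sum>b\<in>B. \<eta> (f b x *\<^sub>C b))"
        by (subst x, rule lin_on_sum[OF dualD(1)[OF \<eta>] sub])
          (use B(2) cvec.subspace_scale[OF sub] in auto)
      also have "\<dots> = (\<Sum>b\<in>B. f b x * \<eta> b)"
        using B(2) lin_on_scale[OF dualD(1)[OF \<eta>]] by (intro sum.cong) (auto simp: scaleC_complex_def)
      finally show ?thesis
        using True by (simp add: sum_apply scaleC_fun_def scaleC_complex_def restr_def mult.commute)
    next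
      case False
      then show ?thesis
        using dualD(2)[OF \<eta>] by (simp add: sum_apply scaleC_fun_def restr_def)
    qed
    then have "\<eta> = (\<Sum>b\<in>B. \<eta> b *\<^sub>C restr U (f b))" by blast
    moreover have "\<dots> \<in> cvec.span ((\<lambda>b. restr U (f b)) ` B)"
      by (intro cvec.span_sum cvec.span_scale cvec.span_base) auto
    ultimately show ?thesis by simp
  qed
  moreover have "cvec.span ((\<lambda>b. restr U (f b)) ` B) \<subseteq> dual U"
    using mem sub by (intro cvec.span_minimal) auto
  ultimately have "dual U = cvec.span ((\<lambda>b. restr U (f b)) ` B)" by blast
  with B(1) show ?thesis
    unfolding fin_dim_def by (intro exI[of _ "(\<lambda>b. restr U (f b)) ` B"]) simp
qed

text \<open>Contraction of the right factor with a functional. It is built on the whole types, so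
  that one map serves all subspaces; hence it is used with functionals that are linear on the whole
  type.\<close>

definition ctr :: "('v \<Rightarrow> complex) \<Rightarrow> ('u::complex_vector, 'v::complex_vector) tensor \<Rightarrow> 'u"
  where "ctr f = tlift UNIV UNIV (\<lambda>u v. f v *\<^sub>C u)"

context
  fixes f :: "'v::complex_vector \<Rightarrow> complex"
  assumes f: "f \<in> dual UNIV"
begin

lemma ctr_bilin: "bilin_on U V (\<lambda>u v. f v *\<^sub>C u)"
  by (rule bilin_onI)
    (auto simp: lin_on_def dual_UNIV_linear[OF f] scaleC_add_left scaleC_scaleC scaleC_add_right
      mult.commute)

lemma ctr_lin: "lin_on (U \<otimes>\<^sub>S V) (ctr f :: _ \<Rightarrow> 'u::complex_vector)"
proof -
  have "lin_on (UNIV \<otimes>\<^sub>S UNIV) (ctr f :: _ \<Rightarrow> 'u)"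
    unfolding ctr_def by (intro tlift_lin ctr_bilin) auto
  then show ?thesis by (rule lin_on_subset) (simp add: tspace_mono)
qed

lemma ctr_tens: "ctr f (u \<otimes> v) = f v *\<^sub>C u"
  unfolding ctr_def by (subst tlift(2)) (auto intro: ctr_bilin)

lemma ctr_mem: "cvec.subspace U \<Longrightarrow> t \<in> U \<otimes>\<^sub>S V \<Longrightarrow> ctr f t \<in> U"
  by (rule tspace_mapI[OF ctr_lin]) (auto simp: ctr_tens cvec.subspace_scale)

end

text \<open>Contraction with a functional that is 1 at \<open>v\<close> recovers \<open>u\<close>. A
  single nonzero \<open>v\<close> thus suffices to test membership in \<open>L\<close>.\<close>

lemma tens_mem_leftD:
  assumes "u \<otimes> v \<in> L \<otimes>\<^sub>S V" "v \<noteq> 0" "cvec.subspace L"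
  shows "u \<in> L"
proof -
  obtain f where f: "f \<in> dual UNIV" "f v = 1" by (rule functional_exists[OF assms(2)])
  then show ?thesis using ctr_mem[OF f(1) assms(3,1)] by (simp add: ctr_tens)
qed

text \<open>Relative to a basis of \<open>V\<close>, the coefficients of \<open>t\<close> are its
  contractions with the coordinate functionals, so they lie in \<open>L\<close>.\<close>

lemma tspace_memI:
  assumes "t \<in> U \<otimes>\<^sub>S V" "fin_dim V" "cvec.subspace L" "\<And>f. f \<in> dual UNIV \<Longrightarrow> ctr f t \<in> L"
  shows "t \<in> L \<otimes>\<^sub>S V"
proof -
  obtain B where B: "finite B" "B \<subseteq> V" "cvec.independent B" "cvec.span B = V" "card B = cvec.dim V"
    by (rule fin_dim_basis[OF assms(2)])
  obtain f where f: "\<And>b. b \<in> B \<Longrightarrow> f b \<in> dual UNIV"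
    "\<And>b c. b \<in> B \<Longrightarrow> c \<in> B \<Longrightarrow> f b c = (if c = b then 1 else 0)"
    using coordinate_functionals[OF B(3)] by metis
  have "t = (\<Sum>b\<in>B. ctr (f b) t \<otimes> b)"
  proof (rule tspace_eqI[OF _ _ assms(1), where f = "\<lambda>t. t"])
    show "lin_on (U \<otimes>\<^sub>S V) (\<lambda>t. \<Sum>b\<in>B. ctr (f b) t \<otimes> b)"
      using f(1)
      by (intro lin_on_sum_fun lin_on_compose[OF ctr_lin _ tens_lin_left[of UNIV]]) auto
  next
    fix u v assume "u \<in> U" "v \<in> V"
    have "(\<Sum>b\<in>B. ctr (f b) (u \<otimes> v) \<otimes> b) = (\<Sum>b\<in>B. u \<otimes> (f b v *\<^sub>C b))"
      using f(1) by (intro sum.cong) (simp_all add: ctr_tens tens_scale)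
    also have "\<dots> = u \<otimes> (\<Sum>b\<in>B. f b v *\<^sub>C b)"
      by (rule lin_on_sum[OF tens_lin_right[of UNIV], symmetric]) auto
    also have "(\<Sum>b\<in>B. f b v *\<^sub>C b) = v"
      using coordinate_expansion[OF B(1) f] B(4) \<open>v \<in> V\<close> by metis
    finally show "u \<otimes> v = (\<Sum>b\<in>B. ctr (f b) (u \<otimes> v) \<otimes> b)" by simp
  qed (simp add: lin_on_def)
  moreover have "ctr (f b) t \<otimes> b \<in> L \<otimes>\<^sub>S V" if "b \<in> B" for b
    using that assms(4) f(1) B(2) by (intro tens_mem) auto
  then have "(\<Sum>b\<in>B. ctr (f b) t \<otimes> b) \<in> L \<otimes>\<^sub>S V" by (rule cvec.subspace_sum[OF tspace_subspace])
  ultimately show ?thesis by simp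
qed

text \<open>Tensors are functions on pairs of functionals; evaluation at pairs of coordinate
  functionals separates the tensors of basis vectors and gives their independence.\<close>

theorem tspace_fin_dim:
  fixes U :: "'u::complex_vector set" and V :: "'v::complex_vector set"
  assumes "fin_dim U" "fin_dim V"
  shows "fin_dim (U \<otimes>\<^sub>S V)" "cvec.dim (U \<otimes>\<^sub>S V) = cvec.dim U * cvec.dim V"
proof -
  obtain C where C: "finite C" "C \<subseteq> V" "cvec.independent C" "cvec.span C = V" "card C = cvec.dim V"
    by (rule fin_dim_basis[OF assms(2)])
  obtain B where B: "finite B" "B \<subseteq> U" "cvec.independent B" "cvec.span B = U" "card B = cvec.dim U"
    by (rule fin_dim_basis[OF assms(1)])
  let ?t = "\<lambda>(u::'u, v::'v). u \<otimes> v"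
  let ?T = "?t ` (B \<times> C)"
  obtain f where f: "\<And>b. b \<in> B \<Longrightarrow> f b \<in> dual UNIV"
    "\<And>b c. b \<in> B \<Longrightarrow> c \<in> B \<Longrightarrow> f b c = (if c = b then 1 else 0)"
    using coordinate_functionals[OF B(3)] by metis
  obtain g where g: "\<And>b. b \<in> C \<Longrightarrow> g b \<in> dual UNIV"
    "\<And>b c. b \<in> C \<Longrightarrow> c \<in> C \<Longrightarrow> g b c = (if c = b then 1 else 0)"
    using coordinate_functionals[OF C(3)] by metis
  have ev: "(u \<otimes> v) (f b) (g c) = (if (u, v) = (b, c) then 1 else 0)"
    if "b \<in> B" "c \<in> C" "u \<in> B" "v \<in> C" for b c u v
    using that f g by (auto simp: tens_def)
  have inj: "inj_on ?t (B \<times> C)"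
  proof (rule inj_onI, clarify)
    fix x y x' y' assume xy: "x \<in> B" "y \<in> C" "x' \<in> B" "y' \<in> C" "x \<otimes> y = x' \<otimes> y'"
    then have "(x' \<otimes> y') (f x) (g y) = 1" using ev[of x y x y] by simp
    then show "x = x' \<and> y = y'"
      using ev[of x y x' y'] xy(1-4) by (simp split: if_split_asm)
  qed
  have ind: "cvec.independent ?T"
  proof
    assume "cvec.dependent ?T"
    then obtain x y where xy: "x \<in> B" "y \<in> C"
      and sp: "x \<otimes> y \<in> cvec.span (?T - {x \<otimes> y})"
      unfolding cvec.dependent_def by auto
    have "cvec.subspace {t :: ('u, 'v) tensor. t (f x) (g y) = 0}"
      by (auto simp: cvec.subspace_def scaleC_fun_def scaleC_complex_def)
    moreover have "?T - {x \<otimes> y} \<subseteq> {t. t (f x) (g y) = 0}"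
      using ev xy by auto
    ultimately have "(x \<otimes> y) (f x) (g y) = 0" using sp cvec.span_minimal by blast
    with ev xy show False by simp
  qed
  have "U \<otimes>\<^sub>S V \<subseteq> cvec.span ?T"
  proof (rule tspace_least)
    fix u v assume uv: "u \<in> U" "v \<in> V"
    have 1: "b \<otimes> v \<in> cvec.span ?T" if "b \<in> B" for b
      by (rule lin_on_span_mem[OF tens_lin_right, where S = C])
        (use that uv C(4) in \<open>auto intro: cvec.span_base\<close>)
    show "u \<otimes> v \<in> cvec.span ?T"
      by (rule lin_on_span_mem[OF tens_lin_left, where S = B]) (use 1 uv B(4) in auto)
  qed simp
  moreover have "?T \<subseteq> U \<otimes>\<^sub>S V" using B(2) C(2) by (auto intro: tens_mem)
  ultimately have eq: "U \<otimes>\<^sub>S V = cvec.span ?T"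
    by (simp add: cvec.span_minimal subset_antisym)
  with B(1) C(1) show "fin_dim (U \<otimes>\<^sub>S V)"
    unfolding fin_dim_def by (intro exI[of _ ?T]) simp
  show "cvec.dim (U \<otimes>\<^sub>S V) = cvec.dim U * cvec.dim V"
    using eq cvec.dim_span_eq_card_independent[OF ind] card_image[OF inj] B(5) C(5)
    by (simp add: card_cartesian_product)
qed

declare One_nat_def [simp del]

section \<open>Dependence on a parameter, flattening and extended compositions\<close>

lemma lin_on_componentwise:
  "(\<And>j. j \<in> J \<Longrightarrow> lin_on U (\<lambda>x. g x j)) \<Longrightarrow> lin_on U (\<lambda>x j. if j \<in> J then g x j else 0)"
  unfolding lin_on_def plus_fun_def scaleC_fun_def by (intro conjI ballI allI ext) (metis (mono_tags, lifting) add_0 cvec.scale_zero_right)+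

text \<open>Supplies linearity in the second argument for maps such as those of
  \<open>ext_comp\<close> and \<open>xi\<close>. Both sides are linear in \<open>t\<close>, so pure
  tensors decide.\<close>

lemma tmap_right_lin_param:
  assumes sub: "cvec.subspace U" "cvec.subspace V" "cvec.subspace A"
    and c: "\<And>a. a \<in> A \<Longrightarrow> lin_on V (c a)" "\<And>v. v \<in> V \<Longrightarrow> lin_on A (\<lambda>a. c a v)"
    and t: "t \<in> U \<otimes>\<^sub>S V"
  shows "lin_on A (\<lambda>a. tmap_right U V (c a) t)"
proof (rule lin_onI)
  fix a b assume ab: "a \<in> A" "b \<in> A"
  then have s: "a + b \<in> A" by (rule cvec.subspace_add[OF sub(3)])
  show "tmap_right U V (c (a + b)) t = tmap_right U V (c a) t + tmap_right U V (c b) t"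
    by (rule tspace_eqI[OF tmap_right_lin[OF sub(1,2) c(1)[OF s]]
          lin_on_plus[OF tmap_right_lin[OF sub(1,2) c(1)[OF ab(1)]]
            tmap_right_lin[OF sub(1,2) c(1)[OF ab(2)]]] t])
      (simp add: tmap_right_tens[OF sub(1,2)] c(1) ab s tens_add lin_on_add[OF c(2)])
next
  fix k a assume a: "a \<in> A"
  then have s: "k *\<^sub>C a \<in> A" by (rule cvec.subspace_scale[OF sub(3)])
  show "tmap_right U V (c (k *\<^sub>C a)) t = k *\<^sub>C tmap_right U V (c a) t"
    by (rule tspace_eqI[OF tmap_right_lin[OF sub(1,2) c(1)[OF s]]
          lin_on_scaleC[OF tmap_right_lin[OF sub(1,2) c(1)[OF a]]] t])
      (simp add: tmap_right_tens[OF sub(1,2)] c(1) a s tens_scale lin_on_scale[OF c(2)])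
qed

lemma Hom_lin_comp_left:
  assumes "c \<in> Hom (B \<otimes>\<^sub>S A) C" "a \<in> A"
  shows "lin_on B (\<lambda>b. c (b \<otimes> a))"
  by (rule lin_on_compose[OF tens_lin_left _ conjunct1[OF assms(1)[unfolded Hom_iff]]])
    (use assms(2) in \<open>auto intro: tens_mem\<close>)

lemma Hom_lin_comp_right:
  assumes "c \<in> Hom (B \<otimes>\<^sub>S A) C" "b \<in> B"
  shows "lin_on A (\<lambda>a. c (b \<otimes> a))"
  by (rule lin_on_compose[OF tens_lin_right _ conjunct1[OF assms(1)[unfolded Hom_iff]]])
    (use assms(2) in \<open>auto intro: tens_mem\<close>)

lemma Hom_mem: "f \<in> Hom U V \<Longrightarrow> x \<in> U \<Longrightarrow> f x \<in> V"
  by (simp add: Hom_def)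

lemma Hom_lin: "f \<in> Hom U V \<Longrightarrow> lin_on U f"
  by (simp add: Hom_iff)

lemma Hom_out: "f \<in> Hom U V \<Longrightarrow> x \<notin> U \<Longrightarrow> f x = 0"
  by (simp add: Hom_def)

lemma lin_on_restr: "lin_on U f \<Longrightarrow> cvec.subspace U \<Longrightarrow> lin_on U (restr U f)"
  by (simp add: lin_on_def restr_def cvec.subspace_add cvec.subspace_scale)

text \<open>The inner map of \<open>flat\<close>, made separate. Unlike \<open>ctr\<close> it
  accepts functionals in \<open>dual H\<close>, which are linear on \<open>H\<close> only and 0
  elsewhere.\<close>

definition nctr :: "'n::complex_vector set \<Rightarrow> 'h::complex_vector set \<Rightarrow> ('h \<Rightarrow> complex)
    \<Rightarrow> ('n, 'h) tensor \<Rightarrow> 'n"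
  where "nctr N H \<eta> = tlift N H (\<lambda>n h. \<eta> h *\<^sub>C n)"

context
  fixes N :: "'n::complex_vector set" and H :: "'h::complex_vector set"
  assumes sub: "cvec.subspace N" "cvec.subspace H"
begin

lemma nctr_bilin: "\<eta> \<in> dual H \<Longrightarrow> bilin_on N H (\<lambda>n h. \<eta> h *\<^sub>C n)"
  by (rule bilin_onI)
    (auto simp: lin_on_def dual_def Hom_def scaleC_complex_def scaleC_add_left scaleC_scaleC
      scaleC_add_right mult.commute)

lemma nctr_Hom: "\<eta> \<in> dual H \<Longrightarrow> nctr N H \<eta> \<in> Hom (N \<otimes>\<^sub>S H) N"
  unfolding nctr_def using sub by (intro tlift_Hom nctr_bilin) (auto intro: cvec.subspace_scale)

lemma nctr_tens: "\<eta> \<in> dual H \<Longrightarrow> n \<in> N \<Longrightarrow> h \<in> H \<Longrightarrow> nctr N H \<eta> (n \<otimes> h) = \<eta> h *\<^sub>C n"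
  unfolding nctr_def by (rule tlift(2)[OF sub nctr_bilin])

lemma nctr_lin_dual:
  assumes t: "t \<in> N \<otimes>\<^sub>S H"
  shows "lin_on (dual H) (\<lambda>\<eta>. nctr N H \<eta> t)"
proof (rule lin_onI)
  fix a b assume ab: "a \<in> dual H" "b \<in> dual H"
  then have s: "a + b \<in> dual H" by (rule cvec.subspace_add[OF dual_subspace[OF sub(2)]])
  show "nctr N H (a + b) t = nctr N H a t + nctr N H b t"
    by (rule tspace_eqI[OF Hom_lin[OF nctr_Hom[OF s]]
          lin_on_plus[OF Hom_lin[OF nctr_Hom[OF ab(1)]] Hom_lin[OF nctr_Hom[OF ab(2)]]] t])
      (simp add: nctr_tens ab s scaleC_add_left)
next
  fix k a assume a: "a \<in> dual H"
  then have s: "k *\<^sub>C a \<in> dual H" by (rule cvec.subspace_scale[OF dual_subspace[OF sub(2)]])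
  show "nctr N H (k *\<^sub>C a) t = k *\<^sub>C nctr N H a t"
    by (rule tspace_eqI[OF Hom_lin[OF nctr_Hom[OF s]] lin_on_scaleC[OF Hom_lin[OF nctr_Hom[OF a]]] t])
      (simp add: nctr_tens a s scaleC_scaleC,
        simp add: scaleC_fun_def scaleC_complex_def)
qed

context
  fixes U :: "'u::complex_vector set" and \<phi> :: "'u \<Rightarrow> ('n, 'h) tensor"
  assumes U: "cvec.subspace U" and \<phi>: "\<phi> \<in> Hom U (N \<otimes>\<^sub>S H)"
begin

lemma flat_bilin: "bilin_on U (dual H) (\<lambda>u \<eta>. nctr N H \<eta> (\<phi> u))"
proof (rule bilin_onI)
  fix \<eta> assume "\<eta> \<in> dual H"
  then show "lin_on U (\<lambda>u. nctr N H \<eta> (\<phi> u))"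
    by (intro lin_on_compose[OF Hom_lin[OF \<phi>] _ Hom_lin[OF nctr_Hom]]) (use \<phi> in \<open>auto simp: Hom_iff\<close>)
next
  fix u assume "u \<in> U"
  then show "lin_on (dual H) (\<lambda>\<eta>. nctr N H \<eta> (\<phi> u))"
    by (intro nctr_lin_dual Hom_mem[OF \<phi>])
qed

lemma flat_Hom: "flat U N H \<phi> \<in> Hom (U \<otimes>\<^sub>S dual H) N"
  unfolding flat_def nctr_def[symmetric]
  using U \<phi> sub by (intro tlift_Hom flat_bilin) (auto intro: Hom_mem[OF nctr_Hom] Hom_mem)

lemma flat_tens: "u \<in> U \<Longrightarrow> \<eta> \<in> dual H \<Longrightarrow> flat U N H \<phi> (u \<otimes> \<eta>) = nctr N H \<eta> (\<phi> u)"
  unfolding flat_def nctr_def[symmetric] by (rule tlift(2)[OF U _ flat_bilin]) (simp_all add: sub)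

end

end

context
  fixes U :: "'u::complex_vector set" and A :: "'a::complex_vector set"
    and X :: "'x::complex_vector set" and B :: "'b::complex_vector set"
    and C :: "'c::complex_vector set" and c f
  assumes sub: "cvec.subspace U" "cvec.subspace A" "cvec.subspace X" "cvec.subspace B"
    and c: "c \<in> Hom (B \<otimes>\<^sub>S A) C" and f: "f \<in> Hom U (X \<otimes>\<^sub>S B)"
begin

lemma ext_comp_bilin: "bilin_on U A (\<lambda>u a. tmap_right X B (\<lambda>b. c (b \<otimes> a)) (f u))"
proof (rule bilin_onI)
  fix a assume "a \<in> A"
  then show "lin_on U (\<lambda>u. tmap_right X B (\<lambda>b. c (b \<otimes> a)) (f u))"
    by (intro lin_on_compose[OF Hom_lin[OF f] _ tmap_right_lin[OF sub(3,4) Hom_lin_comp_left[OF c]]])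
      (use f in \<open>auto simp: Hom_iff\<close>)
next
  fix u assume "u \<in> U"
  then show "lin_on A (\<lambda>a. tmap_right X B (\<lambda>b. c (b \<otimes> a)) (f u))"
    by (intro tmap_right_lin_param[OF sub(3,4,2)] Hom_lin_comp_left[OF c] Hom_lin_comp_right[OF c]
        Hom_mem[OF f])
qed

lemma ext_comp_tens: "u \<in> U \<Longrightarrow> a \<in> A \<Longrightarrow>
    ext_comp U A X B c f (u \<otimes> a) = tmap_right X B (\<lambda>b. c (b \<otimes> a)) (f u)"
  unfolding ext_comp_def by (rule tlift(2)[OF sub(1,2) ext_comp_bilin])

lemma ext_comp_Hom: "ext_comp U A X B c f \<in> Hom (U \<otimes>\<^sub>S A) (X \<otimes>\<^sub>S C)"
  unfolding ext_comp_def
proof (rule tlift_Hom[OF sub(1,2) ext_comp_bilin tspace_subspace])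
  fix u a assume ua: "u \<in> U" "a \<in> A"
  show "tmap_right X B (\<lambda>b. c (b \<otimes> a)) (f u) \<in> X \<otimes>\<^sub>S C"
    by (rule tmap_right_mem[OF sub(3,4) Hom_lin_comp_left[OF c ua(2)] order_refl order_refl _ Hom_mem[OF f ua(1)]])
      (use ua in \<open>auto intro: Hom_mem[OF c] tens_mem\<close>)
qed

end

section \<open>Consequences of the setting\<close>

abbreviation Phi ::
    "('a::complex_vector, 'h::complex_vector, 'm::complex_vector, 'n::complex_vector) comp_data
      \<Rightarrow> (nat \<Rightarrow> 'm \<Rightarrow> ('n, 'h) tensor) \<Rightarrow> nat \<Rightarrow> ('m, 'h \<Rightarrow> complex) tensor \<Rightarrow> 'n"
  where "Phi D w j \<equiv> flat (spM D j) (spN D) (spH D j) (w j)"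

text \<open>The product of \<open>\<eta> \<in> H\<^sub>1\<^sub>1\<^sup>*\<close> with an element of \<open>M\<^sub>j \<otimes> A\<^sub>j\<^sub>1\<close>, in \<open>M\<^sub>j \<otimes> H\<^sub>1\<^sub>j\<^sup>*\<close>.\<close>

definition pair_dual ::
    "('a::complex_vector, 'h::complex_vector, 'm::complex_vector, 'n::complex_vector) comp_data
      \<Rightarrow> nat \<Rightarrow> ('h \<Rightarrow> complex) \<Rightarrow> ('m, 'a) tensor \<Rightarrow> ('m, 'h \<Rightarrow> complex) tensor"
  where "pair_dual D j \<eta> = tmap_right (spM D j) (spA D j 1) (\<lambda>a. ind_dual D j 1 (\<eta> \<otimes> a))"

context comp_setting
begin

lemma subA: "1 \<le> i \<Longrightarrow> i \<le> j \<Longrightarrow> j \<le> rk D \<Longrightarrow> cvec.subspace (spA D j i)"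
  by (rule fin_dim_subspace[OF fin_dim_A])

lemma subH: "1 \<le> i \<Longrightarrow> i \<le> rk D \<Longrightarrow> cvec.subspace (spH D i)"
  by (rule fin_dim_subspace[OF fin_dim_H])

lemma subM: "1 \<le> i \<Longrightarrow> i \<le> rk D \<Longrightarrow> cvec.subspace (spM D i)"
  by (rule fin_dim_subspace[OF fin_dim_M])

lemma subN: "cvec.subspace (spN D)"
  by (rule fin_dim_subspace[OF fin_dim_N])

lemma unitA_mem: "1 \<le> i \<Longrightarrow> i \<le> rk D \<Longrightarrow> unitA D i \<in> spA D i i"
  using A_diag[of i] by (auto intro: cvec.span_base)

lemma unitA_nz: "1 \<le> i \<Longrightarrow> i \<le> rk D \<Longrightarrow> unitA D i \<noteq> 0"
  using A_diag[of i] by simp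

lemma dim_A_diag: "1 \<le> i \<Longrightarrow> i \<le> rk D \<Longrightarrow> cvec.dim (spA D i i) = 1"
  using A_diag[of i] cvec.dim_span_eq_card_independent[of "{unitA D i}"] by simp

text \<open>A_ii is a line, so scalars move to the left factor and the tensors m \<otimes> 1 already
  form a subspace. This is the identification of M \<otimes> A_ii with M.\<close>

lemma tens_unit_ex:
  assumes "1 \<le> i" "i \<le> rk D" "cvec.subspace M" "t \<in> M \<otimes>\<^sub>S spA D i i"
  obtains m where "m \<in> M" "t = m \<otimes> unitA D i"
proof -
  have "cvec.subspace ((\<lambda>m. m \<otimes> unitA D i) ` M)"
    by (rule lin_on_subspace_image[OF tens_lin_left assms(3)])
  moreover have "u \<otimes> v \<in> (\<lambda>m. m \<otimes> unitA D i) ` M" if "u \<in> M" "v \<in> spA D i i" for u v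
  proof -
    have "v \<in> range (\<lambda>k. k *\<^sub>C unitA D i)"
      using that(2) A_diag[OF assms(1,2)] by (auto simp: cvec.span_singleton)
    then obtain k where "v = k *\<^sub>C unitA D i" by blast
    then have "u \<otimes> v = (k *\<^sub>C u) \<otimes> unitA D i" by (simp add: tens_scale)
    then show ?thesis using cvec.subspace_scale[OF assms(3) that(1)] by blast
  qed
  ultimately have "M \<otimes>\<^sub>S spA D i i \<subseteq> (\<lambda>m. m \<otimes> unitA D i) ` M" by (rule tspace_least)
  then show thesis using assms(4) that by blast
qed

lemma compA_mem: "1 \<le> i \<Longrightarrow> i \<le> j \<Longrightarrow> j \<le> k \<Longrightarrow> k \<le> rk D \<Longrightarrow> b \<in> spA D k j \<Longrightarrow> a \<in> spA D j i \<Longrightarrow>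
    compA D k j i (b \<otimes> a) \<in> spA D k i"
  by (rule Hom_mem[OF compA_hom]) (auto intro: tens_mem)

lemma compH_mem: "1 \<le> i \<Longrightarrow> i \<le> j \<Longrightarrow> j \<le> rk D \<Longrightarrow> h \<in> spH D j \<Longrightarrow> a \<in> spA D j i \<Longrightarrow>
    compH D j i (h \<otimes> a) \<in> spH D i"
  by (rule Hom_mem[OF compH_hom]) (auto intro: tens_mem)

section \<open>Induced maps on duals and products with H_11^*\<close>

context
  fixes i j :: nat
  assumes ij: "1 \<le> i" "i \<le> j" "j \<le> rk D"
begin

lemma ind_dual_bilin:
  "bilin_on (dual (spH D i)) (spA D j i) (\<lambda>\<eta> a. restr (spH D j) (\<lambda>h. \<eta> (compH D j i (h \<otimes> a))))"
proof (rule bilin_onI)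
  fix a assume "a \<in> spA D j i"
  show "lin_on (dual (spH D i)) (\<lambda>\<eta>. restr (spH D j) (\<lambda>h. \<eta> (compH D j i (h \<otimes> a))))"
    by (rule lin_onI) (auto simp: restr_def scaleC_fun_def)
next
  fix \<eta> assume "\<eta> \<in> dual (spH D i)"
  note \<eta> = dualD(1)[OF this]
  have *: "lin_on (spA D j i) (\<lambda>a. \<eta> (compH D j i (h \<otimes> a)))" if "h \<in> spH D j" for h
    by (rule lin_on_compose[OF Hom_lin_comp_right[OF compH_hom[OF ij] that] _ \<eta>])
      (use that ij compH_mem in auto)
  show "lin_on (spA D j i) (\<lambda>a. restr (spH D j) (\<lambda>h. \<eta> (compH D j i (h \<otimes> a))))"
    by (rule lin_onI)
      (auto simp: restr_def fun_eq_iff scaleC_fun_def lin_on_add[OF *] lin_on_scale[OF *])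
qed

lemma ind_dual_tens:
  "\<eta> \<in> dual (spH D i) \<Longrightarrow> a \<in> spA D j i \<Longrightarrow>
    ind_dual D j i (\<eta> \<otimes> a) = restr (spH D j) (\<lambda>h. \<eta> (compH D j i (h \<otimes> a)))"
  unfolding ind_dual_def
  using ij by (intro tlift(2) ind_dual_bilin) (auto intro!: dual_subspace subA subH)

lemma ind_dual_Hom: "ind_dual D j i \<in> Hom (dual (spH D i) \<otimes>\<^sub>S spA D j i) (dual (spH D j))"
  unfolding ind_dual_def
proof (rule tlift_Hom)
  fix \<eta> a assume \<eta>: "\<eta> \<in> dual (spH D i)" and a: "a \<in> spA D j i"
  show "restr (spH D j) (\<lambda>h. \<eta> (compH D j i (h \<otimes> a))) \<in> dual (spH D j)"
    by (rule dual_restr[OF lin_on_compose[OF Hom_lin_comp_left[OF compH_hom[OF ij] a] _ dualD(1)[OF \<eta>]]])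
      (use ij a compH_mem subH in auto)
qed (use ij in \<open>auto intro!: dual_subspace subA subH ind_dual_bilin\<close>)

lemma ind_dual_mem: "\<eta> \<in> dual (spH D i) \<Longrightarrow> a \<in> spA D j i \<Longrightarrow> ind_dual D j i (\<eta> \<otimes> a) \<in> dual (spH D j)"
  by (rule Hom_mem[OF ind_dual_Hom]) (rule tens_mem)

end

text \<open>The transpose of \<open>assoc_H\<close>: letting \<open>a\<close> and then
  \<open>b\<close> act on a functional is the same as letting the composition of \<open>b\<close>
  and \<open>a\<close> act. Outside H_1k both sides are 0 by convention.\<close>

lemma ind_dual_assoc:
  assumes "1 \<le> i" "i \<le> j" "j \<le> k" "k \<le> rk D"
    and "\<eta> \<in> dual (spH D i)" "a \<in> spA D j i" "b \<in> spA D k j"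
  shows "ind_dual D k j (ind_dual D j i (\<eta> \<otimes> a) \<otimes> b) = ind_dual D k i (\<eta> \<otimes> compA D k j i (b \<otimes> a))"
proof
  fix h
  show "ind_dual D k j (ind_dual D j i (\<eta> \<otimes> a) \<otimes> b) h = ind_dual D k i (\<eta> \<otimes> compA D k j i (b \<otimes> a)) h"
  proof (cases "h \<in> spH D k")
    case True
    then have "compH D k j (h \<otimes> b) \<in> spH D j" using assms by (intro compH_mem) auto
    moreover have "ind_dual D j i (\<eta> \<otimes> a) \<in> dual (spH D j)" using assms by (intro ind_dual_mem) auto
    moreover have "compA D k j i (b \<otimes> a) \<in> spA D k i" using assms by (intro compA_mem) auto
    ultimately show ?thesis
      using assms True by (simp add: ind_dual_tens restr_def assoc_H)
  next
    case False
    moreover have "ind_dual D j i (\<eta> \<otimes> a) \<in> dual (spH D j)" using assms by (intro ind_dual_mem) auto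
    moreover have "compA D k j i (b \<otimes> a) \<in> spA D k i" using assms by (intro compA_mem) auto
    ultimately show ?thesis using assms by (simp add: ind_dual_tens restr_def)
  qed
qed

context
  fixes j :: nat
  assumes j: "1 \<le> j" "j \<le> rk D"
begin

lemma pair_lin_A: "\<eta> \<in> dual (spH D 1) \<Longrightarrow> lin_on (spA D j 1) (\<lambda>a. ind_dual D j 1 (\<eta> \<otimes> a))"
  using j by (intro Hom_lin_comp_right[OF ind_dual_Hom]) auto

lemma pair_dual_lin: "\<eta> \<in> dual (spH D 1) \<Longrightarrow> lin_on (spM D j \<otimes>\<^sub>S spA D j 1) (pair_dual D j \<eta>)"
  unfolding pair_dual_def using j by (intro tmap_right_lin pair_lin_A) (auto intro: subM subA)

lemma pair_dual_tens: "\<eta> \<in> dual (spH D 1) \<Longrightarrow> m \<in> spM D j \<Longrightarrow> a \<in> spA D j 1 \<Longrightarrow>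
    pair_dual D j \<eta> (m \<otimes> a) = m \<otimes> ind_dual D j 1 (\<eta> \<otimes> a)"
  unfolding pair_dual_def using j by (intro tmap_right_tens pair_lin_A) (auto intro: subM subA)

lemma pair_dual_mem:
  assumes "\<eta> \<in> dual (spH D 1)" "M' \<subseteq> spM D j" "t \<in> M' \<otimes>\<^sub>S spA D j 1"
  shows "pair_dual D j \<eta> t \<in> M' \<otimes>\<^sub>S dual (spH D j)"
  unfolding pair_dual_def
  using j assms(1)
  by (intro tmap_right_mem[OF _ _ pair_lin_A assms(2) order_refl _ assms(3)])
    (auto intro: subM subA ind_dual_mem)

lemma pair_dual_lin_dual:
  assumes "t \<in> spM D j \<otimes>\<^sub>S spA D j 1"
  shows "lin_on (dual (spH D 1)) (\<lambda>\<eta>. pair_dual D j \<eta> t)"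
  unfolding pair_dual_def using j
  by (intro tmap_right_lin_param[OF _ _ _ _ _ assms] pair_lin_A Hom_lin_comp_left[OF ind_dual_Hom])
    (auto intro!: subM subA subH dual_subspace)

end

lemma pair_dual_unit:
  assumes "1 \<le> rk D" "\<eta> \<in> dual (spH D 1)" "m \<in> spM D 1"
  shows "pair_dual D 1 \<eta> (m \<otimes> unitA D 1) = m \<otimes> \<eta>"
proof -
  have "ind_dual D 1 1 (\<eta> \<otimes> unitA D 1) = \<eta>"
    using assms unitA_mem[of 1] unit_H[of 1] dualD(2)[OF assms(2)]
    by (auto simp: ind_dual_tens restr_def fun_eq_iff)
  then show ?thesis using assms unitA_mem[of 1] by (simp add: pair_dual_tens)
qed

section \<open>Elements of W and the last component of zeta\<close>

lemma W_mem: "w \<in> W_space D \<Longrightarrow> 1 \<le> j \<Longrightarrow> j \<le> rk D \<Longrightarrow> w j \<in> Hom (spM D j) (spN D \<otimes>\<^sub>S spH D j)"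
  by (auto simp: W_space_def dsum_def)

lemma Phi_Hom:
  "w \<in> W_space D \<Longrightarrow> 1 \<le> j \<Longrightarrow> j \<le> rk D \<Longrightarrow> Phi D w j \<in> Hom (spM D j \<otimes>\<^sub>S dual (spH D j)) (spN D)"
  by (intro flat_Hom subN subH subM W_mem)

lemma ext_W_Hom:
  "w \<in> W_space D \<Longrightarrow> 1 \<le> i \<Longrightarrow> i \<le> j \<Longrightarrow> j \<le> rk D \<Longrightarrow>
    ext_W D w j i \<in> Hom (spM D j \<otimes>\<^sub>S spA D j i) (spN D \<otimes>\<^sub>S spH D i)"
  unfolding ext_W_def by (intro ext_comp_Hom subN subH subM subA W_mem compH_hom) auto

lemma ext_W_tens:
  "w \<in> W_space D \<Longrightarrow> 1 \<le> i \<Longrightarrow> i \<le> j \<Longrightarrow> j \<le> rk D \<Longrightarrow> m \<in> spM D j \<Longrightarrow> a \<in> spA D j i \<Longrightarrow>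
    ext_W D w j i (m \<otimes> a) = tmap_right (spN D) (spH D j) (\<lambda>h. compH D j i (h \<otimes> a)) (w j m)"
  unfolding ext_W_def by (rule ext_comp_tens) (auto intro: subN subH subM subA W_mem compH_hom)

text \<open>Moves \<open>\<eta>\<close> across the composition: \<open>\<eta>\<close> evaluated on
  the product of \<open>h\<close> and \<open>a\<close> is the product of \<open>\<eta>\<close> and
  \<open>a\<close> evaluated on \<open>h\<close>. Thus \<gamma>(w) is expressed by the maps M_j
  \<otimes> H_1j^* -> N_1 and by the same products that define \<delta>_1.\<close>

lemma nctr_ext_W:
  assumes w: "w \<in> W_space D" and j: "1 \<le> j" "j \<le> rk D"
    and \<eta>: "\<eta> \<in> dual (spH D 1)" and t: "t \<in> spM D j \<otimes>\<^sub>S spA D j 1"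
  shows "nctr (spN D) (spH D 1) \<eta> (ext_W D w j 1 t) = Phi D w j (pair_dual D j \<eta> t)"
proof (rule tspace_eqI[OF _ _ t])
  have r: "1 \<le> rk D" using j by simp
  show "lin_on (spM D j \<otimes>\<^sub>S spA D j 1) (\<lambda>t. nctr (spN D) (spH D 1) \<eta> (ext_W D w j 1 t))"
    by (rule lin_on_compose[OF Hom_lin[OF ext_W_Hom[OF w]] _ Hom_lin[OF nctr_Hom[OF subN subH \<eta>]]])
      (use j Hom_mem[OF ext_W_Hom[OF w]] in auto)
  show "lin_on (spM D j \<otimes>\<^sub>S spA D j 1) (\<lambda>t. Phi D w j (pair_dual D j \<eta> t))"
    by (rule lin_on_compose[OF pair_dual_lin[OF j \<eta>] _ Hom_lin[OF Phi_Hom[OF w j]]])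
      (use pair_dual_mem[OF j \<eta> order_refl] in auto)
  fix m a assume m: "m \<in> spM D j" and a: "a \<in> spA D j 1"
  have l: "lin_on (spH D j) (\<lambda>h. compH D j 1 (h \<otimes> a))"
    by (rule Hom_lin_comp_left[OF compH_hom a]) (use j in auto)
  have \<eta>a: "ind_dual D j 1 (\<eta> \<otimes> a) \<in> dual (spH D j)" using j \<eta> a by (intro ind_dual_mem) auto
  have wm: "w j m \<in> spN D \<otimes>\<^sub>S spH D j" by (rule Hom_mem[OF W_mem[OF w j] m])
  \<comment> \<open>For fixed \<open>a\<close>, the value \<open>w j m\<close> is replaced by an
    arbitrary tensor, so that pure tensors n \<otimes> h suffice.\<close>
  have "nctr (spN D) (spH D 1) \<eta> (tmap_right (spN D) (spH D j) (\<lambda>h. compH D j 1 (h \<otimes> a)) x) =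
      nctr (spN D) (spH D j) (ind_dual D j 1 (\<eta> \<otimes> a)) x" if "x \<in> spN D \<otimes>\<^sub>S spH D j" for x
  proof (rule tspace_eqI[OF _ _ that])
    show "lin_on (spN D \<otimes>\<^sub>S spH D j)
        (\<lambda>x. nctr (spN D) (spH D 1) \<eta> (tmap_right (spN D) (spH D j) (\<lambda>h. compH D j 1 (h \<otimes> a)) x))"
      by (rule lin_on_compose[OF tmap_right_lin[OF subN subH[OF j] l] _
            Hom_lin[OF nctr_Hom[OF subN subH[OF order_refl r] \<eta>]]])
        (use tmap_right_mem[OF subN subH[OF j] l order_refl order_refl, of "spH D 1"]
          compH_mem[of 1 j] j a in auto)
    show "lin_on (spN D \<otimes>\<^sub>S spH D j) (nctr (spN D) (spH D j) (ind_dual D j 1 (\<eta> \<otimes> a)))"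
      by (rule Hom_lin[OF nctr_Hom[OF subN subH[OF j] \<eta>a]])
    fix n h assume "n \<in> spN D" "h \<in> spH D j"
    then show "nctr (spN D) (spH D 1) \<eta>
          (tmap_right (spN D) (spH D j) (\<lambda>h. compH D j 1 (h \<otimes> a)) (n \<otimes> h)) =
        nctr (spN D) (spH D j) (ind_dual D j 1 (\<eta> \<otimes> a)) (n \<otimes> h)"
      using j a \<eta> r \<eta>a compH_mem[of 1 j h a]
      by (simp add: tmap_right_tens[OF subN subH l] nctr_tens[OF subN subH] ind_dual_tens restr_def)
  qed
  then show "nctr (spN D) (spH D 1) \<eta> (ext_W D w j 1 (m \<otimes> a)) = Phi D w j (pair_dual D j \<eta> (m \<otimes> a))"
    using ext_W_tens[OF w, of 1 j m a] flat_tens[OF subN subH[OF j] subM[OF j] W_mem[OF w j] m \<eta>a]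
      pair_dual_tens[OF j \<eta> m a] j m a wm by simp
qed

lemma P_subspace: "1 \<le> i \<Longrightarrow> cvec.subspace (P_space D i)"
  unfolding P_space_def by (intro dsum_subspace) simp

lemma P_mem: "p \<in> P_space D i \<Longrightarrow> i \<le> j \<Longrightarrow> j \<le> rk D \<Longrightarrow> p j \<in> spM D j \<otimes>\<^sub>S spA D j i"
  by (simp add: P_space_def dsum_def)

lemma P_out: "p \<in> P_space D i \<Longrightarrow> j \<notin> {i..rk D} \<Longrightarrow> p j = 0"
  by (simp add: P_space_def dsum_def)

lemma gamma_Hom:
  assumes "w \<in> W_space D"
  shows "gamma_map D w \<in> Hom (P_space D 1) (spN D \<otimes>\<^sub>S spH D 1)"
proof -
  have "lin_on (P_space D 1) (\<lambda>p. \<Sum>i=1..rk D. ext_W D w i 1 (p i))"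
    by (intro lin_on_sum_fun lin_on_compose[OF proj_lin_on _ Hom_lin[OF ext_W_Hom[OF assms]]])
      (auto intro: P_mem)
  then have "lin_on (P_space D 1) (gamma_map D w)"
    unfolding gamma_map_def by (rule lin_on_restr[OF _ P_subspace[OF order_refl]])
  moreover have "(\<Sum>i=1..rk D. ext_W D w i 1 (p i)) \<in> spN D \<otimes>\<^sub>S spH D 1" if "p \<in> P_space D 1" for p
    by (intro cvec.subspace_sum tspace_subspace Hom_mem[OF ext_W_Hom[OF assms]]) (auto intro: P_mem that)
  ultimately show ?thesis by (auto simp: Hom_iff gamma_map_def restr_def)
qed

text \<open>All later computations with the last component of \<zeta>(w) go through this formula.
  Its j-th term involves only the component of \<open>p\<close> in M_j \<otimes> A_j1, so vectors
  with one nonzero component isolate one map \<open>Phi D w j\<close>.\<close>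

lemma zeta_snd_tens:
  assumes w: "w \<in> W_space D" and p: "p \<in> P_space D 1" and \<eta>: "\<eta> \<in> dual (spH D 1)" and r: "1 \<le> rk D"
  shows "snd (zeta D w) (p \<otimes> \<eta>) = (\<Sum>j=1..rk D. Phi D w j (pair_dual D j \<eta> (p j)))"
proof -
  have "snd (zeta D w) (p \<otimes> \<eta>) = nctr (spN D) (spH D 1) \<eta> (\<Sum>j=1..rk D. ext_W D w j 1 (p j))"
    using flat_tens[OF subN subH[OF order_refl r] P_subspace[OF order_refl] gamma_Hom[OF w] p \<eta>] p
    by (simp add: zeta_def gamma_map_def restr_def)
  also have "\<dots> = (\<Sum>j=1..rk D. nctr (spN D) (spH D 1) \<eta> (ext_W D w j 1 (p j)))"
    by (rule lin_on_sum[OF Hom_lin[OF nctr_Hom[OF subN subH[OF order_refl r] \<eta>]]])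
      (auto intro!: Hom_mem[OF ext_W_Hom[OF w]] P_mem p)
  also have "\<dots> = (\<Sum>j=1..rk D. Phi D w j (pair_dual D j \<eta> (p j)))"
    by (intro sum.cong refl nctr_ext_W[OF w _ _ \<eta>]) (auto intro: P_mem p)
  finally show ?thesis .
qed

section \<open>The maps xi\<close>

context
  fixes i :: nat
  assumes i: "2 \<le> i" "i \<le> rk D"
begin

lemma xi_bilin: "bilin_on (P_space D i) (spA D i (i - 1)) (\<lambda>p a j. if j \<in> {i..rk D}
      then tmap_right (spM D j) (spA D j i) (\<lambda>b. compA D j i (i - 1) (b \<otimes> a)) (p j) else 0)"
proof -
  have l: "lin_on (P_space D i)
      (\<lambda>p. tmap_right (spM D j) (spA D j i) (\<lambda>b. compA D j i (i - 1) (b \<otimes> a)) (p j))"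
    if "j \<in> {i..rk D}" "a \<in> spA D i (i - 1)" for a j
    by (rule lin_on_compose[OF proj_lin_on _ tmap_right_lin[OF subM subA Hom_lin_comp_left[OF compA_hom]]])
      (use that i P_mem in auto)
  have l': "lin_on (spA D i (i - 1))
      (\<lambda>a. tmap_right (spM D j) (spA D j i) (\<lambda>b. compA D j i (i - 1) (b \<otimes> a)) (p j))"
    if "j \<in> {i..rk D}" "p \<in> P_space D i" for p j
    by (rule tmap_right_lin_param[OF subM subA subA Hom_lin_comp_left[OF compA_hom] Hom_lin_comp_right[OF compA_hom]])
      (use that i P_mem in auto)
  show ?thesis
    by (rule bilin_onI; rule lin_on_componentwise) (auto intro: l l')
qed

lemma xi_tens: "p \<in> P_space D i \<Longrightarrow> a \<in> spA D i (i - 1) \<Longrightarrow> xi D i (p \<otimes> a) = (\<lambda>j. if j \<in> {i..rk D}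
      then tmap_right (spM D j) (spA D j i) (\<lambda>b. compA D j i (i - 1) (b \<otimes> a)) (p j) else 0)"
  unfolding xi_def using i by (intro tlift(2) xi_bilin) (auto intro!: P_subspace subA)

text \<open>The map \<xi>_i changes only the A factor, so a subspace M' of the M factor is carried
  along. Invariance of generated families rests on this.\<close>

lemma xi_step_mem:
  assumes "j \<in> {i..rk D}" "a \<in> spA D i (i - 1)" "M' \<subseteq> spM D j" "t \<in> M' \<otimes>\<^sub>S spA D j i"
  shows "tmap_right (spM D j) (spA D j i) (\<lambda>b. compA D j i (i - 1) (b \<otimes> a)) t \<in> M' \<otimes>\<^sub>S spA D j (i - 1)"
  by (rule tmap_right_mem[OF subM subA Hom_lin_comp_left[OF compA_hom] assms(3) order_refl _ assms(4)])
    (use assms(1,2) i in \<open>auto intro: compA_mem\<close>)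

lemma xi_Hom: "xi D i \<in> Hom (P_space D i \<otimes>\<^sub>S spA D i (i - 1)) (P_space D (i - 1))"
  unfolding xi_def
proof (rule tlift_Hom[OF _ _ xi_bilin])
  fix p a assume p: "p \<in> P_space D i" and a: "a \<in> spA D i (i - 1)"
  show "(\<lambda>j. if j \<in> {i..rk D}
      then tmap_right (spM D j) (spA D j i) (\<lambda>b. compA D j i (i - 1) (b \<otimes> a)) (p j) else 0)
    \<in> P_space D (i - 1)"
    unfolding P_space_def using xi_step_mem[OF _ a order_refl P_mem[OF p]]
    by (intro dsumI) (auto simp: cvec.subspace_0)
qed (use i in \<open>auto intro!: P_subspace subA\<close>)

end

lemma zeta_mem:
  assumes w: "w \<in> W_space D" and r: "1 \<le> rk D"
  shows "zeta D w \<in> bW_space D"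
  unfolding zeta_def bW_space_def
  by (auto simp: dsum_def intro!: xi_Hom flat_Hom subN subH[OF order_refl r] P_subspace gamma_Hom[OF w])

lemma P_dim:
  assumes "1 \<le> i"
  shows "cvec.dim (P_space D i) = (\<Sum>j=i..rk D. cvec.dim (spM D j) * cvec.dim (spA D j i))"
proof -
  have "cvec.dim (P_space D i) = (\<Sum>j=i..rk D. cvec.dim (spM D j \<otimes>\<^sub>S spA D j i))"
    unfolding P_space_def
    by (rule conjunct2[OF dsum_fin_dim]) (use assms in \<open>auto intro!: tspace_fin_dim fin_dim_M fin_dim_A\<close>)
  also have "\<dots> = (\<Sum>j=i..rk D. cvec.dim (spM D j) * cvec.dim (spA D j i))"
    using assms by (intro sum.cong refl tspace_fin_dim fin_dim_M fin_dim_A) auto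
  finally show ?thesis .
qed

lemma Phi_pair_dual_zero:
  assumes "w \<in> W_space D" "j \<in> {1..rk D}" "\<eta> \<in> dual (spH D 1)"
  shows "Phi D w j (pair_dual D j \<eta> 0) = 0"
proof -
  have "pair_dual D j \<eta> 0 = 0"
    by (rule lin_on_zero[OF pair_dual_lin[OF _ _ assms(3)] tspace_subspace]) (use assms(2) in auto)
  moreover have "Phi D w j 0 = 0"
    by (rule lin_on_zero[OF Hom_lin[OF Phi_Hom[OF assms(1)]] tspace_subspace]) (use assms(2) in auto)
  ultimately show ?thesis by simp
qed

lemma fin_dim_P: "1 \<le> i \<Longrightarrow> fin_dim (P_space D i)"
  unfolding P_space_def
  by (rule conjunct1[OF dsum_fin_dim]) (auto intro!: tspace_fin_dim fin_dim_M fin_dim_A)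

end

section \<open>Invariant families and shifts of w\<close>

lemma image_tspace_subset_iff:
  assumes "lin_on (U \<otimes>\<^sub>S V) f" "cvec.subspace W"
  shows "f ` (U \<otimes>\<^sub>S V) \<subseteq> W \<longleftrightarrow> (\<forall>u\<in>U. \<forall>v\<in>V. f (u \<otimes> v) \<in> W)"
  using tspace_mapI[OF assms] by (auto intro: tens_mem)

abbreviation shift_maps ::
    "('a::complex_vector, 'h, 'm::complex_vector, 'n) comp_data \<Rightarrow> ('m \<Rightarrow> ('m, 'a) tensor) set"
  where "shift_maps D \<equiv> Hom (spM D 1) (spM D 2 \<otimes>\<^sub>S spA D 2 1)"

abbreviation family_value ::
    "('a, 'h, 'm, 'n) comp_data \<Rightarrow> (nat \<Rightarrow> real) \<Rightarrow> real \<Rightarrow> (nat \<Rightarrow> 'v::complex_vector set) \<Rightarrow> 'q::complex_vector set \<Rightarrow> real"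
  where "family_value D l mu V Q \<equiv> (\<Sum>i=1..rk D. l i * dimr (V i)) - mu * dimr Q"

text \<open>The action of the unipotent matrix whose only entry off the diagonal is
  \<open>- s : M\<^sub>1 \<rightarrow> M\<^sub>2 \<otimes> A\<^sub>2\<^sub>1\<close>.\<close>

definition shiftW ::
    "('a::complex_vector, 'h::complex_vector, 'm::complex_vector, 'n::complex_vector) comp_data
      \<Rightarrow> (nat \<Rightarrow> 'm \<Rightarrow> ('n, 'h) tensor) \<Rightarrow> ('m \<Rightarrow> ('m, 'a) tensor) \<Rightarrow> nat \<Rightarrow> 'm \<Rightarrow> ('n, 'h) tensor"
  where "shiftW D w s i = (if i = 1 then (\<lambda>m. w 1 m + ext_W D w 2 1 (s m)) else w i)"

abbreviation P_sub ::
    "('a::complex_vector, 'h, 'm::complex_vector, 'n) comp_data \<Rightarrow> (nat \<Rightarrow> 'm set) \<Rightarrow> nat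
      \<Rightarrow> ('m, 'a) pvec set"
  where "P_sub D M' i \<equiv> dsum {i..rk D} (\<lambda>j. M' j \<otimes>\<^sub>S spA D j i)"

lemma sum_triangle_swap:
  fixes g :: "nat \<Rightarrow> nat \<Rightarrow> real"
  shows "(\<Sum>i=1..r. \<Sum>j=i..r. g i j) = (\<Sum>j=1..r. \<Sum>i=1..j. g i j)"
proof -
  have "(\<Sum>i=1..r. \<Sum>j=i..r. g i j) = (\<Sum>i=1..r. \<Sum>j=1..r. if i \<le> j then g i j else 0)"
    by (intro sum.cong refl sum.mono_neutral_cong_left) auto
  also have "\<dots> = (\<Sum>j=1..r. \<Sum>i=1..r. if i \<le> j then g i j else 0)" by (rule sum.swap)
  also have "\<dots> = (\<Sum>j=1..r. \<Sum>i=1..j. g i j)"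
    by (intro sum.cong refl sum.mono_neutral_cong_right) auto
  finally show ?thesis .
qed

lemma proper_familiesD:
  assumes "(V', Q') \<in> proper_families r V Q"
  shows "i \<in> {1..r} \<Longrightarrow> cvec.subspace (V' i)" "i \<in> {1..r} \<Longrightarrow> V' i \<subseteq> V i"
    and "cvec.subspace Q'" "Q' \<subseteq> Q"
  using assms by (auto simp: proper_families_def)

context comp_setting
begin

lemma invariant_W_iff:
  assumes "w \<in> W_space D"
  shows "(M', N') \<in> invariant_families_W D w \<longleftrightarrow>
    (M', N') \<in> proper_families (rk D) (spM D) (spN D) \<and>
    (\<forall>i\<in>{1..rk D}. \<forall>m\<in>M' i. \<forall>\<eta>\<in>dual (spH D i). Phi D w i (m \<otimes> \<eta>) \<in> N')"
proof -
  have "Phi D w i ` (M' i \<otimes>\<^sub>S dual (spH D i)) \<subseteq> N' \<longleftrightarrow>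
      (\<forall>m\<in>M' i. \<forall>\<eta>\<in>dual (spH D i). Phi D w i (m \<otimes> \<eta>) \<in> N')"
    if "(M', N') \<in> proper_families (rk D) (spM D) (spN D)" "i \<in> {1..rk D}" for i
    by (rule image_tspace_subset_iff[OF lin_on_subset[OF Hom_lin[OF Phi_Hom[OF assms]] tspace_mono]])
      (use that proper_familiesD[OF that(1)] in auto)
  then show ?thesis unfolding invariant_families_W_def by blast
qed

lemma invariant_bW_iff:
  assumes w: "w \<in> W_space D" and r: "1 \<le> rk D"
  shows "(P', Q') \<in> invariant_families_bW D (zeta D w) \<longleftrightarrow>
    (P', Q') \<in> proper_families (rk D) (P_space D) (spN D) \<and>
    (\<forall>i\<in>{2..rk D}. \<forall>p\<in>P' i. \<forall>a\<in>spA D i (i - 1). xi D i (p \<otimes> a) \<in> P' (i - 1)) \<and>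
    (\<forall>p\<in>P' 1. \<forall>\<eta>\<in>dual (spH D 1). snd (zeta D w) (p \<otimes> \<eta>) \<in> Q')"
proof -
  have 1: "xi D i ` (P' i \<otimes>\<^sub>S spA D i (i - 1)) \<subseteq> P' (i - 1) \<longleftrightarrow>
      (\<forall>p\<in>P' i. \<forall>a\<in>spA D i (i - 1). xi D i (p \<otimes> a) \<in> P' (i - 1))"
    if "(P', Q') \<in> proper_families (rk D) (P_space D) (spN D)" "i \<in> {2..rk D}" for i
  proof -
    have "i - 1 \<in> {1..rk D}" using that(2) unfolding atLeastAtMost_iff by arith
    note sub = proper_familiesD(1)[OF that(1) this]
    show ?thesis
      by (rule image_tspace_subset_iff[OF lin_on_subset[OF Hom_lin[OF xi_Hom] tspace_mono]])
        (use that proper_familiesD[OF that(1)] sub in auto)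
  qed
  have z: "snd (zeta D w) \<in> Hom (P_space D 1 \<otimes>\<^sub>S dual (spH D 1)) (spN D)"
    using zeta_mem[OF w r] by (auto simp: bW_space_def)
  have 2: "snd (zeta D w) ` (P' 1 \<otimes>\<^sub>S dual (spH D 1)) \<subseteq> Q' \<longleftrightarrow>
      (\<forall>p\<in>P' 1. \<forall>\<eta>\<in>dual (spH D 1). snd (zeta D w) (p \<otimes> \<eta>) \<in> Q')"
    if "(P', Q') \<in> proper_families (rk D) (P_space D) (spN D)"
    by (rule image_tspace_subset_iff[OF lin_on_subset[OF Hom_lin[OF z] tspace_mono]])
      (use r proper_familiesD[OF that] in auto)
  show ?thesis
  proof (cases "(P', Q') \<in> proper_families (rk D) (P_space D) (spN D)")
    case True
    then show ?thesis using 1[OF True] 2[OF True] by (simp add: invariant_families_bW_def zeta_def)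
  next
    case False
    then show ?thesis by (simp add: invariant_families_bW_def zeta_def)
  qed
qed

context
  fixes w s
  assumes w: "w \<in> W_space D" and r: "2 \<le> rk D" and s: "s \<in> shift_maps D"
begin

lemma shiftW_mem: "shiftW D w s \<in> W_space D"
proof -
  have e: "ext_W D w 2 1 \<in> Hom (spM D 2 \<otimes>\<^sub>S spA D 2 1) (spN D \<otimes>\<^sub>S spH D 1)"
    by (rule ext_W_Hom[OF w]) (use r in auto)
  have "(\<lambda>m. w 1 m + ext_W D w 2 1 (s m)) \<in> Hom (spM D 1) (spN D \<otimes>\<^sub>S spH D 1)"
    unfolding Hom_iff
  proof (intro conjI allI impI)
    show "lin_on (spM D 1) (\<lambda>m. w 1 m + ext_W D w 2 1 (s m))"
      by (intro lin_on_plus lin_on_compose[OF Hom_lin[OF s] _ Hom_lin[OF e]] Hom_lin[OF W_mem[OF w]])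
        (use r s in \<open>auto simp: Hom_iff\<close>)
    show "(\<lambda>m. w 1 m + ext_W D w 2 1 (s m)) ` spM D 1 \<subseteq> spN D \<otimes>\<^sub>S spH D 1"
      using r by (auto intro!: cvec.subspace_add tspace_subspace Hom_mem[OF e] Hom_mem[OF s]
          Hom_mem[OF W_mem[OF w]])
    fix m assume "m \<notin> spM D 1"
    then show "w 1 m + ext_W D w 2 1 (s m) = 0"
      using Hom_out[OF s] Hom_out[OF W_mem[OF w, of 1]] r lin_on_zero[OF Hom_lin[OF e] tspace_subspace]
      by auto
  qed
  then show ?thesis
    using w r by (auto simp: W_space_def dsum_def shiftW_def)
qed

lemma Phi_shiftW_1:
  assumes "m \<in> spM D 1" "\<eta> \<in> dual (spH D 1)"
  shows "Phi D (shiftW D w s) 1 (m \<otimes> \<eta>) = Phi D w 1 (m \<otimes> \<eta>) + Phi D w 2 (pair_dual D 2 \<eta> (s m))"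
proof -
  have r1: "1 \<le> rk D" using r by simp
  have sm: "s m \<in> spM D 2 \<otimes>\<^sub>S spA D 2 1" by (rule Hom_mem[OF s assms(1)])
  have "Phi D (shiftW D w s) 1 (m \<otimes> \<eta>) = nctr (spN D) (spH D 1) \<eta> (shiftW D w s 1 m)"
    by (rule flat_tens[OF subN subH subM W_mem[OF shiftW_mem]]) (use assms r in auto)
  also have "\<dots> = nctr (spN D) (spH D 1) \<eta> (w 1 m) + nctr (spN D) (spH D 1) \<eta> (ext_W D w 2 1 (s m))"
    unfolding shiftW_def if_P[OF refl]
    by (rule lin_on_add[OF Hom_lin[OF nctr_Hom[OF subN subH assms(2)]]])
      (use r1 r sm assms in \<open>auto intro!: Hom_mem[OF W_mem[OF w]] Hom_mem[OF ext_W_Hom[OF w]]\<close>)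
  also have "nctr (spN D) (spH D 1) \<eta> (w 1 m) = Phi D w 1 (m \<otimes> \<eta>)"
    by (rule flat_tens[symmetric, OF subN subH subM W_mem[OF w]]) (use assms r in auto)
  also have "nctr (spN D) (spH D 1) \<eta> (ext_W D w 2 1 (s m)) = Phi D w 2 (pair_dual D 2 \<eta> (s m))"
    by (rule nctr_ext_W[OF w _ _ assms(2) sm]) (use r in auto)
  finally show ?thesis .
qed

lemma Phi_shiftW_other: "i \<noteq> 1 \<Longrightarrow> Phi D (shiftW D w s) i = Phi D w i"
  by (simp add: shiftW_def)

text \<open>The shift of \<open>w\<close> corresponds to the automorphism \<open>p \<mapsto> p + s p\<^sub>1\<close> of \<open>P\<^sub>1\<close>.\<close>

lemma zeta_shiftW:
  assumes p: "p \<in> P_space D 1" "p 1 = m \<otimes> unitA D 1" and m: "m \<in> spM D 1"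
    and \<eta>: "\<eta> \<in> dual (spH D 1)"
  shows "p + single 2 (s m) \<in> P_space D 1"
    and "snd (zeta D w) ((p + single 2 (s m)) \<otimes> \<eta>) =
      (\<Sum>j=1..rk D. Phi D (shiftW D w s) j (pair_dual D j \<eta> (p j)))"
proof -
  have sm: "s m \<in> spM D 2 \<otimes>\<^sub>S spA D 2 1" by (rule Hom_mem[OF s m])
  have p2: "p 2 \<in> spM D 2 \<otimes>\<^sub>S spA D 2 1" by (rule P_mem[OF p(1)]) (use r in auto)
  show mem: "p + single 2 (s m) \<in> P_space D 1"
    using p(1) sm r unfolding P_space_def
    by (intro cvec.subspace_add single_mem_dsum dsum_subspace) auto
  have r1: "1 \<le> rk D" using r by simp
  let ?f = "\<lambda>j. Phi D w j (pair_dual D j \<eta> ((p + single 2 (s m)) j))"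
  let ?g = "\<lambda>j. Phi D (shiftW D w s) j (pair_dual D j \<eta> (p j))"
  have split: "(\<Sum>j=1..rk D. h j) = h 1 + (h 2 + (\<Sum>j=3..rk D. h j))" for h :: "nat \<Rightarrow> 'n"
    using r by (simp add: sum.atLeast_Suc_atMost numeral_2_eq_2[symmetric] numeral_3_eq_3[symmetric])
  \<comment> \<open>The contribution of \<open>s m\<close> appears in term 2 on the left and in term
    1 on the right; the remaining terms agree.\<close>
  have "?f 1 = Phi D w 1 (m \<otimes> \<eta>)"
    using p(2) pair_dual_unit[OF r1 \<eta> m] by (simp add: single_other)
  moreover have "?g 1 = Phi D w 1 (m \<otimes> \<eta>) + Phi D w 2 (pair_dual D 2 \<eta> (s m))"
    using p(2) pair_dual_unit[OF r1 \<eta> m] Phi_shiftW_1[OF m \<eta>] by simp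
  moreover have "?f 2 = ?g 2 + Phi D w 2 (pair_dual D 2 \<eta> (s m))"
  proof -
    have "pair_dual D 2 \<eta> (p 2 + s m) = pair_dual D 2 \<eta> (p 2) + pair_dual D 2 \<eta> (s m)"
      by (rule lin_on_add[OF pair_dual_lin[OF _ _ \<eta>] p2 sm]) (use r in auto)
    moreover have "Phi D w 2 (pair_dual D 2 \<eta> (p 2) + pair_dual D 2 \<eta> (s m)) =
        Phi D w 2 (pair_dual D 2 \<eta> (p 2)) + Phi D w 2 (pair_dual D 2 \<eta> (s m))"
      by (rule lin_on_add[OF Hom_lin[OF Phi_Hom[OF w]]])
        (use r in \<open>auto intro!: pair_dual_mem[OF _ _ \<eta> order_refl] p2 sm\<close>)
    ultimately show ?thesis by (simp add: Phi_shiftW_other)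
  qed
  moreover have "(\<Sum>j=3..rk D. ?f j) = (\<Sum>j=3..rk D. ?g j)"
    by (intro sum.cong refl) (simp add: Phi_shiftW_other single_other)
  ultimately show "snd (zeta D w) ((p + single 2 (s m)) \<otimes> \<eta>) = (\<Sum>j=1..rk D. ?g j)"
    unfolding zeta_snd_tens[OF w mem \<eta> r1] split[of ?f] split[of ?g] by (simp add: algebra_simps)
qed

text \<open>The family generated by M' becomes invariant under \<zeta>(w) after its first member is
  moved by p -> p + s p_1. The other members may stay: this map changes only vectors with a
  component in M_1, and the image of \<xi>_2 has none. Injectivity of the map keeps the
  dimensions.\<close>

lemma family_transfer:
  assumes inv: "(M', N') \<in> invariant_families_W D (shiftW D w s)"
  obtains P' where "(P', N') \<in> invariant_families_bW D (zeta D w)"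
    "\<And>i. i \<in> {1..rk D} \<Longrightarrow> cvec.dim (P' i) = (\<Sum>j=i..rk D. cvec.dim (M' j) * cvec.dim (spA D j i))"
proof -
  have r1: "1 \<le> rk D" using r by simp
  have fam: "(M', N') \<in> proper_families (rk D) (spM D) (spN D)"
    and Phi: "\<And>i m \<eta>. i \<in> {1..rk D} \<Longrightarrow> m \<in> M' i \<Longrightarrow> \<eta> \<in> dual (spH D i) \<Longrightarrow>
      Phi D (shiftW D w s) i (m \<otimes> \<eta>) \<in> N'"
    using inv invariant_W_iff[OF shiftW_mem] by auto
  have M': "cvec.subspace (M' i)" "M' i \<subseteq> spM D i" if "i \<in> {1..rk D}" for i
    using fam that by (auto simp: proper_families_def)
  have N': "cvec.subspace N'" "N' \<subseteq> spN D" using fam by (auto simp: proper_families_def)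
  have fM': "fin_dim (M' i)" if "i \<in> {1..rk D}" for i
    using fin_dim_subset[OF fin_dim_M M'[OF that]] that by auto
  have Phi': "Phi D (shiftW D w s) i t \<in> N'" if "i \<in> {1..rk D}" "t \<in> M' i \<otimes>\<^sub>S dual (spH D i)" for i t
    by (rule tspace_mapI[OF lin_on_subset[OF Hom_lin[OF Phi_Hom[OF shiftW_mem]] tspace_mono] N'(1) that(2)])
      (use that M' Phi in auto)
  have sub: "P_sub D M' i \<subseteq> P_space D i" if "1 \<le> i" for i
    unfolding P_space_def using M' that by (intro dsum_mono tspace_mono) auto
  have dimsub: "fin_dim (P_sub D M' i)"
    "cvec.dim (P_sub D M' i) = (\<Sum>j=i..rk D. cvec.dim (M' j) * cvec.dim (spA D j i))"
    if "i \<in> {1..rk D}" for i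
  proof -
    have "fin_dim (M' j \<otimes>\<^sub>S spA D j i) \<and>
        cvec.dim (M' j \<otimes>\<^sub>S spA D j i) = cvec.dim (M' j) * cvec.dim (spA D j i)"
      if "j \<in> {i..rk D}" for j
      using tspace_fin_dim[OF fM' fin_dim_A] that \<open>i \<in> {1..rk D}\<close> by auto
    then show "fin_dim (P_sub D M' i)"
      "cvec.dim (P_sub D M' i) = (\<Sum>j=i..rk D. cvec.dim (M' j) * cvec.dim (spA D j i))"
      using dsum_fin_dim[of "{i..rk D}" "\<lambda>j. M' j \<otimes>\<^sub>S spA D j i"] by auto
  qed
  \<comment> \<open>Contraction with \<open>f\<close> reads \<open>m\<close> off m \<otimes> 1, so
    that \<open>s\<close> can be applied to the component p_1 in M_1 \<otimes> A_11.\<close>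
  obtain f where f: "f \<in> dual UNIV" "f (unitA D 1) = 1"
    using functional_exists[OF unitA_nz[OF order_refl r1]] by blast
  let ?T = "\<lambda>p. p + single 2 (s (ctr f (p 1)))"
  have p1: "\<exists>m\<in>M' 1. p 1 = m \<otimes> unitA D 1 \<and> ctr f (p 1) = m" if "p \<in> P_sub D M' 1" for p
  proof -
    have "p 1 \<in> M' 1 \<otimes>\<^sub>S spA D 1 1" by (rule dsumD(1)[OF that]) (use r in auto)
    then obtain m where "m \<in> M' 1" "p 1 = m \<otimes> unitA D 1"
      using tens_unit_ex[OF order_refl r1, of "M' 1"] M'(1)[of 1] r1 by auto
    then show ?thesis using f by (simp add: ctr_tens scaleC_one)
  qed
  have Tlin: "lin_on (P_sub D M' 1) ?T"
  proof (intro lin_on_plus)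
    show "lin_on (P_sub D M' 1) (\<lambda>p. p)" by (simp add: lin_on_def)
    have "lin_on (P_sub D M' 1) (\<lambda>p. ctr f (p 1))"
      by (rule lin_on_compose[OF proj_lin_on _ ctr_lin[OF f(1), of "M' 1" "spA D 1 1"]])
        (use r1 in \<open>auto simp: dsum_def\<close>)
    then have "lin_on (P_sub D M' 1) (\<lambda>p. s (ctr f (p 1)))"
    proof (rule lin_on_compose[OF _ _ Hom_lin[OF s]])
      show "(\<lambda>p. ctr f (p 1)) ` P_sub D M' 1 \<subseteq> spM D 1"
      proof (rule image_subsetI)
        fix p assume "p \<in> P_sub D M' 1"
        then obtain m where "m \<in> M' 1" "ctr f (p 1) = m" using p1 by blast
        then show "ctr f (p 1) \<in> spM D 1" using M'(2)[of 1] r1 by (simp add: subset_iff)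
      qed
    qed
    then show "lin_on (P_sub D M' 1) (\<lambda>p. single 2 (s (ctr f (p 1))))"
      by (rule lin_on_compose[OF _ subset_UNIV single_lin_on])
  qed
  have T0: "?T p = p" if "p 1 = 0" for p
  proof -
    have "s 0 = 0" by (rule lin_on_zero[OF Hom_lin[OF s] subM]) (use r1 in auto)
    moreover have "ctr f (0 :: ('m, 'a) tensor) = 0" using lin_on_zero[OF ctr_lin[OF f(1), of UNIV UNIV] tspace_subspace] .
    ultimately have "s (ctr f (p 1)) = 0" using that by simp
    moreover have "single 2 0 = (0 :: nat \<Rightarrow> ('m, 'a) tensor)" by (rule ext) (simp add: single_def)
    ultimately show ?thesis by simp
  qed
  define P' where "P' i = (if i = 1 then ?T ` P_sub D M' 1 else P_sub D M' i)" for i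
  have dimP': "cvec.dim (P' i) = (\<Sum>j=i..rk D. cvec.dim (M' j) * cvec.dim (spA D j i))"
    if i: "i \<in> {1..rk D}" for i
  proof (cases "i = 1")
    case True
    have "cvec.dim (?T ` P_sub D M' 1) = cvec.dim (P_sub D M' 1)"
    proof (rule dim_image_inj[OF Tlin dimsub(1)])
      fix p assume "p \<in> P_sub D M' 1" and T: "?T p = 0"
      have "p 1 = 0" using fun_cong[OF T, of 1] by (simp add: single_other)
      then show "p = 0" using T0 T by simp
    qed (use r1 in auto)
    then show ?thesis using dimsub(2)[OF i] True by (simp add: P'_def)
  next
    case False
    then show ?thesis using dimsub(2)[OF i] by (simp add: P'_def)
  qed
  have subP': "cvec.subspace (P' i)" "P' i \<subseteq> P_space D i" if i: "i \<in> {1..rk D}" for i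
  proof -
    show "cvec.subspace (P' i)"
      using lin_on_subspace_image[OF Tlin] fin_dim_subspace[OF dimsub(1)] i r1 by (simp add: P'_def)
    have "?T p \<in> P_space D 1" if p: "p \<in> P_sub D M' 1" for p
      unfolding P_space_def
    proof (intro cvec.subspace_add dsum_subspace single_mem_dsum)
      obtain m where m: "m \<in> M' 1" "ctr f (p 1) = m" using p1[OF p] by auto
      then have "m \<in> spM D 1" using M'(2)[of 1] r1 by auto
      then show "s (ctr f (p 1)) \<in> spM D 2 \<otimes>\<^sub>S spA D 2 1" unfolding m(2) by (rule Hom_mem[OF s])
    qed (use sub[of 1] p r in \<open>auto simp: P_space_def\<close>)
    then show "P' i \<subseteq> P_space D i" using sub i by (auto simp: P'_def)
  qed
  have fam': "(P', N') \<in> proper_families (rk D) (P_space D) (spN D)"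
  proof -
    \<comment> \<open>The term j = i carries the factor a_ii = 1, so a vanishing sum forces dim M'_i
      = 0.\<close>
    have zero: "cvec.dim (M' i) = 0" if i: "i \<in> {1..rk D}" and "P' i = {0}" for i
    proof -
      have "(\<Sum>j=i..rk D. cvec.dim (M' j) * cvec.dim (spA D j i)) = 0"
        using dimP'[OF i] that(2) by (simp add: dim_zero)
      moreover have "i \<in> {i..rk D}" using i by simp
      ultimately have "cvec.dim (M' i) * cvec.dim (spA D i i) = 0"
        by (simp add: sum_eq_0_iff)
      then show ?thesis using i dim_A_diag[of i] by simp
    qed
    \<comment> \<open>The two dimensions are sums with termwise inequality; equal totals force
      equality of each term, in particular of j = i with a_ii = 1.\<close>
    have full: "M' i = spM D i" if i: "i \<in> {1..rk D}" and eq: "P' i = P_space D i" for i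
    proof -
      have "(\<Sum>j=i..rk D. cvec.dim (M' j) * cvec.dim (spA D j i)) =
          (\<Sum>j=i..rk D. cvec.dim (spM D j) * cvec.dim (spA D j i))"
        using dimP'[OF i] eq P_dim[of i] i by simp
      then have "cvec.dim (M' i) * cvec.dim (spA D i i) = cvec.dim (spM D i) * cvec.dim (spA D i i)"
      proof (rule sum_mono_inv)
        fix j assume "j \<in> {i..rk D}"
        then have "j \<in> {1..rk D}" using i by simp
        then have "cvec.dim (M' j) \<le> cvec.dim (spM D j)"
          using dim_mono[OF fin_dim_M M'(2)] by simp
        then show "cvec.dim (M' j) * cvec.dim (spA D j i) \<le> cvec.dim (spM D j) * cvec.dim (spA D j i)"
          by (rule mult_right_mono) simp
      qed (use i in auto)
      then have "cvec.dim (spM D i) \<le> cvec.dim (M' i)" using i dim_A_diag[of i] by simp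
      then show ?thesis using dim_eq_imp_eq[OF fin_dim_M M'[OF i]] i by auto
    qed
    have "M' i = {0}" if "i \<in> {1..rk D}" "P' i = {0}" for i
      using zero[OF that] dim_eq_0_imp[OF fM'] that by blast
    moreover have "\<not> ((\<forall>i\<in>{1..rk D}. M' i = {0}) \<and> N' = {0})"
      "\<not> ((\<forall>i\<in>{1..rk D}. M' i = spM D i) \<and> N' = spN D)"
      using fam by (simp_all add: proper_families_def)
    ultimately have "\<not> ((\<forall>i\<in>{1..rk D}. P' i = {0}) \<and> N' = {0})"
      "\<not> ((\<forall>i\<in>{1..rk D}. P' i = P_space D i) \<and> N' = spN D)"
      using full by metis+
    then show ?thesis using subP' N' by (simp add: proper_families_def)
  qed
  have "xi D i (p \<otimes> a) \<in> P' (i - 1)"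
    if i: "i \<in> {2..rk D}" and p: "p \<in> P' i" and a: "a \<in> spA D i (i - 1)" for i p a
  proof -
    let ?q = "xi D i (p \<otimes> a)"
    have pi: "p \<in> P_sub D M' i" using p i by (simp add: P'_def)
    then have pP: "p \<in> P_space D i" using sub[of i] i by auto
    have i2: "2 \<le> i" "i \<le> rk D" using i by auto
    have q: "?q j = (if j \<in> {i..rk D}
      then tmap_right (spM D j) (spA D j i) (\<lambda>b. compA D j i (i - 1) (b \<otimes> a)) (p j) else 0)" for j
      by (simp add: xi_tens[OF i2 pP a])
    have "?q \<in> P_sub D M' (i - 1)"
    proof (rule dsumI)
      fix j assume j: "j \<in> {i - 1..rk D}"
      show "?q j \<in> M' j \<otimes>\<^sub>S spA D j (i - 1)"
      proof (cases "j \<in> {i..rk D}")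
        case True
        then show ?thesis
          using xi_step_mem[OF i2 True a M'(2) dsumD(1)[OF pi True]] i by (simp add: q)
      next
        case False
        then show ?thesis by (simp add: q cvec.subspace_0 del: atLeastAtMost_iff)
      qed
    qed (use i in \<open>auto simp: q\<close>)
    \<comment> \<open>\<xi>_2 takes values in the summands j \<ge> 2, so component 1 of
      \<open>?q\<close> is 0 and \<open>?T\<close> fixes it.\<close>
    moreover have "?T ?q = ?q" if "i = 2" by (rule T0) (use q[of 1] that in simp)
    ultimately have q': "?q \<in> P_sub D M' (i - 1)" "i = 2 \<Longrightarrow> ?T ?q = ?q" by simp_all
    show ?thesis
    proof (cases "i = 2")
      case True
      then have e: "i - 1 = 1" by arith
      have "?q \<in> ?T ` P_sub D M' 1"
        using imageI[OF q'(1)[unfolded e], of ?T] unfolding q'(2)[OF True] .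
      then show ?thesis unfolding e by (simp add: P'_def)
    next
      case False
      then have "i - 1 \<noteq> 1" using i by auto
      then show ?thesis using q'(1) by (simp add: P'_def)
    qed
  qed
  moreover have "snd (zeta D w) (p' \<otimes> \<eta>) \<in> N'" if p': "p' \<in> P' 1" and \<eta>: "\<eta> \<in> dual (spH D 1)" for p' \<eta>
  proof -
    obtain p where p: "p \<in> P_sub D M' 1" "p' = ?T p" using p' by (auto simp: P'_def)
    obtain m where m: "m \<in> M' 1" "p 1 = m \<otimes> unitA D 1" "ctr f (p 1) = m" using p1[OF p(1)] by auto
    have mM: "m \<in> spM D 1" using m(1) M'(2)[of 1] r1 by auto
    have pP: "p \<in> P_space D 1" using sub p(1) by auto
    have "Phi D (shiftW D w s) j (pair_dual D j \<eta> (p j)) \<in> N'" if j: "j \<in> {1..rk D}" for j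
      by (rule Phi'[OF j pair_dual_mem[OF _ _ \<eta> M'(2)[OF j] dsumD(1)[OF p(1) j]]]) (use j in auto)
    then have "(\<Sum>j=1..rk D. Phi D (shiftW D w s) j (pair_dual D j \<eta> (p j))) \<in> N'"
      by (rule cvec.subspace_sum[OF N'(1)])
    then show ?thesis using zeta_shiftW(2)[OF pP m(2) mM \<eta>] p(2) m(3) by simp
  qed
  ultimately have "(P', N') \<in> invariant_families_bW D (zeta D w)"
    unfolding invariant_bW_iff[OF w r1] using fam' by simp
  with dimP' that show thesis by blast
qed

end

section \<open>Equality of values, and shifts of w for semi-stable zeta(w)\<close>

lemma value_eq:
  assumes "associated_polarization D lam al"
    and "\<And>i. i \<in> {1..rk D} \<Longrightarrow> dm i = (\<Sum>j=i..rk D. d j * cvec.dim (spA D j i))"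
  shows "(\<Sum>i=1..rk D. al i * real (dm i)) = (\<Sum>j=1..rk D. lam j * real (d j))"
proof -
  have "(\<Sum>i=1..rk D. al i * real (dm i)) =
      (\<Sum>i=1..rk D. \<Sum>j=i..rk D. al i * (real (d j) * dimr (spA D j i)))"
    using assms(2) by (intro sum.cong refl) (simp add: sum_distrib_left)
  also have "\<dots> = (\<Sum>j=1..rk D. \<Sum>i=1..j. al i * (real (d j) * dimr (spA D j i)))"
    by (rule sum_triangle_swap)
  also have "\<dots> = (\<Sum>j=1..rk D. lam j * real (d j))"
    using assms(1) unfolding associated_polarization_def
    by (intro sum.cong refl) (simp add: sum_distrib_left mult_ac)
  finally show ?thesis .
qed

lemma Gred_semistable_shiftW:
  assumes "associated_polarization D lam al" "2 \<le> rk D" "w \<in> W_space D"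
    and "s \<in> shift_maps D" "zeta D w \<in> bW_semistable D al mu"
  shows "Gred_semistable D lam mu (shiftW D w s)"
  unfolding Gred_semistable_def
proof clarify
  fix M' N' assume "(M', N') \<in> invariant_families_W D (shiftW D w s)"
  then obtain P' where "(P', N') \<in> invariant_families_bW D (zeta D w)"
    and d: "\<And>i. i \<in> {1..rk D} \<Longrightarrow> cvec.dim (P' i) = (\<Sum>j=i..rk D. cvec.dim (M' j) * cvec.dim (spA D j i))"
    using family_transfer[OF assms(3,2,4)] by blast
  then have "family_value D al mu P' N' \<le> 0"
    using assms(5) by (auto simp: bW_semistable_def)
  then show "family_value D lam mu M' N' \<le> 0"
    using value_eq[OF assms(1) d] by simp
qed

lemma Gred_stable_shiftW:
  assumes "associated_polarization D lam al" "2 \<le> rk D" "w \<in> W_space D"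
    and "s \<in> shift_maps D" "zeta D w \<in> bW_stable D al mu"
  shows "Gred_stable D lam mu (shiftW D w s)"
  unfolding Gred_stable_def
proof clarify
  fix M' N' assume "(M', N') \<in> invariant_families_W D (shiftW D w s)"
  then obtain P' where "(P', N') \<in> invariant_families_bW D (zeta D w)"
    and d: "\<And>i. i \<in> {1..rk D} \<Longrightarrow> cvec.dim (P' i) = (\<Sum>j=i..rk D. cvec.dim (M' j) * cvec.dim (spA D j i))"
    using family_transfer[OF assms(3,2,4)] by blast
  then have "family_value D al mu P' N' < 0"
    using assms(5) by (auto simp: bW_stable_def)
  then show "family_value D lam mu M' N' < 0"
    using value_eq[OF assms(1) d] by simp
qed

end

section \<open>The unipotent group\<close>

definition unip ::
    "('a::complex_vector, 'h, 'm::complex_vector, 'n) comp_data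
      \<Rightarrow> ('m \<Rightarrow> ('m, 'a) tensor) \<Rightarrow> ('m, 'a) lmat"
  where "unip D s = (\<lambda>j i. if j = 2 \<and> i = 1 then s else lmat_one D j i)"

lemma unip_diag [simp]: "unip D s i i = lmat_one D i i"
  by (auto simp: unip_def)

lemma Hom_subspace: "cvec.subspace V \<Longrightarrow> cvec.subspace (Hom U V)"
  unfolding cvec.subspace_def Hom_def
  by (auto simp: scaleC_fun_def scaleC_add_right scaleC_scaleC mult.commute algebra_simps)

lemma ext_comp_zero:
  assumes sub: "cvec.subspace U" "cvec.subspace A" "cvec.subspace X" "cvec.subspace B"
    and c: "c \<in> Hom (B \<otimes>\<^sub>S A) C" and t: "t \<in> U \<otimes>\<^sub>S A"
  shows "ext_comp U A X B c 0 t = 0"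
proof -
  have 0: "0 \<in> Hom U (X \<otimes>\<^sub>S B)" by (rule cvec.subspace_0[OF Hom_subspace[OF tspace_subspace]])
  show ?thesis
  proof (rule tspace_eqI[OF Hom_lin[OF ext_comp_Hom[OF sub c 0]] lin_on_zero_fun t])
    fix u a assume "u \<in> U" "a \<in> A"
    then show "ext_comp U A X B c 0 (u \<otimes> a) = 0"
      using lin_on_zero[OF tmap_right_lin[OF sub(3,4) Hom_lin_comp_left[OF c]] tspace_subspace]
      by (simp add: ext_comp_tens[OF sub c 0])
  qed
qed

lemma id_mem_GL:
  assumes "cvec.subspace U"
  shows "restr U (\<lambda>u. u) \<in> GL U"
proof -
  have "lin_on U (\<lambda>u. u)" by (simp add: lin_on_def)
  then have "restr U (\<lambda>u. u) \<in> Hom U U"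
    using lin_on_restr[OF _ assms] by (auto simp: Hom_iff restr_def)
  moreover have "bij_betw (restr U (\<lambda>u. u)) U U"
    by (rule bij_betw_cong[THEN iffD1, OF _ bij_betw_id]) (simp add: restr_def)
  ultimately show ?thesis by (simp add: GL_def)
qed

context comp_setting
begin

lemma lmat_one_diag: "1 \<le> i \<Longrightarrow> i \<le> rk D \<Longrightarrow> m \<in> spM D i \<Longrightarrow> lmat_one D i i m = m \<otimes> unitA D i"
  by (simp add: lmat_one_def restr_def)

lemma lmat_one_diag_Hom:
  "1 \<le> i \<Longrightarrow> i \<le> rk D \<Longrightarrow> lmat_one D i i \<in> Hom (spM D i) (spM D i \<otimes>\<^sub>S spA D i i)"
  by (auto simp: Hom_iff lmat_one_def intro!: lin_on_restr tens_lin_left subM)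
    (auto simp: restr_def intro!: tens_mem unitA_mem)

lemma ext_comp_one:
  assumes ik: "1 \<le> i" "i \<le> k" "k \<le> rk D" and t: "t \<in> spM D k \<otimes>\<^sub>S spA D k i"
  shows "ext_comp (spM D k) (spA D k i) (spM D k) (spA D k k) (compA D k k i) (lmat_one D k k) t = t"
proof -
  have k: "1 \<le> k" using ik by simp
  note sub = subM[OF k ik(3)] subA[OF ik] subM[OF k ik(3)] subA[OF k order_refl ik(3)]
  note c = compA_hom[OF ik(1,2) order_refl ik(3)]
  note one = lmat_one_diag_Hom[OF k ik(3)]
  show ?thesis
  proof (rule tspace_eqI[OF Hom_lin[OF ext_comp_Hom[OF sub c one]] _ t, of "\<lambda>t. t"])
    fix u a assume ua: "u \<in> spM D k" "a \<in> spA D k i"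
    show "ext_comp (spM D k) (spA D k i) (spM D k) (spA D k k) (compA D k k i) (lmat_one D k k)
        (u \<otimes> a) = u \<otimes> a"
      using ik k ua
      by (simp add: ext_comp_tens[OF sub c one] lmat_one_diag
          tmap_right_tens[OF sub(3,4) Hom_lin_comp_left[OF c]] unitA_mem unit_left)
  qed (simp add: lin_on_def)
qed

lemma ext_comp_unit_right:
  assumes ik: "1 \<le> i" "i \<le> k" "k \<le> rk D" and s: "s \<in> Hom (spM D i) (spM D k \<otimes>\<^sub>S spA D k i)"
    and m: "m \<in> spM D i"
  shows "ext_comp (spM D i) (spA D i i) (spM D k) (spA D k i) (compA D k i i) s (m \<otimes> unitA D i) = s m"
proof -
  have i: "i \<le> rk D" and k: "1 \<le> k" using ik by auto
  note sub = subM[OF ik(1) i] subA[OF ik(1) order_refl i] subM[OF k ik(3)] subA[OF ik]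
  note c = compA_hom[OF ik(1) order_refl ik(2,3)]
  note u = unitA_mem[OF ik(1) i]
  have "tmap_right (spM D k) (spA D k i) (\<lambda>b. compA D k i i (b \<otimes> unitA D i)) t = t"
    if "t \<in> spM D k \<otimes>\<^sub>S spA D k i" for t
  proof (rule tspace_eqI[OF tmap_right_lin[OF sub(3,4) Hom_lin_comp_left[OF c u]] _ that, of "\<lambda>t. t"])
    fix x a assume "x \<in> spM D k" "a \<in> spA D k i"
    then show "tmap_right (spM D k) (spA D k i) (\<lambda>b. compA D k i i (b \<otimes> unitA D i)) (x \<otimes> a) = x \<otimes> a"
      using ik by (simp add: tmap_right_tens[OF sub(3,4) Hom_lin_comp_left[OF c u]] unit_right)
  qed (simp add: lin_on_def)
  then show ?thesis
    using ext_comp_tens[OF sub c s m u] Hom_mem[OF s m] by simp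
qed

section \<open>Products and inverses of matrices with one entry off the diagonal\<close>

context
  assumes r: "2 \<le> rk D"
begin

lemma unip_in_range:
  assumes s: "s \<in> shift_maps D" and ij: "1 \<le> i" "i \<le> j" "j \<le> rk D"
  shows "unip D s j i \<in> Hom (spM D i) (spM D j \<otimes>\<^sub>S spA D j i)"
proof (cases "j = i")
  case True
  then show ?thesis using lmat_one_diag_Hom[of i] ij by simp
next
  case False
  have "0 \<in> Hom (spM D i) (spM D j \<otimes>\<^sub>S spA D j i)"
    by (rule cvec.subspace_0[OF Hom_subspace[OF tspace_subspace]])
  then show ?thesis using s False by (auto simp: unip_def lmat_one_def)
qed

lemma unip_mem_G_L:
  assumes s: "s \<in> shift_maps D"
  shows "unip D s \<in> G_L D"
proof -
  have "\<exists>f\<in>GL (spM D i). unip D s i i = restr (spM D i) (\<lambda>m. f m \<otimes> unitA D i)" if "i \<in> {1..rk D}" for i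
  proof (rule bexI[of _ "restr (spM D i) (\<lambda>m. m)"])
    show "unip D s i i = restr (spM D i) (\<lambda>m. restr (spM D i) (\<lambda>m. m) m \<otimes> unitA D i)"
      using that by (auto simp: unip_def lmat_one_def restr_def fun_eq_iff)
    show "restr (spM D i) (\<lambda>m. m) \<in> GL (spM D i)" using that by (intro id_mem_GL subM) auto
  qed
  moreover have "unip D s j i = 0" if "\<not> (1 \<le> i \<and> i \<le> j \<and> j \<le> rk D)" for j i
  proof -
    have "\<not> (j = 2 \<and> i = 1)" using that r by auto
    moreover have "\<not> (j = i \<and> i \<in> {1..rk D})" using that by auto
    ultimately show ?thesis by (simp only: unip_def lmat_one_def if_False)
  qed
  ultimately show ?thesis using unip_in_range[OF s] unfolding G_L_def by blast
qed

text \<open>Left multiplication adds \<open>s\<close> times row 1 to row 2, and row 1 of a lower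
  triangular matrix has only the entry (1, 1). Hence only the entry (2, 1) changes.\<close>

lemma lmat_mult_unip:
  assumes s: "s \<in> shift_maps D" and g: "g \<in> G_L D"
    and ik: "1 \<le> i" "i \<le> k" "k \<le> rk D"
  shows "lmat_mult D (unip D s) g k i m = g k i m + (if k = 2 \<and> i = 1
    then ext_comp (spM D 1) (spA D 1 1) (spM D 2) (spA D 2 1) (compA D 2 1 1) s (g 1 1 m) else 0)"
proof -
  let ?e = "\<lambda>j. ext_comp (spM D j) (spA D j i) (spM D k) (spA D k j) (compA D k j i)
    (unip D s k j) (g j i m)"
  have gm: "g j i m \<in> spM D j \<otimes>\<^sub>S spA D j i" if "i \<le> j" "j \<le> rk D" for j
  proof -
    have gH: "g j i \<in> Hom (spM D i) (spM D j \<otimes>\<^sub>S spA D j i)" using g that ik by (auto simp: G_L_def)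
    show ?thesis
      using Hom_mem[OF gH, of m] Hom_out[OF gH, of m] cvec.subspace_0[OF tspace_subspace] by metis
  qed
  have top: "?e k = g k i m"
    using ext_comp_one[OF ik gm[OF ik(2,3)]] by simp
  have low: "?e j = 0" if "j \<in> {i..<k}" "\<not> (k = 2 \<and> j = 1)" for j
  proof -
    have "unip D s k j = 0" using that by (auto simp: unip_def lmat_one_def)
    then show ?thesis
      using that ik gm[of j]
      by (simp, intro ext_comp_zero) (auto intro!: subM subA compA_hom gm)
  qed
  have "lmat_mult D (unip D s) g k i m = (\<Sum>j\<in>{i..k}. ?e j)"
    using ik by (simp add: lmat_mult_def)
  also have "{i..k} = insert k {i..<k}" using ik by auto
  also have "(\<Sum>j\<in>insert k {i..<k}. ?e j) = g k i m + (\<Sum>j\<in>{i..<k}. ?e j)"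
    using top by simp
  also have "(\<Sum>j\<in>{i..<k}. ?e j) = (if k = 2 \<and> i = 1
    then ext_comp (spM D 1) (spA D 1 1) (spM D 2) (spA D 2 1) (compA D 2 1 1) s (g 1 1 m) else 0)"
  proof (cases "k = 2 \<and> i = 1")
    case True
    then have "{i..<k} = {1}" by auto
    then show ?thesis using True by (simp add: unip_def)
  next
    case False
    then have "\<not> (k = 2 \<and> j = 1)" if "j \<in> {i..<k}" for j using that ik by auto
    then have "(\<Sum>j\<in>{i..<k}. ?e j) = 0" by (intro sum.neutral ballI low) auto
    then show ?thesis by (simp only: if_not_P[OF False])
  qed
  finally show ?thesis .
qed

lemma lmat_mult_out: "\<not> (1 \<le> i \<and> i \<le> k \<and> k \<le> rk D) \<Longrightarrow> lmat_mult D g g' k i = 0"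
  by (auto simp: lmat_mult_def)

lemma G_L_out: "g \<in> G_L D \<Longrightarrow> \<not> (1 \<le> i \<and> i \<le> k \<and> k \<le> rk D) \<Longrightarrow> g k i = 0"
  by (simp add: G_L_def)

lemma unip_mult:
  assumes s: "s \<in> shift_maps D" and t: "t \<in> shift_maps D"
  shows "lmat_mult D (unip D s) (unip D t) = unip D (s + t)"
proof (rule ext, rule ext, rule ext)
  fix k i m
  have st: "s + t \<in> shift_maps D"
    by (rule cvec.subspace_add[OF Hom_subspace[OF tspace_subspace] s t])
  show "lmat_mult D (unip D s) (unip D t) k i m = unip D (s + t) k i m"
  proof (cases "1 \<le> i \<and> i \<le> k \<and> k \<le> rk D")
    case True
    have sm: "ext_comp (spM D 1) (spA D 1 1) (spM D 2) (spA D 2 1) (compA D 2 1 1) s (unip D t 1 1 m) = s m"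
    proof (cases "m \<in> spM D 1")
      case True
      then show ?thesis
        using ext_comp_unit_right[OF _ _ _ s] r lmat_one_diag[of 1] by (simp add: unip_def)
    next
      case False
      have "lin_on (spM D 1 \<otimes>\<^sub>S spA D 1 1)
          (ext_comp (spM D 1) (spA D 1 1) (spM D 2) (spA D 2 1) (compA D 2 1 1) s)"
        by (rule Hom_lin[OF ext_comp_Hom[OF _ _ _ _ compA_hom s]]) (use r in \<open>auto intro!: subM subA\<close>)
      then show ?thesis
        using False r lin_on_zero[OF _ tspace_subspace] Hom_out[OF s False]
        by (simp add: unip_def lmat_one_def restr_def)
    qed
    then show ?thesis
      using True lmat_mult_unip[OF s unip_mem_G_L[OF t], of i k m]
      by (auto simp: unip_def add.commute)
  next
    case False
    then show ?thesis using lmat_mult_out[of i k] G_L_out[OF unip_mem_G_L[OF st], of i k] by simp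
  qed
qed

lemma unip_zero: "unip D 0 = lmat_one D"
  by (intro ext) (auto simp: unip_def lmat_one_def)

text \<open>The inverse is a definite description, so uniqueness must be shown as well: by the
  product formula a right inverse agrees with the identity away from (2, 1), and that entry is found
  by comparison with \<open>unip D (- s)\<close>, which has the same entry (1, 1).\<close>

lemma lmat_inv_unip:
  assumes s: "s \<in> shift_maps D"
  shows "lmat_inv D (unip D s) = unip D (- s)"
  unfolding lmat_inv_def
proof (rule the_equality)
  have s': "- s \<in> shift_maps D"
    by (rule cvec.subspace_neg[OF Hom_subspace[OF tspace_subspace] s])
  show "unip D (- s) \<in> G_L D \<and> lmat_mult D (unip D s) (unip D (- s)) = lmat_one D \<and>
      lmat_mult D (unip D (- s)) (unip D s) = lmat_one D"
    using unip_mult[OF s s'] unip_mult[OF s' s] unip_mem_G_L[OF s'] by (simp add: unip_zero)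
  fix g assume "g \<in> G_L D \<and> lmat_mult D (unip D s) g = lmat_one D \<and> lmat_mult D g (unip D s) = lmat_one D"
  then have g: "g \<in> G_L D" and mult: "lmat_mult D (unip D s) g = lmat_one D" by auto
  have other: "g k i = lmat_one D k i" if "1 \<le> i \<and> i \<le> k \<and> k \<le> rk D" "\<not> (k = 2 \<and> i = 1)" for k i
  proof
    fix m
    show "g k i m = lmat_one D k i m"
      using lmat_mult_unip[OF s g, of i k m] that mult by simp
  qed
  have "g k i = unip D (- s) k i" for k i
  proof (cases "1 \<le> i \<and> i \<le> k \<and> k \<le> rk D")
    case True
    show ?thesis
    proof (cases "k = 2 \<and> i = 1")
      case ki: True
      have "g 2 1 m = - s m" for m
      proof -
        have g11: "g 1 1 = unip D (- s) 1 1" using other[of 1 1] r by (simp add: unip_def)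
        have "lmat_mult D (unip D s) g 2 1 m = lmat_mult D (unip D s) (unip D (- s)) 2 1 m"
          using mult unip_mult[OF s s'] by (simp add: unip_zero)
        then have "g 2 1 m = unip D (- s) 2 1 m"
          using r lmat_mult_unip[OF s g, of 1 2 m] lmat_mult_unip[OF s unip_mem_G_L[OF s'], of 1 2 m]
          by (simp add: g11)
        then show ?thesis by (simp add: unip_def)
      qed
      then have "g 2 1 = - s" by (simp add: fun_Compl_def fun_eq_iff)
      then show ?thesis using ki by (simp add: unip_def)
    next
      case False
      then show ?thesis using other[OF True False] by (auto simp: unip_def)
    qed
  next
    case False
    then show ?thesis using G_L_out[OF g False] G_L_out[OF unip_mem_G_L[OF s'] False] by simp
  qed
  then show "g = unip D (- s)" by blast
qed

section \<open>The orbit of w under H\<close>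

lemma ext_W_unit:
  assumes w: "w \<in> W_space D" and i: "1 \<le> i" "i \<le> rk D" and m: "m \<in> spM D i"
  shows "ext_W D w i i (m \<otimes> unitA D i) = w i m"
proof -
  note c = compH_hom[OF i(1) order_refl i(2)]
  note u = unitA_mem[OF i]
  have "tmap_right (spN D) (spH D i) (\<lambda>h. compH D i i (h \<otimes> unitA D i)) t = t"
    if "t \<in> spN D \<otimes>\<^sub>S spH D i" for t
  proof (rule tspace_eqI[OF tmap_right_lin[OF subN subH[OF i] Hom_lin_comp_left[OF c u]] _ that, of "\<lambda>t. t"])
    fix n h assume "n \<in> spN D" "h \<in> spH D i"
    then show "tmap_right (spN D) (spH D i) (\<lambda>h. compH D i i (h \<otimes> unitA D i)) (n \<otimes> h) = n \<otimes> h"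
      using i by (simp add: tmap_right_tens[OF subN subH[OF i] Hom_lin_comp_left[OF c u]] unit_H)
  qed (simp add: lin_on_def)
  then show ?thesis using ext_W_tens[OF w i(1) order_refl i(2) m u] Hom_mem[OF W_mem[OF w i] m] by simp
qed

text \<open>The sign comes from the inverse in the action: the matrix with entry \<open>- s\<close>
  has inverse \<open>unip D s\<close>, whose column 1 adds the extension of the second component of
  \<open>w\<close> along \<open>s\<close> to the first.\<close>

lemma act_unip:
  assumes w: "w \<in> W_space D" and s: "s \<in> shift_maps D"
  shows "act D (unip D (- s), restr (spN D) (\<lambda>n. n)) w = shiftW D w s"
proof
  fix i
  have s': "- s \<in> shift_maps D"
    by (rule cvec.subspace_neg[OF Hom_subspace[OF tspace_subspace] s])
  have inv: "lmat_inv D (unip D (- s)) = unip D s" using lmat_inv_unip[OF s'] by simp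
  show "act D (unip D (- s), restr (spN D) (\<lambda>n. n)) w i = shiftW D w s i"
  proof (cases "i \<in> {1..rk D}")
    case i: True
    show ?thesis
    proof
      fix m
      let ?e = "\<lambda>j. ext_W D w j i (unip D s j i m)"
      have ext0: "ext_W D w j i 0 = 0" if "i \<le> j" "j \<le> rk D" for j
        by (rule lin_on_zero[OF Hom_lin[OF ext_W_Hom[OF w]] tspace_subspace]) (use that i in auto)
      have diag: "?e i = w i m"
      proof (cases "m \<in> spM D i")
        case True
        then show ?thesis using ext_W_unit[OF w _ _ True] i by (simp add: lmat_one_diag)
      next
        case False
        then show ?thesis
          using Hom_out[OF W_mem[OF w, of i] False] ext0[of i] i
          by (simp add: lmat_one_def restr_def)
      qed
      have "(\<Sum>j=i..rk D. ?e j) = w i m + (\<Sum>j\<in>{i<..rk D}. ?e j)"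
      proof -
        have "{i..rk D} = insert i {i<..rk D}" using i by auto
        then show ?thesis using diag by simp
      qed
      also have "(\<Sum>j\<in>{i<..rk D}. ?e j) = (\<Sum>j\<in>{i<..rk D}. if j = 2 \<and> i = 1 then ext_W D w 2 1 (s m) else 0)"
        using ext0 by (intro sum.cong refl) (auto simp: unip_def lmat_one_def)
      also have "\<dots> = (if i = 1 then ext_W D w 2 1 (s m) else 0)"
        using r by (cases "i = 1") simp_all
      also have "w i m + (if i = 1 then ext_W D w 2 1 (s m) else 0) = shiftW D w s i m"
        by (cases "i = 1") (simp_all add: shiftW_def)
      finally have sum: "(\<Sum>j=i..rk D. ?e j) = shiftW D w s i m" .
      have "shiftW D w s i m \<in> spN D \<otimes>\<^sub>S spH D i"
      proof -
        have h: "shiftW D w s i \<in> Hom (spM D i) (spN D \<otimes>\<^sub>S spH D i)"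
          by (rule W_mem[OF shiftW_mem[OF w r s]]) (use i in auto)
        show ?thesis
          using Hom_mem[OF h, of m] Hom_out[OF h, of m] cvec.subspace_0[OF tspace_subspace] by metis
      qed
      then have "tmap_left (spN D) (spH D i) (restr (spN D) (\<lambda>n. n)) (\<Sum>j=i..rk D. ?e j) = shiftW D w s i m"
        using sum i by (simp add: tmap_left_id[OF subN subH])
      then show "act D (unip D (- s), restr (spN D) (\<lambda>n. n)) w i m = shiftW D w s i m"
        using i by (simp add: act_def inv)
    qed
  next
    case False
    then show ?thesis using w r by (auto simp: act_def shiftW_def W_space_def dsum_def)
  qed
qed

lemma unip_mem_H:
  assumes "s \<in> shift_maps D"
  shows "(unip D s, restr (spN D) (\<lambda>n. n)) \<in> H_grp D"
  using unip_mem_G_L[OF assms] id_mem_GL[OF subN] by (auto simp: H_grp_def G_grp_def)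

lemma H_orbit_shiftW:
  assumes w: "w \<in> W_space D" and s: "s \<in> shift_maps D"
  obtains u where "u \<in> H_grp D" "act D u w = shiftW D w s"
  using act_unip[OF w s] unip_mem_H[OF cvec.subspace_neg[OF Hom_subspace[OF tspace_subspace] s]] that
  by blast

text \<open>An entry in row j takes its values in M_j \<otimes> A_ji and so vanishes for j \<ge> 3.
  With the diagonal fixed, (2, 1) is the only free entry.\<close>

lemma H_orbit_cases:
  assumes w: "w \<in> W_space D" and M0: "\<And>j. 3 \<le> j \<Longrightarrow> j \<le> rk D \<Longrightarrow> spM D j = {0}"
    and u: "u \<in> H_grp D"
  obtains s where "s \<in> shift_maps D" "act D u w = shiftW D w s"
proof -
  obtain g where gu: "u = (g, restr (spN D) (\<lambda>n. n))" and g: "g \<in> G_L D"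
    and diag: "\<And>i. i \<in> {1..rk D} \<Longrightarrow> g i i = lmat_one D i i"
    using u by (auto simp: H_grp_def G_grp_def)
  have g21: "g 2 1 \<in> shift_maps D" using g r by (auto simp: G_L_def)
  have "g j i = unip D (g 2 1) j i" for j i
  proof (cases "1 \<le> i \<and> i \<le> j \<and> j \<le> rk D")
    case True
    then have gH: "g j i \<in> Hom (spM D i) (spM D j \<otimes>\<^sub>S spA D j i)" using g by (auto simp: G_L_def)
    consider "i = j" | "i = 1" "j = 2" | "i < j" "3 \<le> j" using True by linarith
    then show ?thesis
    proof cases
      case 1
      then show ?thesis using diag[of i] True by simp
    next
      case 2
      then show ?thesis by (simp add: unip_def)
    next
      case 3
      then have "g j i m = 0" for m
        using Hom_mem[OF gH, of m] Hom_out[OF gH, of m] M0[of j] True by auto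
      then have "g j i = 0" by (simp add: zero_fun_def fun_eq_iff)
      then show ?thesis using 3 by (simp add: unip_def lmat_one_def)
    qed
  next
    case False
    then show ?thesis using G_L_out[OF g False] G_L_out[OF unip_mem_G_L[OF g21] False] by simp
  qed
  then have "g = unip D (- (- g 2 1))" unfolding minus_minus by blast
  moreover have "- g 2 1 \<in> shift_maps D"
    by (rule cvec.subspace_neg[OF Hom_subspace[OF tspace_subspace] g21])
  ultimately show thesis using that[of "- g 2 1"] act_unip[OF w, of "- g 2 1"] gu by simp
qed

end

end

section \<open>Vanishing of \<open>M\<^sub>j\<close> for \<open>j > 2\<close>\<close>

text \<open>The mirror image of \<open>ctr\<close>: the functional contracts the left
  factor.\<close>

definition lctr :: "('u \<Rightarrow> complex) \<Rightarrow> ('u::complex_vector, 'v::complex_vector) tensor \<Rightarrow> 'v"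
  where "lctr f = tlift UNIV UNIV (\<lambda>u v. f u *\<^sub>C v)"

context
  fixes f :: "'u::complex_vector \<Rightarrow> complex"
  assumes f: "f \<in> dual UNIV"
begin

lemma lctr_bilin: "bilin_on U V (\<lambda>u v. f u *\<^sub>C v)"
  by (rule bilin_onI)
    (auto simp: lin_on_def dual_UNIV_linear[OF f] scaleC_add_left scaleC_scaleC scaleC_add_right
      mult.commute)

lemma lctr_lin: "lin_on (U \<otimes>\<^sub>S V) (lctr f :: _ \<Rightarrow> 'v::complex_vector)"
proof -
  have "lin_on (UNIV \<otimes>\<^sub>S UNIV) (lctr f :: _ \<Rightarrow> 'v)"
    unfolding lctr_def by (intro tlift_lin lctr_bilin) auto
  then show ?thesis by (rule lin_on_subset) (simp add: tspace_mono)
qed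

lemma lctr_tens: "lctr f (u \<otimes> v) = f u *\<^sub>C v"
  unfolding lctr_def by (subst tlift(2)) (auto intro: lctr_bilin)

lemma lctr_mem: "cvec.subspace V \<Longrightarrow> t \<in> U \<otimes>\<^sub>S V \<Longrightarrow> lctr f t \<in> V"
  by (rule tspace_mapI[OF lctr_lin]) (auto simp: lctr_tens cvec.subspace_scale)

lemma lctr_zero: "lctr f 0 = 0"
  using lin_on_zero[OF lctr_lin[of UNIV UNIV] tspace_subspace] .

end

lemma dim_span_singleton: "x \<noteq> 0 \<Longrightarrow> cvec.dim (cvec.span {x}) = 1"
  using cvec.dim_span_eq_card_independent[of "{x}"] by simp

section \<open>Test families for a semi-stable point\<close>

context comp_setting
begin

text \<open>The zero family and the full family have value 0 by the normalization of the
  polarization. The weak inequality therefore extends to all invariant families, and test families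
  can be used without checking that they are proper.\<close>

lemma Gred_semistable_le:
  assumes ss: "Gred_semistable D lam mu w" and pol: "polarization D lam mu" and w: "w \<in> W_space D"
    and M': "\<And>i. i \<in> {1..rk D} \<Longrightarrow> cvec.subspace (M' i)" "\<And>i. i \<in> {1..rk D} \<Longrightarrow> M' i \<subseteq> spM D i"
    and N': "cvec.subspace N'" "N' \<subseteq> spN D"
    and inv: "\<And>i m \<eta>. i \<in> {1..rk D} \<Longrightarrow> m \<in> M' i \<Longrightarrow> \<eta> \<in> dual (spH D i) \<Longrightarrow> Phi D w i (m \<otimes> \<eta>) \<in> N'"
  shows "family_value D lam mu M' N' \<le> 0"
proof (cases "(M', N') \<in> proper_families (rk D) (spM D) (spN D)")
  case True
  then have "(M', N') \<in> invariant_families_W D w" using inv invariant_W_iff[OF w] by blast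
  then show ?thesis using ss by (auto simp: Gred_semistable_def)
next
  case False
  then consider "\<forall>i\<in>{1..rk D}. M' i = {0}" "N' = {0}" | "\<forall>i\<in>{1..rk D}. M' i = spM D i" "N' = spN D"
    using M' N' by (auto simp: proper_families_def)
  then show ?thesis
  proof cases
    case 1
    then show ?thesis by (simp add: dim_zero)
  next
    case 2
    then have "(\<Sum>i=1..rk D. lam i * dimr (M' i)) = (\<Sum>i=1..rk D. lam i * dimr (spM D i))"
      by (intro sum.cong) auto
    then show ?thesis using pol 2 by (simp add: polarization_def)
  qed
qed

lemma lam_le_dim_dual:
  assumes ss: "Gred_semistable D lam mu w" and pol: "polarization D lam mu" and w: "w \<in> W_space D"
    and mu: "0 \<le> mu" and i: "1 \<le> i" "i \<le> rk D" and nz: "spM D i \<noteq> {0}"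
  shows "lam i \<le> mu * dimr (dual (spH D i))"
proof -
  obtain m where m: "m \<in> spM D i" "m \<noteq> 0" using nz cvec.subspace_0[OF subM[OF i]] by blast
  note H = Phi_Hom[OF w i]
  \<comment> \<open>The test family: the line through one nonzero \<open>m\<close> in M_i, with the
    image of m \<otimes> H_1i^* in N_1, of dimension at most that of H_1i^*.\<close>
  let ?M = "\<lambda>j. if j = i then cvec.span {m} else {0}"
  let ?N = "(\<lambda>\<eta>. Phi D w i (m \<otimes> \<eta>)) ` dual (spH D i)"
  have lin: "lin_on (dual (spH D i)) (\<lambda>\<eta>. Phi D w i (m \<otimes> \<eta>))"
    by (rule Hom_lin_comp_right[OF H m(1)])
  have sp: "cvec.span {m} \<subseteq> spM D i" using m(1) subM[OF i] by (intro cvec.span_minimal) auto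
  have "(\<Sum>j=1..rk D. lam j * dimr (?M j)) - mu * dimr ?N \<le> 0"
  proof (rule Gred_semistable_le[OF ss pol w])
    show "cvec.subspace ?N"
      by (rule lin_on_subspace_image[OF lin dual_subspace[OF subH[OF i]]])
    show "?N \<subseteq> spN D" using Hom_mem[OF H] m(1) by (auto intro: tens_mem)
    fix j m' \<eta> assume j: "j \<in> {1..rk D}" "m' \<in> ?M j" "\<eta> \<in> dual (spH D j)"
    show "Phi D w j (m' \<otimes> \<eta>) \<in> ?N"
    proof (cases "j = i")
      case True
      then obtain k where k: "m' = k *\<^sub>C m" using j(2) by (auto simp: cvec.span_singleton)
      then have "m' \<otimes> \<eta> = m \<otimes> (k *\<^sub>C \<eta>)" by (simp add: tens_scale)
      moreover have "k *\<^sub>C \<eta> \<in> dual (spH D i)"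
        using j(3) True by (intro cvec.subspace_scale dual_subspace subH i) auto
      ultimately show ?thesis using True by auto
    next
      case False
      then have "m' \<otimes> \<eta> = 0" using j(2) by simp
      then have "Phi D w j (m' \<otimes> \<eta>) = 0"
        using lin_on_zero[OF Hom_lin[OF Phi_Hom[OF w]] tspace_subspace, of j] j(1) by simp
      then show ?thesis
        using cvec.subspace_0[OF lin_on_subspace_image[OF lin dual_subspace[OF subH[OF i]]]] by simp
    qed
  qed (use sp subM cvec.subspace_0 in auto)
  moreover have "(\<Sum>j=1..rk D. lam j * dimr (?M j)) = (\<Sum>j=1..rk D. if j = i then lam i else 0)"
    by (intro sum.cong) (auto simp: dim_zero dim_span_singleton[OF m(2), unfolded cvec.dim_span] cvec.dim_span)
  moreover have "\<dots> = lam i" using i by simp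
  moreover have "cvec.dim ?N \<le> cvec.dim (dual (spH D i))"
    by (rule dim_image_le[OF lin fin_dim_dual[OF fin_dim_H[OF i]]])
  then have "mu * dimr ?N \<le> mu * dimr (dual (spH D i))" using mu by (intro mult_left_mono) simp_all
  ultimately show ?thesis by linarith
qed

lemma lam_pos:
  assumes "associated_polarization D lam al" "\<And>i. 1 \<le> i \<Longrightarrow> i \<le> rk D \<Longrightarrow> 0 < al i" "1 \<le> i" "i \<le> rk D"
  shows "0 < lam i"
proof -
  have "lam i = (\<Sum>k=1..i. dimr (spA D i k) * al k)"
    using assms(1,3,4) by (simp add: associated_polarization_def)
  moreover have "dimr (spA D i i) * al i \<le> (\<Sum>k=1..i. dimr (spA D i k) * al k)"
    using assms(3,4) by (intro member_le_sum) (auto intro!: mult_nonneg_nonneg less_imp_le[OF assms(2)])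
  ultimately show ?thesis using assms(2-4) dim_A_diag[of i] by fastforce
qed

text \<open>Surjectivity of H_11^* \<otimes> A_i1 -> H_1i^* turns A_i1 = 0 into H_1i^* = 0, and the
  previous bound then gives \<lambda>_i \<le> 0. Nonzero elements of A_i1 will be needed to detect
  subspaces of M_i by tensors m \<otimes> a.\<close>

lemma semistable_A_nonzero:
  assumes ss: "Gred_semistable D lam mu w" and pol: "polarization D lam mu" and w: "w \<in> W_space D"
    and mu: "0 \<le> mu" and i: "1 \<le> i" "i \<le> rk D" and nz: "spM D i \<noteq> {0}" and lam: "0 < lam i"
  shows "spA D i 1 \<noteq> {0}"
proof
  assume A: "spA D i 1 = {0}"
  have "dual (spH D i) = ind_dual D i 1 ` (dual (spH D 1) \<otimes>\<^sub>S spA D i 1)"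
    using ind_dual_surj[of 1 i] i by simp
  also have "\<dots> = {0}"
    using lin_on_zero[OF Hom_lin[OF ind_dual_Hom[of 1 i]] tspace_subspace] i by (simp add: A)
  finally have "dimr (dual (spH D i)) = 0" by (simp add: dim_zero)
  then show False using lam_le_dim_dual[OF ss pol w mu i nz] lam by simp
qed

section \<open>The map delta_1 and the supremum c_1\<close>

lemma MA_fin_dim: "fin_dim (MA_sum D (spM D))"
  unfolding MA_sum_def
  by (rule conjunct1[OF dsum_fin_dim]) (auto intro!: tspace_fin_dim fin_dim_M fin_dim_A)

lemma MH_fin_dim: "fin_dim (MH_sum D)"
  unfolding MH_sum_def
  by (rule conjunct1[OF dsum_fin_dim]) (auto intro!: tspace_fin_dim fin_dim_M fin_dim_dual fin_dim_H)

lemma delta1_bilin: "bilin_on (MA_sum D (spM D)) (dual (spH D 1))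
    (\<lambda>q \<eta> i. if i \<in> {2..rk D} then pair_dual D i \<eta> (q i) else 0)"
proof (rule bilin_onI; rule lin_on_componentwise)
  fix \<eta> i assume \<eta>: "\<eta> \<in> dual (spH D 1)" and i: "i \<in> {2..rk D}"
  show "lin_on (MA_sum D (spM D)) (\<lambda>q. pair_dual D i \<eta> (q i))"
    by (rule lin_on_compose[OF proj_lin_on _ pair_dual_lin[OF _ _ \<eta>]])
      (use i in \<open>auto simp: MA_sum_def dsum_def\<close>)
next
  fix q i assume q: "q \<in> MA_sum D (spM D)" and i: "i \<in> {2..rk D}"
  show "lin_on (dual (spH D 1)) (\<lambda>\<eta>. pair_dual D i \<eta> (q i))"
    by (rule pair_dual_lin_dual) (use q i in \<open>auto simp: MA_sum_def dsum_def\<close>)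
qed

context
  assumes r: "2 \<le> rk D"
begin

lemma MA_subspace: "cvec.subspace (MA_sum D M')"
  unfolding MA_sum_def by (rule dsum_subspace) simp

lemma subdH1: "cvec.subspace (dual (spH D 1))"
  using r by (intro dual_subspace subH) auto

lemma delta1_lin: "lin_on (MA_sum D (spM D) \<otimes>\<^sub>S dual (spH D 1)) (delta1 D)"
  unfolding delta1_def pair_dual_def[symmetric] by (rule tlift_lin[OF MA_subspace subdH1 delta1_bilin])

lemma delta1_tens: "q \<in> MA_sum D (spM D) \<Longrightarrow> \<eta> \<in> dual (spH D 1) \<Longrightarrow>
    delta1 D (q \<otimes> \<eta>) = (\<lambda>i. if i \<in> {2..rk D} then pair_dual D i \<eta> (q i) else 0)"
  unfolding delta1_def pair_dual_def[symmetric] by (rule tlift(2)[OF MA_subspace subdH1 delta1_bilin])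

lemma delta1_tens_mem:
  assumes q: "q \<in> MA_sum D (spM D)" and \<eta>: "\<eta> \<in> dual (spH D 1)"
  shows "delta1 D (q \<otimes> \<eta>) \<in> MH_sum D"
  unfolding delta1_tens[OF q \<eta>] MH_sum_def
proof (rule dsumI)
  fix i assume i: "i \<in> {2..rk D}"
  then have "pair_dual D i \<eta> (q i) \<in> spM D i \<otimes>\<^sub>S dual (spH D i)"
    using q by (intro pair_dual_mem[OF _ _ \<eta> order_refl]) (auto simp: MA_sum_def dsum_def)
  then show "(if i \<in> {2..rk D} then pair_dual D i \<eta> (q i) else 0) \<in> spM D i \<otimes>\<^sub>S dual (spH D i)"
    using i by simp
qed auto

lemma delta1_image_subset:
  assumes "K \<subseteq> MA_sum D (spM D)" "cvec.subspace Y"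
    and "\<And>q \<eta>. q \<in> K \<Longrightarrow> \<eta> \<in> dual (spH D 1) \<Longrightarrow> delta1 D (q \<otimes> \<eta>) \<in> Y"
  shows "delta1 D ` (K \<otimes>\<^sub>S dual (spH D 1)) \<subseteq> Y"
  using image_tspace_subset_iff[OF lin_on_subset[OF delta1_lin tspace_mono[OF assms(1) order_refl]] assms(2)]
    assms(3) by simp

lemma MH_subspace: "cvec.subspace (MH_sum D)"
  by (rule fin_dim_subspace[OF MH_fin_dim])

lemma delta1_dim_le:
  assumes "K \<subseteq> MA_sum D (spM D)"
  shows "cvec.dim (delta1 D ` (K \<otimes>\<^sub>S dual (spH D 1))) \<le> cvec.dim (MH_sum D)"
  by (rule dim_mono[OF MH_fin_dim], rule delta1_image_subset[OF assms MH_subspace], rule delta1_tens_mem)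
    (use assms in auto)

text \<open>The supremum dominates the quotients only because they are bounded: a proper subspace
  has codimension at least 1, so each quotient is at most the dimension of the target of
  \<delta>_1.\<close>

lemma c1_bound:
  assumes K: "K \<in> K_family D"
  shows "dimr (MH_sum D) - dimr (delta1 D ` (K \<otimes>\<^sub>S dual (spH D 1))) \<le>
    c1 D * (dimr (MA_sum D (spM D)) - dimr K)"
    and "0 \<le> c1 D"
proof -
  let ?q = "\<lambda>K. (dimr (MH_sum D) - dimr (delta1 D ` (K \<otimes>\<^sub>S dual (spH D 1)))) /
      (dimr (MA_sum D (spM D)) - dimr K)"
  have codim: "1 \<le> dimr (MA_sum D (spM D)) - dimr K" if "K \<in> K_family D" for K
  proof -
    have sub: "cvec.subspace K" "K \<subseteq> MA_sum D (spM D)" "K \<noteq> MA_sum D (spM D)"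
      using that by (auto simp: K_family_def)
    have "\<not> cvec.dim (MA_sum D (spM D)) \<le> cvec.dim K"
      using dim_eq_imp_eq[OF MA_fin_dim sub(1,2)] sub(3) by blast
    then show ?thesis by simp
  qed
  have nn: "0 \<le> dimr (MH_sum D) - dimr (delta1 D ` (K \<otimes>\<^sub>S dual (spH D 1)))" if "K \<in> K_family D" for K
    using delta1_dim_le[of K] that by (simp add: K_family_def psubset_eq)
  have "?q K \<le> dimr (MH_sum D)" if "K \<in> K_family D" for K
  proof -
    have "?q K \<le> (dimr (MH_sum D) - dimr (delta1 D ` (K \<otimes>\<^sub>S dual (spH D 1)))) / 1"
      using codim[OF that] nn[OF that] by (intro divide_left_mono) auto
    then show ?thesis by simp
  qed
  then have bdd: "bdd_above (?q ` K_family D)" by (rule bdd_aboveI2)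
  have c1: "c1 D = (SUP K\<in>K_family D. ?q K)" using K by (auto simp: c1_def)
  have le: "?q K \<le> c1 D" unfolding c1 by (rule cSUP_upper[OF K bdd])
  then show "dimr (MH_sum D) - dimr (delta1 D ` (K \<otimes>\<^sub>S dual (spH D 1))) \<le>
    c1 D * (dimr (MA_sum D (spM D)) - dimr K)"
    using codim[OF K] by (simp add: divide_le_eq)
  have "0 \<le> ?q K" using codim[OF K] nn[OF K] by (intro divide_nonneg_nonneg) auto
  then show "0 \<le> c1 D" using le by linarith
qed

text \<open>The lower bound for \<open>c\<^sub>1\<close> comes from the graph of a map
  \<open>M\<^sub>2 \<otimes> A\<^sub>2\<^sub>1 \<rightarrow> A\<^sub>j\<^sub>1\<close>, \<open>m \<otimes> a \<mapsto> f(m) b a\<close>, with \<open>b \<in> A\<^sub>j\<^sub>2\<close>.\<close>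

lemma dim_dual_le_c1:
  assumes A: "\<And>i. 2 \<le> i \<Longrightarrow> i \<le> rk D \<Longrightarrow> spM D i \<noteq> {0} \<Longrightarrow> spA D i 1 \<noteq> {0}"
    and j: "2 < j" "j \<le> rk D" and M2: "spM D 2 \<noteq> {0}" and Mj: "spM D j \<noteq> {0}"
  shows "dimr (dual (spH D j)) \<le> c1 D * dimr (spA D j 1)"
proof -
  have j': "1 \<le> j" "2 \<le> j" using j by auto
  have r1: "1 \<le> rk D" using r by simp
  obtain m0 where m0: "m0 \<in> spM D 2" "m0 \<noteq> 0" using M2 cvec.subspace_0[OF subM[of 2]] r by auto
  obtain f where f: "f \<in> dual UNIV" "f m0 = 1" by (rule functional_exists[OF m0(2)])
  obtain mj where mj: "mj \<in> spM D j" "mj \<noteq> 0" using Mj cvec.subspace_0[OF subM[of j]] j by auto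
  obtain g where g: "g \<in> dual UNIV" "g mj = 1" by (rule functional_exists[OF mj(2)])
  note compA_hom' = compA_hom[of 1 2 j, OF order_refl one_le_numeral j'(2) j(2)]
  \<comment> \<open>A_j1 is nonzero and the composition A_j2 \<otimes> A_21 -> A_j1 is onto, so some
    product is nonzero. It makes the graph link M_2 with M_j.\<close>
  have "\<exists>b\<in>spA D j 2. \<exists>a\<in>spA D 2 1. compA D j 2 1 (b \<otimes> a) \<noteq> 0"
  proof (rule ccontr)
    assume "\<not> ?thesis"
    then have "compA D j 2 1 ` (spA D j 2 \<otimes>\<^sub>S spA D 2 1) \<subseteq> {0}"
      using image_tspace_subset_iff[OF Hom_lin[OF compA_hom'], of "{0}"] by auto
    then have "spA D j 1 \<subseteq> {0}" using compA_surj[of 1 2 j] j by simp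
    then show False using A[OF j'(2) j(2) Mj] cvec.subspace_0[OF subA[of 1 j]] j by auto
  qed
  then obtain b a0 where b: "b \<in> spA D j 2" and a0: "a0 \<in> spA D 2 1"
    and ba: "compA D j 2 1 (b \<otimes> a0) \<noteq> 0" by blast
  let ?MA = "MA_sum D (spM D)"
  \<comment> \<open>The kernel of \<open>F\<close> is, up to sign, the graph, enlarged by the
    tensors that \<open>g\<close> kills and by the summands of index other than 2 and j. The
    component in M_j makes \<open>F\<close> onto A_j1, so the kernel has codimension a_j1.\<close>
  define F where "F q = compA D j 2 1 (b \<otimes> lctr f (q 2)) + lctr g (q j)" for q :: "('m, 'a) pvec"
  \<comment> \<open>The same combination on the side of the dual spaces. Products of ker
    \<open>F\<close> with H_11^* lie in ker \<open>G\<close>, which has codimension at least dim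
    H_1j^* because already the component in M_j reaches all of H_1j^*.\<close>
  define G where "G y = ind_dual D j 2 (lctr f (y 2) \<otimes> b) + lctr g (y j)"
    for y :: "nat \<Rightarrow> ('m, 'h \<Rightarrow> complex) tensor"
  have q2: "q 2 \<in> spM D 2 \<otimes>\<^sub>S spA D 2 1" "q j \<in> spM D j \<otimes>\<^sub>S spA D j 1" if "q \<in> ?MA" for q
    using that r j by (auto simp: MA_sum_def dsum_def)
  have lq2: "lctr f (q 2) \<in> spA D 2 1" "lctr g (q j) \<in> spA D j 1" if "q \<in> ?MA" for q
    using q2[OF that] r j by (auto intro!: lctr_mem[OF f(1)] lctr_mem[OF g(1)] subA)
  have y2: "y 2 \<in> spM D 2 \<otimes>\<^sub>S dual (spH D 2)" "y j \<in> spM D j \<otimes>\<^sub>S dual (spH D j)" if "y \<in> MH_sum D" for y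
    using that r j by (auto simp: MH_sum_def dsum_def)
  have ly2: "lctr f (y 2) \<in> dual (spH D 2)" "lctr g (y j) \<in> dual (spH D j)" if "y \<in> MH_sum D" for y
    using y2[OF that] r j by (auto intro!: lctr_mem[OF f(1)] lctr_mem[OF g(1)] dual_subspace subH)
  note compb = Hom_lin_comp_right[OF compA_hom' b]
  note indb = Hom_lin_comp_left[OF ind_dual_Hom[of 2 j, OF one_le_numeral j'(2) j(2)] b]
  have Flin: "lin_on ?MA F"
    unfolding F_def
  proof (intro lin_on_plus)
    have "lin_on ?MA (\<lambda>q. lctr f (q 2))"
      by (rule lin_on_compose[OF proj_lin_on _ lctr_lin[OF f(1)]]) (use q2 in auto)
    then show "lin_on ?MA (\<lambda>q. compA D j 2 1 (b \<otimes> lctr f (q 2)))"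
      by (rule lin_on_compose[OF _ _ compb]) (use lq2 in auto)
    show "lin_on ?MA (\<lambda>q. lctr g (q j))"
      by (rule lin_on_compose[OF proj_lin_on _ lctr_lin[OF g(1)]]) (use q2 in auto)
  qed
  have Glin: "lin_on (MH_sum D) G"
    unfolding G_def
  proof (intro lin_on_plus)
    have "lin_on (MH_sum D) (\<lambda>q. lctr f (q 2))"
      by (rule lin_on_compose[OF proj_lin_on _ lctr_lin[OF f(1)]]) (use y2 in auto)
    then show "lin_on (MH_sum D) (\<lambda>q. ind_dual D j 2 (lctr f (q 2) \<otimes> b))"
      by (rule lin_on_compose[OF _ _ indb]) (use ly2 in auto)
    show "lin_on (MH_sum D) (\<lambda>q. lctr g (q j))"
      by (rule lin_on_compose[OF proj_lin_on _ lctr_lin[OF g(1)]]) (use y2 in auto)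
  qed
  have comp0: "compA D j 2 1 (b \<otimes> 0) = 0" using lin_on_zero[OF Hom_lin[OF compA_hom'] tspace_subspace] by simp
  have ind0: "ind_dual D j 2 (0 \<otimes> b) = 0"
    using lin_on_zero[OF Hom_lin[OF ind_dual_Hom[of 2 j, OF one_le_numeral j'(2) j(2)]] tspace_subspace] by simp
  have j2: "2 \<noteq> j" "j \<noteq> 2" using j by auto
  have single_MA: "single k t \<in> ?MA" if "t \<in> spM D k \<otimes>\<^sub>S spA D k 1" "k \<in> {2..rk D}" for k t
    unfolding MA_sum_def using that by (intro single_mem_dsum) auto
  have Fj: "F (single j (m \<otimes> c)) = g m *\<^sub>C c" for m c
    using j2 comp0 by (simp add: F_def single_other lctr_zero[OF f(1)] lctr_tens[OF g(1)])
  have Fim: "F ` ?MA = spA D j 1"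
  proof
    show "F ` ?MA \<subseteq> spA D j 1"
      unfolding F_def using lq2 b j
      by (auto intro!: cvec.subspace_add subA compA_mem)
    show "spA D j 1 \<subseteq> F ` ?MA"
    proof
      fix c assume c: "c \<in> spA D j 1"
      have "single j (mj \<otimes> c) \<in> ?MA" using mj c j by (intro single_MA tens_mem) auto
      moreover have "F (single j (mj \<otimes> c)) = c" using Fj g(2) by (simp add: scaleC_one)
      ultimately show "c \<in> F ` ?MA" by (metis imageI)
    qed
  qed
  have Gim: "dual (spH D j) \<subseteq> G ` MH_sum D"
  proof
    fix c assume c: "c \<in> dual (spH D j)"
    have "single j (mj \<otimes> c) \<in> MH_sum D"
      unfolding MH_sum_def using mj c j by (intro single_mem_dsum tens_mem) auto
    moreover have "G (single j (mj \<otimes> c)) = c"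
      using j2 ind0 g(2) by (simp add: G_def single_other lctr_zero[OF f(1)] lctr_tens[OF g(1)] scaleC_one)
    ultimately show "c \<in> G ` MH_sum D" by (metis imageI)
  qed
  define K where "K = {q \<in> ?MA. F q = 0}"
  have Ksub: "cvec.subspace K" "K \<subseteq> ?MA"
    using lin_on_subspace_vimage[OF Flin MA_subspace, of "{0}"] by (auto simp: K_def)
  have dimK: "cvec.dim ?MA = cvec.dim (spA D j 1) + cvec.dim K"
    using rank_nullity[OF Flin MA_fin_dim] Fim by (simp add: K_def)
  \<comment> \<open>Contraction of the M factor commutes with the product by \<open>\<eta>\<close>,
    which acts on the A factor.\<close>
  have lp: "lctr h (pair_dual D i \<eta> t) = ind_dual D i 1 (\<eta> \<otimes> lctr h t)"
    if h: "h \<in> dual UNIV" and i: "1 \<le> i" "i \<le> rk D" and \<eta>: "\<eta> \<in> dual (spH D 1)"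
      and t: "t \<in> spM D i \<otimes>\<^sub>S spA D i 1" for h i \<eta> t
  proof (rule tspace_eqI[OF _ _ t])
    show "lin_on (spM D i \<otimes>\<^sub>S spA D i 1) (\<lambda>t. lctr h (pair_dual D i \<eta> t))"
      by (rule lin_on_compose[OF pair_dual_lin[OF i \<eta>] _ lctr_lin[OF h]])
        (use pair_dual_mem[OF i \<eta> order_refl] in auto)
    show "lin_on (spM D i \<otimes>\<^sub>S spA D i 1) (\<lambda>t. ind_dual D i 1 (\<eta> \<otimes> lctr h t))"
      by (rule lin_on_compose[OF lctr_lin[OF h] _ pair_lin_A[OF i \<eta>]])
        (use lctr_mem[OF h subA] i in auto)
    fix u v assume "u \<in> spM D i" "v \<in> spA D i 1"
    then show "lctr h (pair_dual D i \<eta> (u \<otimes> v)) = ind_dual D i 1 (\<eta> \<otimes> lctr h (u \<otimes> v))"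
      using lin_on_scale[OF pair_lin_A[OF i \<eta>]]
      by (simp add: pair_dual_tens[OF i \<eta>] lctr_tens[OF h])
  qed
  have Gd: "G (delta1 D (q \<otimes> \<eta>)) = ind_dual D j 1 (\<eta> \<otimes> F q)" if q: "q \<in> ?MA" and \<eta>: "\<eta> \<in> dual (spH D 1)" for q \<eta>
  proof -
    have "G (delta1 D (q \<otimes> \<eta>)) =
        ind_dual D j 2 (lctr f (pair_dual D 2 \<eta> (q 2)) \<otimes> b) + lctr g (pair_dual D j \<eta> (q j))"
      using r j by (simp add: G_def delta1_tens[OF q \<eta>])
    also have "\<dots> = ind_dual D j 2 (ind_dual D 2 1 (\<eta> \<otimes> lctr f (q 2)) \<otimes> b) + ind_dual D j 1 (\<eta> \<otimes> lctr g (q j))"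
      using lp[OF f(1) _ _ \<eta> q2(1)[OF q]] lp[OF g(1) _ _ \<eta> q2(2)[OF q]] r j by simp
    also have "ind_dual D j 2 (ind_dual D 2 1 (\<eta> \<otimes> lctr f (q 2)) \<otimes> b) =
        ind_dual D j 1 (\<eta> \<otimes> compA D j 2 1 (b \<otimes> lctr f (q 2)))"
      by (rule ind_dual_assoc) (use j \<eta> b lq2[OF q] in auto)
    also have "\<dots> + ind_dual D j 1 (\<eta> \<otimes> lctr g (q j)) = ind_dual D j 1 (\<eta> \<otimes> F q)"
      unfolding F_def
      by (rule lin_on_add[symmetric, OF pair_lin_A[OF j'(1) j(2) \<eta>]])
        (use j b lq2[OF q] in \<open>auto intro!: compA_mem\<close>)
    finally show ?thesis .
  qed
  have "delta1 D ` (K \<otimes>\<^sub>S dual (spH D 1)) \<subseteq> {y \<in> MH_sum D. G y = 0}"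
  proof (rule delta1_image_subset[OF Ksub(2)])
    show "cvec.subspace {y \<in> MH_sum D. G y = 0}"
      using lin_on_subspace_vimage[OF Glin MH_subspace, of "{0}"] by simp
    fix q \<eta> assume q: "q \<in> K" and \<eta>: "\<eta> \<in> dual (spH D 1)"
    have "q \<in> ?MA" "F q = 0" using q by (auto simp: K_def)
    moreover have "ind_dual D j 1 (\<eta> \<otimes> 0) = 0"
      using lin_on_zero[OF pair_lin_A[OF j'(1) j(2) \<eta>] subA] j by simp
    ultimately show "delta1 D (q \<otimes> \<eta>) \<in> {y \<in> MH_sum D. G y = 0}"
      using delta1_tens_mem Gd \<eta> by simp
  qed
  moreover have "fin_dim {y \<in> MH_sum D. G y = 0}"
    using lin_on_subspace_vimage[OF Glin MH_subspace, of "{0}"]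
    by (intro fin_dim_subset[OF MH_fin_dim]) auto
  ultimately have "cvec.dim (delta1 D ` (K \<otimes>\<^sub>S dual (spH D 1))) \<le> cvec.dim {y \<in> MH_sum D. G y = 0}"
    by (intro dim_mono)
  moreover have "cvec.dim (dual (spH D j)) \<le> cvec.dim (G ` MH_sum D)"
    by (rule dim_mono[OF fin_dim_image[OF Glin MH_fin_dim] Gim])
  ultimately have "dimr (dual (spH D j)) \<le> dimr (MH_sum D) - dimr (delta1 D ` (K \<otimes>\<^sub>S dual (spH D 1)))"
    using rank_nullity[OF Glin MH_fin_dim] by simp
  also have "\<dots> \<le> c1 D * (dimr ?MA - dimr K)"
  proof (rule c1_bound)
    have "K \<noteq> ?MA"
    proof
      assume "K = ?MA"
      then have "cvec.dim (spA D j 1) = 0" using dimK by simp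
      then have "spA D j 1 = {0}" using dim_eq_0_imp[OF fin_dim_A] j by simp
      then show False using A[OF j'(2) j(2) Mj] by simp
    qed
    \<comment> \<open>Two kinds of elements of \<open>K\<close> force every M'_i to be all of M_i:
      tensors killed by \<open>F\<close>, which yield the kernels of \<open>f\<close> and
      \<open>g\<close> and the M_i of all other indices, and one graph vector, which yields
      \<open>m0\<close> and \<open>mj\<close>.\<close>
    moreover have "\<not> K \<subseteq> MA_sum D M'"
      if M': "\<And>i. i \<in> {2..rk D} \<Longrightarrow> cvec.subspace (M' i)" "\<And>i. i \<in> {2..rk D} \<Longrightarrow> M' i \<subseteq> spM D i"
        and ex: "\<exists>i\<in>{2..rk D}. M' i \<noteq> spM D i" for M'
    proof
      assume KM: "K \<subseteq> MA_sum D M'"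
      have mem: "q i \<in> M' i \<otimes>\<^sub>S spA D i 1" if "q \<in> K" "i \<in> {2..rk D}" for q i
        using KM that by (auto simp: MA_sum_def dsum_def)
      have ker: "m \<in> M' i"
        if i: "i \<in> {2..rk D}" and m: "m \<in> spM D i" and a: "a \<in> spA D i 1" "a \<noteq> 0"
          and F0: "F (single i (m \<otimes> a)) = 0" for i m a
      proof -
        have "single i (m \<otimes> a) \<in> K" using single_MA[OF tens_mem[OF m a(1)] i] F0 by (simp add: K_def)
        from mem[OF this i] have "m \<otimes> a \<in> M' i \<otimes>\<^sub>S spA D i 1" by simp
        then show ?thesis by (rule tens_mem_leftD[OF _ a(2) M'(1)[OF i]])
      qed
      \<comment> \<open>The graph vector over m0 \<otimes> a0. By the choice of \<open>b\<close> and
        \<open>a0\<close> both components are nonzero pure tensors, so each gives a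
        membership.\<close>
      let ?q = "single 2 (m0 \<otimes> a0) + single j ((- mj) \<otimes> compA D j 2 1 (b \<otimes> a0))"
      have c: "compA D j 2 1 (b \<otimes> a0) \<in> spA D j 1" using a0 b j by (intro compA_mem) auto
      have "?q \<in> ?MA"
        using r j m0 mj a0 c
        by (intro cvec.subspace_add[OF MA_subspace] single_MA tens_mem cvec.subspace_neg[OF subM]) auto
      moreover have "F ?q = 0"
      proof -
        have "g (- mj) = - g mj" using lin_on_neg[OF dual_UNIV_lin[OF g(1), of UNIV]] by simp
        then show ?thesis
          using j2 f(2) g(2) by (simp add: F_def single_other lctr_tens[OF f(1)] lctr_tens[OF g(1)] scaleC_one)
      qed
      ultimately have qK: "?q \<in> K" by (simp add: K_def)
      have a0nz: "a0 \<noteq> 0" using ba comp0 by auto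
      have m0M: "m0 \<in> M' 2"
      proof -
        have "m0 \<otimes> a0 \<in> M' 2 \<otimes>\<^sub>S spA D 2 1" using mem[OF qK, of 2] r j2 by (simp add: single_other)
        then show ?thesis by (rule tens_mem_leftD[OF _ a0nz M'(1)]) (use r in auto)
      qed
      have mjM: "mj \<in> M' j"
      proof -
        have "(- mj) \<otimes> compA D j 2 1 (b \<otimes> a0) \<in> M' j \<otimes>\<^sub>S spA D j 1"
          using mem[OF qK, of j] j j2 by (simp add: single_other)
        then have "- mj \<in> M' j" by (rule tens_mem_leftD[OF _ ba M'(1)]) (use j in auto)
        then show ?thesis using cvec.subspace_neg[OF M'(1)[of j]] j by fastforce
      qed
      have "spM D i \<subseteq> M' i" if i: "i \<in> {2..rk D}" for i
      proof
        fix m assume m: "m \<in> spM D i"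
        consider "i = 2" | "i = j" | "i \<noteq> 2" "i \<noteq> j" by blast
        then show "m \<in> M' i"
        proof cases
          case 1
          let ?m = "m - f m *\<^sub>C m0"
          have "?m \<in> M' 2"
          proof (rule ker[OF _ _ a0 a0nz])
            show "?m \<in> spM D 2"
              using m 1 m0 r by (auto intro!: cvec.subspace_diff cvec.subspace_scale subM)
            have "f ?m = 0"
              using f lin_on_diff[OF dual_UNIV_lin[OF f(1)], of UNIV m] by (simp add: dual_UNIV_linear)
            then show "F (single 2 (?m \<otimes> a0)) = 0"
              using j2 comp0 by (simp add: F_def single_other lctr_tens[OF f(1)] lctr_zero[OF g(1)])
          qed (use r in auto)
          then have "?m + f m *\<^sub>C m0 \<in> M' 2"
            using m0M r by (intro cvec.subspace_add cvec.subspace_scale M') auto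
          then show ?thesis using 1 by simp
        next
          case 2
          let ?m = "m - g m *\<^sub>C mj"
          have "?m \<in> M' j"
          proof (rule ker[OF _ _ c ba])
            show "?m \<in> spM D j"
              using m 2 mj j by (auto intro!: cvec.subspace_diff cvec.subspace_scale subM)
            have "g ?m = 0"
              using g lin_on_diff[OF dual_UNIV_lin[OF g(1)], of UNIV m] by (simp add: dual_UNIV_linear)
            then show "F (single j (?m \<otimes> compA D j 2 1 (b \<otimes> a0))) = 0" using Fj by simp
          qed (use j in auto)
          then have "?m + g m *\<^sub>C mj \<in> M' j"
            using mjM j by (intro cvec.subspace_add cvec.subspace_scale M') auto
          then show ?thesis using 2 by simp
        next
          case 3
          show ?thesis
          proof (cases "spM D i = {0}")
            case True
            then show ?thesis using m cvec.subspace_0[OF M'(1)[OF i]] by simp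
          next
            case False
            then have "spA D i 1 \<noteq> {0}" using A i by simp
            then obtain a where "a \<in> spA D i 1" "a \<noteq> 0" using cvec.subspace_0[OF subA[of 1 i]] i by auto
            then show ?thesis
              using 3 comp0
              by (intro ker[OF i m]) (simp_all add: F_def single_other lctr_zero[OF f(1)] lctr_zero[OF g(1)])
          qed
        qed
      qed
      then show False using ex M'(2) by blast
    qed
    ultimately show "K \<in> K_family D" using Ksub unfolding K_family_def by blast
  qed
  also have "\<dots> = c1 D * dimr (spA D j 1)" using dimK by simp
  finally show ?thesis .
qed

theorem semistable_imp_M_zero:
  assumes ss: "Gred_semistable D lam mu w" and pol: "polarization D lam mu" and w: "w \<in> W_space D"
    and mu: "0 \<le> mu" and ass: "associated_polarization D lam al"
    and al: "\<And>i. 1 \<le> i \<Longrightarrow> i \<le> rk D \<Longrightarrow> 0 < al i"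
    and c1: "dimr (spA D 2 1) * mu * c1 D \<le> lam 2"
    and M2: "spM D 2 \<noteq> {0}" and j: "3 \<le> j" "j \<le> rk D"
  shows "spM D j = {0}"
proof (rule ccontr)
  assume Mj: "spM D j \<noteq> {0}"
  have A: "spA D i 1 \<noteq> {0}" if "2 \<le> i" "i \<le> rk D" "spM D i \<noteq> {0}" for i
    using semistable_A_nonzero[OF ss pol w mu _ _ _ lam_pos[OF ass al]] that by simp
  have j': "2 < j" "1 \<le> j" "2 \<le> j" using j by auto
  let ?h = "dimr (dual (spH D j))"
  have h: "?h \<le> c1 D * dimr (spA D j 1)" by (rule dim_dual_le_c1[OF A j'(1) j(2) M2 Mj])
  have lamj: "lam j \<le> mu * ?h" by (rule lam_le_dim_dual[OF ss pol w mu j'(2) j(2) Mj])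
  have "lam j = (\<Sum>k=1..j. dimr (spA D j k) * al k)" using ass j by (simp add: associated_polarization_def)
  \<comment> \<open>Of the nonnegative summands only k = 1, 2, j are kept: the first two are
    compared with \<lambda>_2, and the last, with a_jj = 1, makes the final estimate strict.\<close>
  also have "\<dots> \<ge> (\<Sum>k\<in>{1, 2, j}. dimr (spA D j k) * al k)"
    using j by (intro sum_mono2) (auto intro!: mult_nonneg_nonneg less_imp_le[OF al])
  also have "(\<Sum>k\<in>{1, 2, j}. dimr (spA D j k) * al k) = dimr (spA D j 1) * al 1 + dimr (spA D j 2) * al 2 + al j"
    using j dim_A_diag[of j] by simp
  finally have lower: "dimr (spA D j 1) * al 1 + dimr (spA D j 2) * al 2 + al j \<le> lam j" .
  have lam2: "lam 2 = dimr (spA D 2 1) * al 1 + al 2"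
  proof -
    have "{1..2::nat} = {1, 2}" by auto
    then show ?thesis using ass r dim_A_diag[of 2] by (simp add: associated_polarization_def)
  qed
  have "cvec.dim (spA D j 1) \<le> cvec.dim (spA D j 2 \<otimes>\<^sub>S spA D 2 1)"
    using dim_image_le[OF Hom_lin[OF compA_hom[of 1 2 j]] tspace_fin_dim(1)[OF fin_dim_A fin_dim_A]]
      compA_surj[of 1 2 j] j by simp
  also have "\<dots> = cvec.dim (spA D j 2) * cvec.dim (spA D 2 1)"
    using j by (intro tspace_fin_dim fin_dim_A) auto
  finally have dims: "dimr (spA D j 1) \<le> dimr (spA D j 2) * dimr (spA D 2 1)"
    by (metis of_nat_le_iff of_nat_mult)
  have a21: "0 < dimr (spA D 2 1)"
    using dim_eq_0_imp[OF fin_dim_A[of 1 2]] A[of 2] M2 r by auto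
  have pos: "0 < al 1" "0 < al 2" "0 < al j" using al r j by auto
  let ?a = "dimr (spA D 2 1)" and ?aj = "dimr (spA D j 1)"
  \<comment> \<open>The factor a_21 is carried along because it occurs in the bound on \<lambda>_2
    and in a_j1 \<le> a_j2 a_21. The chain returns to its starting term through a strict
    step.\<close>
  have "?a * (mu * ?h) \<le> ?a * (mu * (c1 D * ?aj))"
    using h mu by (intro mult_left_mono) auto
  also have "\<dots> = (?a * mu * c1 D) * ?aj" by (simp add: mult_ac)
  also have "\<dots> \<le> lam 2 * ?aj" using c1 by (intro mult_right_mono) auto
  also have "\<dots> = ?a * (?aj * al 1) + ?aj * al 2" by (simp add: lam2 algebra_simps)
  also have "\<dots> \<le> ?a * (?aj * al 1) + (dimr (spA D j 2) * ?a) * al 2"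
    using dims pos by (intro add_left_mono mult_right_mono) auto
  also have "\<dots> < ?a * (?aj * al 1) + (dimr (spA D j 2) * ?a) * al 2 + ?a * al j"
    using a21 pos by simp
  also have "\<dots> = ?a * (?aj * al 1 + dimr (spA D j 2) * al 2 + al j)" by (simp add: algebra_simps)
  also have "\<dots> \<le> ?a * lam j" using lower by (intro mult_left_mono) auto
  also have "\<dots> \<le> ?a * (mu * ?h)" using lamj by (intro mult_left_mono) auto
  finally show False by simp
qed

end

end

section \<open>The case \<open>M\<^sub>j = 0\<close> for \<open>j > 2\<close>\<close>

text \<open>The smallest \<open>M'\<close> with \<open>K \<subseteq> M' \<otimes>\<^sub>S V\<close>.\<close>

definition supp :: "('u::complex_vector, 'v::complex_vector) tensor set \<Rightarrow> 'u set"
  where "supp K = cvec.span (\<Union>f\<in>dual UNIV. ctr f ` K)"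

lemma supp_subspace: "cvec.subspace (supp K)"
  by (simp add: supp_def)

lemma supp_least: "K \<subseteq> L \<otimes>\<^sub>S V \<Longrightarrow> cvec.subspace L \<Longrightarrow> supp K \<subseteq> L"
  unfolding supp_def
proof (rule cvec.span_minimal[OF subsetI])
  fix x assume "K \<subseteq> L \<otimes>\<^sub>S V" "cvec.subspace L" "x \<in> (\<Union>f\<in>dual UNIV. ctr f ` K)"
  then obtain f t where "f \<in> dual UNIV" "x = ctr f t" "t \<in> L \<otimes>\<^sub>S V" by blast
  then show "x \<in> L" using ctr_mem \<open>cvec.subspace L\<close> by simp
qed

lemma subset_supp:
  assumes "K \<subseteq> U \<otimes>\<^sub>S V" "fin_dim V"
  shows "K \<subseteq> supp K \<otimes>\<^sub>S V"
proof
  fix t assume t: "t \<in> K"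
  then have "ctr f t \<in> supp K" if "f \<in> dual UNIV" for f
    unfolding supp_def using that by (intro cvec.span_base) blast
  then show "t \<in> supp K \<otimes>\<^sub>S V"
    by (rule tspace_memI[OF subsetD[OF assms(1) t] assms(2) supp_subspace])
qed

lemma dsum_eq_single:
  assumes "k \<in> I" "\<And>i. i \<in> I \<Longrightarrow> i \<noteq> k \<Longrightarrow> V i = {0}"
  shows "dsum I V = single k ` V k"
proof
  show "dsum I V \<subseteq> single k ` V k"
  proof
    fix x assume x: "x \<in> dsum I V"
    have "x = single k (x k)"
    proof
      fix i
      show "x i = single k (x k) i"
      proof (cases "i = k")
        case False
        then have "x i = 0" using assms(2)[of i] dsumD[OF x, of i] by (cases "i \<in> I") simp_all
        then show ?thesis using False by (simp add: single_other)
      qed simp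
    qed
    then show "x \<in> single k ` V k" using dsumD(1)[OF x assms(1)] by (rule image_eqI)
  qed
  show "single k ` V k \<subseteq> dsum I V"
    using assms by (intro image_subsetI dsumI) (auto simp: single_def)
qed

lemma single_eq_0: "single k t = 0 \<Longrightarrow> t = 0"
  by (drule fun_cong[of _ _ k]) simp

lemma dim_single_image: "fin_dim V \<Longrightarrow> cvec.dim (single k ` V) = cvec.dim V"
  by (rule dim_image_inj[OF single_lin_on]) (assumption, rule single_eq_0)

section \<open>Products of subspaces of M_2 \<otimes> A_21 with H_11^*\<close>

context comp_setting
begin

text \<open>For K in M_2 \<otimes> A_21 this is the image of K \<otimes> H_11^* under \<delta>_1,
  seen inside M_2 \<otimes> H_12^* without the embedding into the direct sum.\<close>

definition prod_dual :: "('m, 'a) tensor set \<Rightarrow> ('m, 'h \<Rightarrow> complex) tensor set"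
  where "prod_dual K = cvec.span {pair_dual D 2 \<eta> t |t \<eta>. t \<in> K \<and> \<eta> \<in> dual (spH D 1)}"

lemma prod_dual_subspace: "cvec.subspace (prod_dual K)"
  by (simp add: prod_dual_def)

lemma prod_dual_mem: "t \<in> K \<Longrightarrow> \<eta> \<in> dual (spH D 1) \<Longrightarrow> pair_dual D 2 \<eta> t \<in> prod_dual K"
  unfolding prod_dual_def by (rule cvec.span_base) blast

context
  assumes r: "2 \<le> rk D" and M0: "\<And>j. 3 \<le> j \<Longrightarrow> j \<le> rk D \<Longrightarrow> spM D j = {0}"
begin

lemma fin_dim2: "fin_dim (spM D 2)" "fin_dim (spA D 2 1)" "fin_dim (dual (spH D 2))"
  "fin_dim (spM D 2 \<otimes>\<^sub>S spA D 2 1)"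
  using r by (auto intro!: fin_dim_M fin_dim_A fin_dim_dual fin_dim_H tspace_fin_dim)

lemma MA_eq: "MA_sum D (spM D) = single 2 ` (spM D 2 \<otimes>\<^sub>S spA D 2 1)"
  unfolding MA_sum_def
proof (rule dsum_eq_single)
  fix i assume "i \<in> {2..rk D}" "i \<noteq> 2"
  then have "spM D i = {0}" by (intro M0) auto
  then show "spM D i \<otimes>\<^sub>S spA D i 1 = {0}" by simp
qed (use r in auto)

lemma MH_eq: "MH_sum D = single 2 ` (spM D 2 \<otimes>\<^sub>S dual (spH D 2))"
  unfolding MH_sum_def
proof (rule dsum_eq_single)
  fix i assume "i \<in> {2..rk D}" "i \<noteq> 2"
  then have "spM D i = {0}" by (intro M0) auto
  then show "spM D i \<otimes>\<^sub>S dual (spH D i) = {0}" by simp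
qed (use r in auto)

lemma prod_dual_subset:
  assumes "M' \<subseteq> spM D 2" "K \<subseteq> M' \<otimes>\<^sub>S spA D 2 1"
  shows "prod_dual K \<subseteq> M' \<otimes>\<^sub>S dual (spH D 2)"
  unfolding prod_dual_def
proof (rule cvec.span_minimal[OF subsetI tspace_subspace])
  fix x assume "x \<in> {pair_dual D 2 \<eta> t |t \<eta>. t \<in> K \<and> \<eta> \<in> dual (spH D 1)}"
  then obtain t \<eta> where "x = pair_dual D 2 \<eta> t" "t \<in> K" "\<eta> \<in> dual (spH D 1)" by blast
  then show "x \<in> M' \<otimes>\<^sub>S dual (spH D 2)"
    using pair_dual_mem[of 2 \<eta> M' t] assms r by auto
qed

text \<open>This is the surjectivity of H_11^* \<otimes> A_21 -> H_12^*, tensored with M'.\<close>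

lemma prod_dual_full:
  assumes M': "M' \<subseteq> spM D 2"
  shows "prod_dual (M' \<otimes>\<^sub>S spA D 2 1) = M' \<otimes>\<^sub>S dual (spH D 2)"
proof
  show "prod_dual (M' \<otimes>\<^sub>S spA D 2 1) \<subseteq> M' \<otimes>\<^sub>S dual (spH D 2)"
    by (rule prod_dual_subset[OF M' order_refl])
  note H = ind_dual_Hom[of 1 2, OF order_refl one_le_numeral r]
  show "M' \<otimes>\<^sub>S dual (spH D 2) \<subseteq> prod_dual (M' \<otimes>\<^sub>S spA D 2 1)"
  proof (rule tspace_least[OF prod_dual_subspace])
    fix m \<xi> assume m: "m \<in> M'" and "\<xi> \<in> dual (spH D 2)"
    then obtain x where x: "x \<in> dual (spH D 1) \<otimes>\<^sub>S spA D 2 1" "\<xi> = ind_dual D 2 1 x"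
      using ind_dual_surj[of 1 2] r by auto
    have lin: "lin_on (dual (spH D 1) \<otimes>\<^sub>S spA D 2 1) (\<lambda>x. m \<otimes> ind_dual D 2 1 x)"
      by (rule lin_on_compose[OF Hom_lin[OF H] subset_UNIV tens_lin_right])
    have "m \<otimes> ind_dual D 2 1 x \<in> prod_dual (M' \<otimes>\<^sub>S spA D 2 1)"
    proof (rule tspace_mapI[OF lin prod_dual_subspace x(1)])
      fix \<eta> a assume ea: "\<eta> \<in> dual (spH D 1)" "a \<in> spA D 2 1"
      then show "m \<otimes> ind_dual D 2 1 (\<eta> \<otimes> a) \<in> prod_dual (M' \<otimes>\<^sub>S spA D 2 1)"
        using prod_dual_mem[OF tens_mem[OF m ea(2)] ea(1)] pair_dual_tens[of 2 \<eta> m a] r m M' by auto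
    qed
    then show "m \<otimes> \<xi> \<in> prod_dual (M' \<otimes>\<^sub>S spA D 2 1)" unfolding x(2) .
  qed
qed

text \<open>Adding \<open>M'' \<otimes> A\<^sub>2\<^sub>1\<close> to \<open>K\<close> for a complement \<open>M''\<close> of \<open>supp K\<close> gives an element of
  \<open>\<K>\<close> with the same codimensions.\<close>

lemma codim_prod_dual_le:
  assumes K: "cvec.subspace K" "K \<subseteq> spM D 2 \<otimes>\<^sub>S spA D 2 1"
  shows "dimr (supp K \<otimes>\<^sub>S dual (spH D 2)) - dimr (prod_dual K) \<le>
    c1 D * (dimr (supp K \<otimes>\<^sub>S spA D 2 1) - dimr K)"
\<comment> \<open>c_1 only sees proper subspaces, so the case of codimension 0 is separated; there
  both sides vanish by \<open>prod_dual_full\<close>.\<close>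
proof (cases "K = supp K \<otimes>\<^sub>S spA D 2 1")
  case True
  have "prod_dual (supp K \<otimes>\<^sub>S spA D 2 1) = supp K \<otimes>\<^sub>S dual (spH D 2)"
    by (rule prod_dual_full[OF supp_least[OF K(2) fin_dim_subspace[OF fin_dim2(1)]]])
  then show ?thesis using True by simp
next
  case False
  let ?A = "spA D 2 1" and ?M' = "supp K" and ?H = "dual (spH D 2)"
  have subM2: "cvec.subspace (spM D 2)" by (rule fin_dim_subspace[OF fin_dim2(1)])
  have M': "cvec.subspace ?M'" "?M' \<subseteq> spM D 2" by (rule supp_subspace, rule supp_least[OF K(2) subM2])
  have KM': "K \<subseteq> ?M' \<otimes>\<^sub>S ?A" by (rule subset_supp[OF K(2) fin_dim2(2)])
  have fM': "fin_dim ?M'" by (rule fin_dim_subset[OF fin_dim2(1) M'])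
  have fM'A: "fin_dim (?M' \<otimes>\<^sub>S ?A)" by (rule tspace_fin_dim(1)[OF fM' fin_dim2(2)])
  have fK: "fin_dim K" by (rule fin_dim_subset[OF fin_dim2(4) K])
  obtain M'' where M'': "cvec.subspace M''" "M'' \<subseteq> spM D 2" "cvec.dim ?M' + cvec.dim M'' = cvec.dim (spM D 2)"
    "\<And>x. x \<in> spM D 2 \<Longrightarrow> \<exists>u\<in>?M'. \<exists>v\<in>M''. x = u + v" "?M' \<inter> M'' = {0}"
    by (rule complement_exists[OF fin_dim2(1) M'], rule that)
  have fM'': "fin_dim M''" by (rule fin_dim_subset[OF fin_dim2(1) M''(1,2)])
  have fM''A: "fin_dim (M'' \<otimes>\<^sub>S ?A)" by (rule tspace_fin_dim(1)[OF fM'' fin_dim2(2)])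
  have fM''H: "fin_dim (M'' \<otimes>\<^sub>S ?H)" by (rule tspace_fin_dim(1)[OF fM'' fin_dim2(3)])
  have dimMA: "cvec.dim (spM D 2 \<otimes>\<^sub>S ?A) = cvec.dim (?M' \<otimes>\<^sub>S ?A) + cvec.dim (M'' \<otimes>\<^sub>S ?A)"
    unfolding tspace_fin_dim(2)[OF fin_dim2(1,2)] tspace_fin_dim(2)[OF fM' fin_dim2(2)]
      tspace_fin_dim(2)[OF fM'' fin_dim2(2)] M''(3)[symmetric] by (rule add_mult_distrib)
  have dimMH: "cvec.dim (spM D 2 \<otimes>\<^sub>S ?H) = cvec.dim (?M' \<otimes>\<^sub>S ?H) + cvec.dim (M'' \<otimes>\<^sub>S ?H)"
    unfolding tspace_fin_dim(2)[OF fin_dim2(1,3)] tspace_fin_dim(2)[OF fM' fin_dim2(3)]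
      tspace_fin_dim(2)[OF fM'' fin_dim2(3)] M''(3)[symmetric] by (rule add_mult_distrib)
  let ?K = "ssum K (M'' \<otimes>\<^sub>S ?A)"
  have Kt: "cvec.subspace ?K" "?K \<subseteq> spM D 2 \<otimes>\<^sub>S ?A"
    by (rule ssum_subspace[OF K(1) tspace_subspace])
      (rule ssum_least[OF tspace_subspace K(2) tspace_mono[OF M''(2) order_refl]])
  have fKt: "fin_dim ?K" by (rule ssum_fin_dim(1)[OF fK fM''A])
  \<comment> \<open>The enlarged space has at most the codimension that \<open>K\<close> has in supp
    K \<otimes> A_21: a complement \<open>Z\<close> of \<open>K\<close> there, together with
    \<open>?K\<close>, exhausts M_2 \<otimes> A_21.\<close>
  have codimK: "cvec.dim (spM D 2 \<otimes>\<^sub>S ?A) + cvec.dim K \<le> cvec.dim ?K + cvec.dim (?M' \<otimes>\<^sub>S ?A)"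
  proof -
    obtain Z where Z: "cvec.subspace Z" "Z \<subseteq> ?M' \<otimes>\<^sub>S ?A" "cvec.dim K + cvec.dim Z = cvec.dim (?M' \<otimes>\<^sub>S ?A)"
      "\<And>x. x \<in> ?M' \<otimes>\<^sub>S ?A \<Longrightarrow> \<exists>u\<in>K. \<exists>v\<in>Z. x = u + v" "K \<inter> Z = {0}"
      by (rule complement_exists[OF fM'A K(1) KM'], rule that)
    have fZ: "fin_dim Z" by (rule fin_dim_subset[OF fM'A Z(1,2)])
    have sub: "cvec.subspace (ssum Z ?K)" by (rule ssum_subspace[OF Z(1) Kt(1)])
    have 1: "?K \<subseteq> ssum Z ?K" "Z \<subseteq> ssum Z ?K"
      by (rule ssum_sup2[OF Z(1)], rule ssum_sup1[OF Kt(1)])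
    have 2: "K \<subseteq> ?K" "M'' \<otimes>\<^sub>S ?A \<subseteq> ?K"
      by (rule ssum_sup1[OF tspace_subspace], rule ssum_sup2[OF K(1)])
    have "spM D 2 \<otimes>\<^sub>S ?A \<subseteq> ssum Z ?K"
    proof (rule tspace_least[OF sub])
      fix m a assume ma: "m \<in> spM D 2" "a \<in> ?A"
      obtain u v where uv: "u \<in> ?M'" "v \<in> M''" "m = u + v" using M''(4)[OF ma(1)] by blast
      obtain k z where kz: "k \<in> K" "z \<in> Z" "u \<otimes> a = k + z" using Z(4)[OF tens_mem[OF uv(1) ma(2)]] by blast
      have "m \<otimes> a = (k + z) + v \<otimes> a" using uv(3) kz(3) by (simp add: tens_add)
      moreover have "k \<in> ssum Z ?K" "z \<in> ssum Z ?K" "v \<otimes> a \<in> ssum Z ?K"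
        using 1 2 kz tens_mem[OF uv(2) ma(2)] by auto
      ultimately show "m \<otimes> a \<in> ssum Z ?K" using sub by (simp add: cvec.subspace_add)
    qed
    then have "cvec.dim (spM D 2 \<otimes>\<^sub>S ?A) \<le> cvec.dim (ssum Z ?K)"
      by (rule dim_mono[OF ssum_fin_dim(1)[OF fZ fKt]])
    also have "\<dots> \<le> cvec.dim Z + cvec.dim ?K" by (rule ssum_fin_dim(2)[OF fZ fKt])
    finally show ?thesis using Z(3) by simp
  qed
  have dK: "cvec.dim K < cvec.dim (?M' \<otimes>\<^sub>S ?A)"
    using dim_eq_imp_eq[OF fM'A K(1) KM'] False by fastforce
  have A: "?A \<noteq> {0}"
  proof
    assume "?A = {0}"
    then have "cvec.dim (?M' \<otimes>\<^sub>S ?A) = 0" by (simp add: dim_zero)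
    then show False using dK by simp
  qed
  define Kh where "Kh = (single 2 ` ?K :: ('m, 'a) pvec set)"
  have Kh: "Kh \<subseteq> MA_sum D (spM D)" unfolding MA_eq Kh_def using Kt(2) by (rule image_mono)
  \<comment> \<open>Any family whose tensor space contains \<open>Kh\<close> must contain M'' by way
    of M'' \<otimes> A_21 and \<open>supp K\<close> by minimality, hence all of M_2; the M_i with i
    > 2 are zero.\<close>
  have fam: "Kh \<in> K_family D"
  proof -
    have "Kh \<noteq> MA_sum D (spM D)"
    proof
      assume "Kh = MA_sum D (spM D)"
      then have "cvec.dim ?K = cvec.dim (spM D 2 \<otimes>\<^sub>S ?A)"
        using dim_single_image[OF fKt, of 2] dim_single_image[OF fin_dim2(4), of 2] by (simp add: MA_eq Kh_def)
      then show False using ssum_fin_dim(2)[OF fK fM''A] dimMA dK by simp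
    qed
    moreover have "\<not> Kh \<subseteq> MA_sum D L"
      if L: "\<And>i. i \<in> {2..rk D} \<Longrightarrow> cvec.subspace (L i)" "\<And>i. i \<in> {2..rk D} \<Longrightarrow> L i \<subseteq> spM D i"
        and ex: "\<exists>i\<in>{2..rk D}. L i \<noteq> spM D i" for L
    proof
      assume KL: "Kh \<subseteq> MA_sum D L"
      have i2: "2 \<in> {2..rk D}" using r by simp
      have KtL: "?K \<subseteq> L 2 \<otimes>\<^sub>S ?A"
      proof
        fix t assume "t \<in> ?K"
        then have "single 2 t \<in> Kh" unfolding Kh_def by (rule imageI)
        then have "single 2 t \<in> MA_sum D L" by (rule subsetD[OF KL])
        from dsumD(1)[OF this[unfolded MA_sum_def] i2] show "t \<in> L 2 \<otimes>\<^sub>S ?A" by simp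
      qed
      obtain a where a: "a \<in> ?A" "a \<noteq> 0" using A cvec.subspace_0[OF fin_dim_subspace[OF fin_dim2(2)]] by blast
      have "M'' \<subseteq> L 2"
      proof
        fix m assume "m \<in> M''"
        then have "m \<otimes> a \<in> ?K" by (rule subsetD[OF ssum_sup2[OF K(1)] tens_mem[OF _ a(1)]])
        then have "m \<otimes> a \<in> L 2 \<otimes>\<^sub>S ?A" by (rule subsetD[OF KtL])
        then show "m \<in> L 2" by (rule tens_mem_leftD[OF _ a(2) L(1)[OF i2]])
      qed
      have "?M' \<subseteq> L 2"
        by (rule supp_least[OF order_trans[OF ssum_sup1[OF tspace_subspace] KtL] L(1)[OF i2]])
      have "x \<in> L 2" if x: "x \<in> spM D 2" for x
      proof -
        obtain u v where "u \<in> ?M'" "v \<in> M''" "x = u + v" using M''(4)[OF x] by blast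
        then show ?thesis using \<open>?M' \<subseteq> L 2\<close> \<open>M'' \<subseteq> L 2\<close> cvec.subspace_add[OF L(1)[OF i2], of u v] by auto
      qed
      then have L2: "L 2 = spM D 2" using L(2)[OF i2] by blast
      have "L i = spM D i" if i: "i \<in> {2..rk D}" for i
      proof (cases "i = 2")
        case False
        then have "spM D i = {0}" using i by (intro M0) auto
        then show ?thesis using L(2)[OF i] cvec.subspace_0[OF L(1)[OF i]] by auto
      qed (simp add: L2)
      then show False using ex by blast
    qed
    moreover have "cvec.subspace Kh" unfolding Kh_def by (rule lin_on_subspace_image[OF single_lin_on Kt(1)])
    ultimately show ?thesis using Kh unfolding K_family_def psubset_eq mem_Collect_eq by blast
  qed
  have fP: "fin_dim (prod_dual K)"
    by (rule fin_dim_subset[OF tspace_fin_dim(1)[OF fin_dim2(1,3)] prod_dual_subspace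
          prod_dual_subset[OF order_refl K(2)]])
  let ?Y = "ssum (prod_dual K) (M'' \<otimes>\<^sub>S ?H)"
  have fY: "fin_dim ?Y" by (rule ssum_fin_dim(1)[OF fP fM''H])
  \<comment> \<open>On the dual side the added part contributes at most M'' \<otimes> H_12^*, whose
    dimension is exactly the difference between M_2 \<otimes> H_12^* and supp K \<otimes>
    H_12^*.\<close>
  have "delta1 D ` (Kh \<otimes>\<^sub>S dual (spH D 1)) \<subseteq> single 2 ` ?Y"
  proof (rule delta1_image_subset[OF r Kh])
    show "cvec.subspace (single 2 ` ?Y)"
      by (rule lin_on_subspace_image[OF single_lin_on fin_dim_subspace[OF fY]])
    fix q \<eta> assume qKh: "q \<in> Kh" and \<eta>: "\<eta> \<in> dual (spH D 1)"
    from qKh obtain k x where k: "k \<in> K" and x: "x \<in> M'' \<otimes>\<^sub>S ?A" and q: "q = single 2 (k + x)"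
      unfolding Kh_def ssum_def by blast
    have qMA: "q \<in> MA_sum D (spM D)" by (rule subsetD[OF Kh qKh])
    have x': "x \<in> spM D 2 \<otimes>\<^sub>S ?A" using x tspace_mono[OF M''(2) order_refl] by blast
    have "pair_dual D 2 \<eta> (k + x) = pair_dual D 2 \<eta> k + pair_dual D 2 \<eta> x"
      by (rule lin_on_add[OF pair_dual_lin[OF _ _ \<eta>]]) (use r k x' K(2) in auto)
    moreover have "pair_dual D 2 \<eta> x \<in> M'' \<otimes>\<^sub>S ?H"
      by (rule pair_dual_mem[OF _ _ \<eta> M''(2) x]) (use r in auto)
    ultimately have Y: "pair_dual D 2 \<eta> (k + x) \<in> ?Y" using prod_dual_mem[OF k \<eta>] by (simp add: ssum_mem)
    have "delta1 D (q \<otimes> \<eta>) = single 2 (pair_dual D 2 \<eta> (k + x))"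
    proof
      fix i
      show "delta1 D (q \<otimes> \<eta>) i = single 2 (pair_dual D 2 \<eta> (k + x)) i"
      proof (cases "i = 2")
        case True
        then show ?thesis using r fun_cong[OF delta1_tens[OF r qMA \<eta>], of 2] by (simp add: q)
      next
        case False
        have "pair_dual D i \<eta> 0 = 0" if "i \<in> {2..rk D}"
          by (rule lin_on_zero[OF pair_dual_lin[OF _ _ \<eta>] tspace_subspace]) (use that in auto)
        then show ?thesis using False fun_cong[OF delta1_tens[OF r qMA \<eta>], of i] by (simp add: q single_other)
      qed
    qed
    then show "delta1 D (q \<otimes> \<eta>) \<in> single 2 ` ?Y" using Y by simp
  qed
  then have "cvec.dim (delta1 D ` (Kh \<otimes>\<^sub>S dual (spH D 1))) \<le> cvec.dim (single 2 ` ?Y)"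
    by (rule dim_mono[OF fin_dim_image[OF single_lin_on fY]])
  also have "\<dots> \<le> cvec.dim (prod_dual K) + cvec.dim (M'' \<otimes>\<^sub>S ?H)"
    unfolding dim_single_image[OF fY] by (rule ssum_fin_dim(2)[OF fP fM''H])
  finally have "dimr (?M' \<otimes>\<^sub>S ?H) - dimr (prod_dual K) \<le>
      dimr (MH_sum D) - dimr (delta1 D ` (Kh \<otimes>\<^sub>S dual (spH D 1)))"
    unfolding MH_eq dim_single_image[OF tspace_fin_dim(1)[OF fin_dim2(1,3)]] dimMH by simp
  also have "\<dots> \<le> c1 D * (dimr (MA_sum D (spM D)) - dimr Kh)" by (rule c1_bound(1)[OF r fam])
  also have "\<dots> \<le> c1 D * (dimr (?M' \<otimes>\<^sub>S ?A) - dimr K)"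
    using codimK unfolding MA_eq Kh_def dim_single_image[OF fKt] dim_single_image[OF fin_dim2(4)]
    by (intro mult_left_mono c1_bound(2)[OF r fam]) linarith
  finally show ?thesis .
qed

end

text \<open>The last conclusion is a disjunction for the sake of stability: either the comparison is
  itself strict, or the family obtained is proper and stability of the translate makes its value
  negative. The hypothesis on A_21 allows division by a_21 when the codimension of K is 0.\<close>

theorem family_comparison:
  assumes r: "2 \<le> rk D" and M0: "\<And>j. 3 \<le> j \<Longrightarrow> j \<le> rk D \<Longrightarrow> spM D j = {0}"
    and w: "w \<in> W_space D" and mu: "0 \<le> mu" and ass: "associated_polarization D lam al"
    and al: "\<And>i. 1 \<le> i \<Longrightarrow> i \<le> rk D \<Longrightarrow> 0 < al i"
    and c1: "dimr (spA D 2 1) * mu * c1 D \<le> lam 2"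
    and A: "spM D 2 \<noteq> {0} \<Longrightarrow> spA D 2 1 \<noteq> {0}"
    and inv: "(P', Q') \<in> invariant_families_bW D (zeta D w)"
  obtains s M' N' where "s \<in> shift_maps D"
    "\<And>i. i \<in> {1..rk D} \<Longrightarrow> cvec.subspace (M' i)" "\<And>i. i \<in> {1..rk D} \<Longrightarrow> M' i \<subseteq> spM D i"
    "cvec.subspace N'" "N' \<subseteq> spN D"
    "\<And>i m \<eta>. i \<in> {1..rk D} \<Longrightarrow> m \<in> M' i \<Longrightarrow> \<eta> \<in> dual (spH D i) \<Longrightarrow> Phi D (shiftW D w s) i (m \<otimes> \<eta>) \<in> N'"
    "family_value D al mu P' Q' < family_value D lam mu M' N' \<or>
     family_value D al mu P' Q' \<le> family_value D lam mu M' N' \<and>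
     (M', N') \<in> proper_families (rk D) (spM D) (spN D)"
proof -
  let ?A = "spA D 2 1" and ?H = "dual (spH D 2)"
  have r1: "1 \<le> rk D" using r by simp
  have i12: "1 \<in> {1..rk D}" "2 \<in> {1..rk D}" "2 \<in> {2..rk D}" using r by auto
  note fM1 = fin_dim_M[OF order_refl r1] and fM2 = fin_dim_M[OF one_le_numeral r]
    and fA = fin_dim_A[OF order_refl one_le_numeral r]
  have fH: "fin_dim ?H" by (rule fin_dim_dual[OF fin_dim_H[OF one_le_numeral r]])
  have fM2A: "fin_dim (spM D 2 \<otimes>\<^sub>S ?A)" by (rule tspace_fin_dim(1)[OF fM2 fA])
  note sM1 = fin_dim_subspace[OF fM1] and sM2 = fin_dim_subspace[OF fM2]
  note pf = conjunct1[OF inv[unfolded invariant_bW_iff[OF w r1]]]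
  have xi: "\<And>i p a. i \<in> {2..rk D} \<Longrightarrow> p \<in> P' i \<Longrightarrow> a \<in> spA D i (i - 1) \<Longrightarrow> xi D i (p \<otimes> a) \<in> P' (i - 1)"
    and psi: "\<And>p \<eta>. p \<in> P' 1 \<Longrightarrow> \<eta> \<in> dual (spH D 1) \<Longrightarrow> snd (zeta D w) (p \<otimes> \<eta>) \<in> Q'"
    using inv unfolding invariant_bW_iff[OF w r1] by simp_all
  note P' = proper_familiesD(1,2)[OF pf] and Q' = proper_familiesD(3,4)[OF pf]
  have fQ': "fin_dim Q'" by (rule fin_dim_subset[OF fin_dim_N Q'])
  have fP': "fin_dim (P' i)" if i: "i \<in> {1..rk D}" for i
    by (rule fin_dim_subset[OF fin_dim_P P'(1)[OF i] P'(2)[OF i]]) (use i in auto)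
  have P_zero: "p j = 0" if "p \<in> P_space D i" "1 \<le> i" "3 \<le> j" for p i j
  proof (cases "j \<in> {i..rk D}")
    case True
    then have "p j \<in> spM D j \<otimes>\<^sub>S spA D j i" using P_mem[OF that(1), of j] by simp
    then show ?thesis using M0[of j] that(3) True by simp
  next
    case False
    then show ?thesis by (rule P_out[OF that(1)])
  qed
  obtain f1 where f1: "f1 \<in> dual UNIV" "f1 (unitA D 1) = 1"
    by (rule functional_exists[OF unitA_nz[OF order_refl r1]])
  obtain f2 where f2: "f2 \<in> dual UNIV" "f2 (unitA D 2) = 1"
    by (rule functional_exists[OF unitA_nz[OF one_le_numeral r]])
  let ?pr1 = "\<lambda>p :: ('m, 'a) pvec. ctr f1 (p 1)" and ?pr2 = "\<lambda>p :: ('m, 'a) pvec. ctr f2 (p 2)"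
  have ctr0: "ctr f1 (0 :: ('m, 'a) tensor) = 0"
    using lin_on_zero[OF ctr_lin[OF f1(1), of UNIV UNIV] tspace_subspace] .
  have P1: "?pr1 p \<in> spM D 1" "p 1 = ?pr1 p \<otimes> unitA D 1" "p 2 \<in> spM D 2 \<otimes>\<^sub>S ?A"
    "p = single 1 (?pr1 p \<otimes> unitA D 1) + single 2 (p 2)" if p: "p \<in> P_space D 1" for p
  proof -
    have "p 1 \<in> spM D 1 \<otimes>\<^sub>S spA D 1 1" by (rule P_mem[OF p order_refl r1])
    then obtain m where m: "m \<in> spM D 1" "p 1 = m \<otimes> unitA D 1"
      by (rule tens_unit_ex[OF order_refl r1 sM1])
    then show 1: "?pr1 p \<in> spM D 1" "p 1 = ?pr1 p \<otimes> unitA D 1"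
      using f1 by (simp_all add: ctr_tens scaleC_one)
    show "p 2 \<in> spM D 2 \<otimes>\<^sub>S ?A" by (rule P_mem[OF p one_le_numeral r])
    show "p = single 1 (?pr1 p \<otimes> unitA D 1) + single 2 (p 2)"
    proof
      fix j :: nat
      consider "j = 0" | "j = 1" | "j = 2" | "3 \<le> j" by linarith
      then show "p j = (single 1 (?pr1 p \<otimes> unitA D 1) + single 2 (p 2)) j"
      proof cases
        case 1
        then show ?thesis using P_out[OF p, of j] by (simp add: single_other)
      next
        case 2
        then show ?thesis using 1(2) by (simp add: single_other)
      next
        case 3
        then show ?thesis by (simp add: single_other)
      next
        case 4
        then show ?thesis using P_zero[OF p order_refl, of j] by (simp add: single_other)
      qed
    qed
  qed
  have P2: "?pr2 p \<in> spM D 2" "p = single 2 (?pr2 p \<otimes> unitA D 2)" if p: "p \<in> P_space D 2" for p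
  proof -
    have "p 2 \<in> spM D 2 \<otimes>\<^sub>S spA D 2 2" by (rule P_mem[OF p order_refl r])
    then obtain m where m: "m \<in> spM D 2" "p 2 = m \<otimes> unitA D 2"
      by (rule tens_unit_ex[OF one_le_numeral r sM2])
    then show 1: "?pr2 p \<in> spM D 2" using f2 by (simp add: ctr_tens scaleC_one)
    have 2: "p 2 = ?pr2 p \<otimes> unitA D 2" using m f2 by (simp add: ctr_tens scaleC_one)
    show "p = single 2 (?pr2 p \<otimes> unitA D 2)"
    proof
      fix j :: nat
      consider "j < 2" | "j = 2" | "3 \<le> j" by linarith
      then show "p j = single 2 (?pr2 p \<otimes> unitA D 2) j"
      proof cases
        case 1
        then show ?thesis using P_out[OF p, of j] by (simp add: single_other)
      next
        case 2
        then show ?thesis using \<open>p 2 = ?pr2 p \<otimes> unitA D 2\<close> by simp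
      next
        case 3
        then show ?thesis using P_zero[OF p one_le_numeral, of j] by (simp add: single_other)
      qed
    qed
  qed
  have pr1_lin: "lin_on (P' 1) ?pr1"
    by (rule lin_on_compose[OF proj_lin_on _ ctr_lin[OF f1(1), of "spM D 1" "spA D 1 1"]])
      (use P_mem[OF _ order_refl r1] P'(2)[OF i12(1)] in auto)
  have pr2_lin: "lin_on (P' 2) ?pr2"
    by (rule lin_on_compose[OF proj_lin_on _ ctr_lin[OF f2(1), of "spM D 2" "spA D 2 2"]])
      (use P_mem[OF _ order_refl r] P'(2)[OF i12(2)] in auto)
  define M1 where "M1 = ?pr1 ` P' 1"
  \<comment> \<open>P_2 is now a copy of M_2, and this is P'_2 seen inside it. The member of index 2
    of the test family will be \<open>supp K\<close> instead.\<close>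
  define M2 where "M2 = ?pr2 ` P' 2"
  define K where "K = {t \<in> spM D 2 \<otimes>\<^sub>S ?A. single 2 t \<in> P' 1}"
  have M1: "cvec.subspace M1" "M1 \<subseteq> spM D 1"
    unfolding M1_def
    by (rule lin_on_subspace_image[OF pr1_lin P'(1)[OF i12(1)]])
      (rule image_subsetI, rule P1(1)[OF subsetD[OF P'(2)[OF i12(1)]]])
  have M2: "cvec.subspace M2" "M2 \<subseteq> spM D 2"
    unfolding M2_def
    by (rule lin_on_subspace_image[OF pr2_lin P'(1)[OF i12(2)]])
      (rule image_subsetI, rule P2(1)[OF subsetD[OF P'(2)[OF i12(2)]]])
  have K: "cvec.subspace K" "K \<subseteq> spM D 2 \<otimes>\<^sub>S ?A"
    unfolding K_def by (rule lin_on_subspace_vimage[OF single_lin_on tspace_subspace P'(1)[OF i12(1)]]) auto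
  have fM1': "fin_dim M1" by (rule fin_dim_subset[OF fM1 M1])
  have fM2': "fin_dim M2" by (rule fin_dim_subset[OF fM2 M2])
  have fK: "fin_dim K" by (rule fin_dim_subset[OF fM2A K])
  have dimP1: "cvec.dim (P' 1) = cvec.dim M1 + cvec.dim K"
  proof -
    have "{p \<in> P' 1. ?pr1 p = 0} = single 2 ` K"
    proof
      show "{p \<in> P' 1. ?pr1 p = 0} \<subseteq> single 2 ` K"
      proof
        fix p assume p: "p \<in> {p \<in> P' 1. ?pr1 p = 0}"
        then have pP: "p \<in> P_space D 1" using P'(2)[OF i12(1)] by auto
        have "single 1 (?pr1 p \<otimes> unitA D 1) = (0 :: ('m, 'a) pvec)"
          using p by (intro ext) (simp add: single_def)
        then have e: "p = single 2 (p 2)" using P1(4)[OF pP] by simp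
        moreover have "p 2 \<in> K" unfolding K_def using P1(3)[OF pP] p e by simp
        ultimately show "p \<in> single 2 ` K" by (rule image_eqI)
      qed
      show "single 2 ` K \<subseteq> {p \<in> P' 1. ?pr1 p = 0}" using ctr0 by (auto simp: K_def single_other)
    qed
    then show ?thesis
      using rank_nullity[OF pr1_lin fP'[OF i12(1)]] dim_single_image[OF fK, of 2] by (simp add: M1_def)
  qed
  have dimP2: "cvec.dim (P' 2) = cvec.dim M2"
  proof -
    have "p = 0" if p: "p \<in> P' 2" "?pr2 p = 0" for p
    proof -
      have "p \<in> P_space D 2" using p P'(2)[OF i12(2)] by auto
      from P2(2)[OF this] have "p = single 2 (0 \<otimes> unitA D 2)" unfolding p(2) .
      also have "\<dots> = 0" by (intro ext) (simp add: single_def)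
      finally show ?thesis .
    qed
    then show ?thesis unfolding M2_def by (rule dim_image_inj[OF pr2_lin fP'[OF i12(2)], symmetric])
  qed
  \<comment> \<open>Invariance under \<xi>_2, evaluated at m \<otimes> 1 and \<open>a\<close>, puts
    m \<otimes> a into P'_1.\<close>
  have M2K: "M2 \<otimes>\<^sub>S ?A \<subseteq> K"
  proof (rule tspace_least[OF K(1)])
    fix m a assume m: "m \<in> M2" and a: "a \<in> ?A"
    obtain p where p: "p \<in> P' 2" "m = ?pr2 p" using m by (auto simp: M2_def)
    have pP: "p \<in> P_space D 2" using p P'(2)[OF i12(2)] by auto
    have mM: "m \<in> spM D 2" using m M2(2) by auto
    have pe: "p = single 2 (m \<otimes> unitA D 2)" using P2(2)[OF pP] p(2) by simp
    have e: "(2::nat) - 1 = 1" by arith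
    have u: "unitA D 2 \<in> spA D 2 2" by (rule unitA_mem[OF one_le_numeral r])
    have l2: "lin_on (spA D 2 2) (\<lambda>b. compA D 2 2 1 (b \<otimes> a))"
      by (rule Hom_lin_comp_left[OF compA_hom a]) (use r in auto)
    have "xi D 2 (p \<otimes> a) = single 2 (m \<otimes> a)"
    proof
      fix j
      show "xi D 2 (p \<otimes> a) j = single 2 (m \<otimes> a) j"
      proof (cases "j = 2")
        case True
        have "tmap_right (spM D 2) (spA D 2 2) (\<lambda>b. compA D 2 2 1 (b \<otimes> a)) (m \<otimes> unitA D 2) = m \<otimes> a"
          using unit_left[of 1 2 a] r a
          by (simp add: tmap_right_tens[OF sM2 subA[OF one_le_numeral order_refl r] l2 mM u])
        then show ?thesis using True r xi_tens[OF order_refl r pP, unfolded e, OF a] by (simp add: pe)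
      next
        case False
        have "tmap_right (spM D j) (spA D j 2) (\<lambda>b. compA D j 2 1 (b \<otimes> a)) 0 = 0" if "j \<in> {2..rk D}"
          by (rule lin_on_zero[OF tmap_right_lin[OF subM subA Hom_lin_comp_left[OF compA_hom a]] tspace_subspace])
            (use that in auto)
        then show ?thesis
          using False xi_tens[OF order_refl r pP, unfolded e, OF a] by (simp add: pe single_other)
      qed
    qed
    moreover have "xi D 2 (p \<otimes> a) \<in> P' 1" using xi[OF i12(3) p(1), unfolded e, OF a] .
    ultimately show "m \<otimes> a \<in> K" using tens_mem[OF mM a] by (simp add: K_def)
  qed
  \<comment> \<open>A linear section of P'_1 -> M1, chosen on a basis of \<open>M1\<close>; on the
    remaining vectors of a basis of M_1 it is set to 0, so that \<open>s\<close> is defined on all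
    of M_1.\<close>
  obtain s where s: "s \<in> shift_maps D"
    and sM1: "\<And>m. m \<in> M1 \<Longrightarrow> single 1 (m \<otimes> unitA D 1) + single 2 (s m) \<in> P' 1"
  proof -
    obtain B where B: "finite B" "B \<subseteq> M1" "cvec.independent B" "cvec.span B = M1" "card B = cvec.dim M1"
      by (rule fin_dim_basis[OF fM1'])
    obtain C where C: "B \<subseteq> C" "finite C" "C \<subseteq> spM D 1" "cvec.independent C" "cvec.span C = spM D 1"
      by (rule basis_extend[OF fM1 order_trans[OF B(2) M1(2)] B(3)])
    have "\<forall>b\<in>B. \<exists>p. p \<in> P' 1 \<and> ?pr1 p = b" using B(2) by (auto simp: M1_def)
    then obtain g where g: "\<And>b. b \<in> B \<Longrightarrow> g b \<in> P' 1" "\<And>b. b \<in> B \<Longrightarrow> ?pr1 (g b) = b" by metis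
    obtain F where F: "lin_on UNIV F" "\<And>b. b \<in> C \<Longrightarrow> F b = (if b \<in> B then g b 2 else 0)"
      using lin_on_from_basis[OF C(4), of "\<lambda>b. if b \<in> B then g b 2 else 0"] by blast
    have gP: "g b \<in> P_space D 1" if "b \<in> B" for b using g(1)[OF that] P'(2)[OF i12(1)] by auto
    have FM: "F m \<in> spM D 2 \<otimes>\<^sub>S ?A" if "m \<in> spM D 1" for m
    proof (rule lin_on_span_mem[OF lin_on_subset[OF F(1) subset_UNIV] _ tspace_subspace])
      show "F ` C \<subseteq> spM D 2 \<otimes>\<^sub>S ?A"
        using F(2) P1(3)[OF gP] cvec.subspace_0[OF tspace_subspace] by auto
      show "m \<in> cvec.span C" using that C(5) by simp
    qed
    have "restr (spM D 1) F \<in> shift_maps D"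
      using lin_on_restr[OF lin_on_subset[OF F(1) subset_UNIV] sM1] FM by (auto simp: Hom_iff restr_def)
    moreover have "single 1 (m \<otimes> unitA D 1) + single 2 (restr (spM D 1) F m) \<in> P' 1" if m: "m \<in> M1" for m
    proof -
      have "single 1 (m \<otimes> unitA D 1) + single 2 (F m) \<in> P' 1"
      proof (rule lin_on_span_mem[OF _ _ P'(1)[OF i12(1)]])
        show "m \<in> cvec.span B" using m B(4) by simp
        show "lin_on (cvec.span B) (\<lambda>m. single 1 (m \<otimes> unitA D 1) + single 2 (F m))"
          by (rule lin_on_plus[OF lin_on_compose[OF tens_lin_left subset_UNIV single_lin_on]
                lin_on_compose[OF lin_on_subset[OF F(1) subset_UNIV] subset_UNIV single_lin_on]])
        show "(\<lambda>m. single 1 (m \<otimes> unitA D 1) + single 2 (F m)) ` B \<subseteq> P' 1"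
        proof (rule image_subsetI)
          fix b assume b: "b \<in> B"
          have "single 1 (b \<otimes> unitA D 1) + single 2 (F b) = g b"
            using P1(4)[OF gP[OF b]] g(2)[OF b] F(2)[of b] b C(1) by auto
          then show "single 1 (b \<otimes> unitA D 1) + single 2 (F b) \<in> P' 1" using g(1)[OF b] by simp
        qed
      qed
      moreover have "m \<in> spM D 1" using m M1(2) by auto
      ultimately show ?thesis by (simp add: restr_def)
    qed
    ultimately show thesis by (rule that)
  qed
  let ?S = "supp K"
  let ?X = "?S \<otimes>\<^sub>S ?H"
  have S: "cvec.subspace ?S" "?S \<subseteq> spM D 2" by (rule supp_subspace, rule supp_least[OF K(2) sM2])
  have fS: "fin_dim ?S" by (rule fin_dim_subset[OF fM2 S])
  have fSA: "fin_dim (?S \<otimes>\<^sub>S ?A)" by (rule tspace_fin_dim(1)[OF fS fA])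
  have fX: "fin_dim ?X" by (rule tspace_fin_dim(1)[OF fS fH])
  have KS: "K \<subseteq> ?S \<otimes>\<^sub>S ?A" by (rule subset_supp[OF K(2) fA])
  have XM: "?X \<subseteq> spM D 2 \<otimes>\<^sub>S ?H" by (rule tspace_mono[OF S(2) order_refl])
  note Phi2 = Phi_Hom[OF w one_le_numeral r]
  have dualX: "prod_dual K \<subseteq> ?X" by (rule prod_dual_subset[OF r _ S(2) KS]) (rule M0)
  \<comment> \<open>On a vector of P'_1 without component in M_1, the last component of \<zeta>(w)
    is just the value of \<open>Phi D w 2\<close> on a product. So these products already land in
    Q'.\<close>
  have PhiK: "Phi D w 2 x \<in> Q'" if "x \<in> prod_dual K" for x
  proof (rule lin_on_span_mem[OF _ _ Q'(1) that[unfolded prod_dual_def]])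
    show "lin_on (cvec.span {pair_dual D 2 \<eta> t |t \<eta>. t \<in> K \<and> \<eta> \<in> dual (spH D 1)}) (Phi D w 2)"
      using lin_on_subset[OF Hom_lin[OF Phi2] order_trans[OF dualX XM]] by (simp add: prod_dual_def)
    show "Phi D w 2 ` {pair_dual D 2 \<eta> t |t \<eta>. t \<in> K \<and> \<eta> \<in> dual (spH D 1)} \<subseteq> Q'"
    proof (rule image_subsetI)
      fix x assume "x \<in> {pair_dual D 2 \<eta> t |t \<eta>. t \<in> K \<and> \<eta> \<in> dual (spH D 1)}"
      then obtain t \<eta> where x: "x = pair_dual D 2 \<eta> t" and t: "t \<in> K" and \<eta>: "\<eta> \<in> dual (spH D 1)" by blast
      have tP: "single 2 t \<in> P' 1" using t by (simp add: K_def)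
      then have tP': "single 2 t \<in> P_space D 1" using P'(2)[OF i12(1)] by auto
      note z = Phi_pair_dual_zero[OF w _ \<eta>]
      have "snd (zeta D w) (single 2 t \<otimes> \<eta>) = (\<Sum>j=1..rk D. Phi D w j (pair_dual D j \<eta> (single 2 t j)))"
        by (rule zeta_snd_tens[OF w tP' \<eta> r1])
      also have "\<dots> = (\<Sum>j=1..rk D. if j = 2 then Phi D w 2 x else 0)"
      proof (rule sum.cong[OF refl])
        fix j assume "j \<in> {1..rk D}"
        then show "Phi D w j (pair_dual D j \<eta> (single 2 t j)) = (if j = 2 then Phi D w 2 x else 0)"
          using z x by (cases "j = 2") (simp_all add: single_other)
      qed
      also have "\<dots> = Phi D w 2 x" using r by simp
      finally show "Phi D w 2 x \<in> Q'" using psi[OF tP \<eta>] by simp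
    qed
  qed
  define N' where "N' = ssum Q' (Phi D w 2 ` ?X)"
  have PhiX: "lin_on ?X (Phi D w 2)" by (rule lin_on_subset[OF Hom_lin[OF Phi2] XM])
  have subPhiX: "cvec.subspace (Phi D w 2 ` ?X)" by (rule lin_on_subspace_image[OF PhiX tspace_subspace])
  have N': "cvec.subspace N'" "N' \<subseteq> spN D" "Q' \<subseteq> N'"
  proof -
    show "cvec.subspace N'" unfolding N'_def by (rule ssum_subspace[OF Q'(1) subPhiX])
    have "Phi D w 2 ` ?X \<subseteq> spN D"
      by (rule image_subsetI, rule Hom_mem[OF Phi2], rule subsetD[OF XM])
    then show "N' \<subseteq> spN D" unfolding N'_def by (rule ssum_least[OF subN Q'(2)])
    show "Q' \<subseteq> N'" unfolding N'_def by (rule ssum_sup1[OF subPhiX])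
  qed
  \<comment> \<open>Since \<open>prod_dual K\<close> is sent into Q', only a complement of it in
    supp K \<otimes> H_12^* can enlarge Q'.\<close>
  have dimN': "dimr N' \<le> dimr Q' + (dimr ?X - dimr (prod_dual K))"
  proof -
    obtain Z where Z: "cvec.subspace Z" "Z \<subseteq> ?X" "cvec.dim (prod_dual K) + cvec.dim Z = cvec.dim ?X"
      "\<And>x. x \<in> ?X \<Longrightarrow> \<exists>u\<in>prod_dual K. \<exists>v\<in>Z. x = u + v" "prod_dual K \<inter> Z = {0}"
      by (rule complement_exists[OF fX prod_dual_subspace dualX], rule that)
    have fZ: "fin_dim Z" by (rule fin_dim_subset[OF fX Z(1,2)])
    have linZ: "lin_on Z (Phi D w 2)" by (rule lin_on_subset[OF PhiX Z(2)])
    have fPZ: "fin_dim (Phi D w 2 ` Z)" by (rule fin_dim_image[OF linZ fZ])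
    have sub: "cvec.subspace (ssum Q' (Phi D w 2 ` Z))" by (rule ssum_subspace[OF Q'(1) fin_dim_subspace[OF fPZ]])
    have "Phi D w 2 ` ?X \<subseteq> ssum Q' (Phi D w 2 ` Z)"
    proof (rule image_subsetI)
      fix x assume x: "x \<in> ?X"
      obtain u v where uv: "u \<in> prod_dual K" "v \<in> Z" "x = u + v" using Z(4)[OF x] by blast
      have "Phi D w 2 x = Phi D w 2 u + Phi D w 2 v"
        unfolding uv(3) by (rule lin_on_add[OF PhiX subsetD[OF dualX uv(1)] subsetD[OF Z(2) uv(2)]])
      then show "Phi D w 2 x \<in> ssum Q' (Phi D w 2 ` Z)" using PhiK[OF uv(1)] uv(2) by (simp add: ssum_mem)
    qed
    then have "N' \<subseteq> ssum Q' (Phi D w 2 ` Z)"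
      unfolding N'_def by (rule ssum_least[OF sub ssum_sup1[OF fin_dim_subspace[OF fPZ]]])
    then have "cvec.dim N' \<le> cvec.dim (ssum Q' (Phi D w 2 ` Z))"
      by (rule dim_mono[OF ssum_fin_dim(1)[OF fQ' fPZ]])
    also have "\<dots> \<le> cvec.dim Q' + cvec.dim (Phi D w 2 ` Z)" by (rule ssum_fin_dim(2)[OF fQ' fPZ])
    also have "\<dots> \<le> cvec.dim Q' + cvec.dim Z" using dim_image_le[OF linZ fZ] by simp
    finally show ?thesis using Z(3) by simp
  qed
  define M' where "M' i = (if i = 1 then M1 else if i = 2 then ?S else {0})" for i :: nat
  have M': "cvec.subspace (M' i)" "M' i \<subseteq> spM D i" if i: "i \<in> {1..rk D}" for i
    using M1 S cvec.subspace_0[OF subM[of i]] i by (auto simp: M'_def)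
  have invM: "Phi D (shiftW D w s) i (m \<otimes> \<eta>) \<in> N'"
    if i: "i \<in> {1..rk D}" and m: "m \<in> M' i" and \<eta>: "\<eta> \<in> dual (spH D i)" for i m \<eta>
  proof -
    consider "i = 1" | "i = 2" | "i \<noteq> 1" "i \<noteq> 2" by blast
    then show ?thesis
    proof cases
      \<comment> \<open>The lift of \<open>m\<close> lies in P'_1, and the value of \<zeta>(w) there
        is that of the shifted map at \<open>m\<close>. So M'_1 already lands in Q'.\<close>
      case 1
      have mM1: "m \<in> M1" and \<eta>1: "\<eta> \<in> dual (spH D 1)" using m \<eta> 1 by (auto simp: M'_def)
      have mM: "m \<in> spM D 1" using mM1 M1(2) by auto
      let ?p = "single 1 (m \<otimes> unitA D 1)"
      have p: "?p \<in> P_space D 1"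
        unfolding P_space_def using r1 mM unitA_mem[OF order_refl r1]
        by (intro single_mem_dsum tens_mem) auto
      have p1: "?p 1 = m \<otimes> unitA D 1" by simp
      note z = Phi_pair_dual_zero[OF shiftW_mem[OF w r s] _ \<eta>1]
      have "snd (zeta D w) ((?p + single 2 (s m)) \<otimes> \<eta>) =
          (\<Sum>j=1..rk D. Phi D (shiftW D w s) j (pair_dual D j \<eta> (?p j)))"
        by (rule zeta_shiftW(2)[OF w r s p p1 mM \<eta>1])
      also have "\<dots> = (\<Sum>j=1..rk D. if j = 1 then Phi D (shiftW D w s) 1 (m \<otimes> \<eta>) else 0)"
      proof (rule sum.cong[OF refl])
        fix j assume "j \<in> {1..rk D}"
        then show "Phi D (shiftW D w s) j (pair_dual D j \<eta> (?p j)) =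
            (if j = 1 then Phi D (shiftW D w s) 1 (m \<otimes> \<eta>) else 0)"
          using z pair_dual_unit[OF r1 \<eta>1 mM] by (cases "j = 1") (simp_all add: single_other)
      qed
      also have "\<dots> = Phi D (shiftW D w s) 1 (m \<otimes> \<eta>)" using r1 by simp
      finally have "Phi D (shiftW D w s) 1 (m \<otimes> \<eta>) \<in> Q'" using psi[OF sM1[OF mM1] \<eta>1] by simp
      then show ?thesis using N'(3) 1 by auto
    next
      case 2
      then have "m \<otimes> \<eta> \<in> ?X" using m \<eta> by (intro tens_mem) (auto simp: M'_def)
      then have "Phi D w 2 (m \<otimes> \<eta>) \<in> N'" unfolding N'_def using ssum_sup2[OF Q'(1)] by blast
      then show ?thesis using 2 by (simp add: shiftW_def)
    next
      case 3
      then have "m \<otimes> \<eta> = 0" using m by (simp add: M'_def)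
      moreover have "Phi D (shiftW D w s) i 0 = 0"
        by (rule lin_on_zero[OF Hom_lin[OF Phi_Hom[OF shiftW_mem[OF w r s]]] tspace_subspace]) (use i in auto)
      ultimately show ?thesis using cvec.subspace_0[OF N'(1)] by simp
    qed
  qed
  have split: "(\<Sum>i=1..rk D. h i) = h 1 + h 2" if "\<And>i. 3 \<le> i \<Longrightarrow> i \<le> rk D \<Longrightarrow> h i = 0" for h :: "nat \<Rightarrow> real"
  proof -
    have "(\<Sum>i=1..rk D. h i) = (\<Sum>i\<in>{1, 2}. h i)"
      using r that by (intro sum.mono_neutral_right) auto
    then show ?thesis by simp
  qed
  have Pi: "P' i = {0}" "P_space D i = {0}" if "3 \<le> i" "i \<le> rk D" for i
  proof -
    have i: "1 \<le> i" "i \<in> {1..rk D}" using that by auto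
    have "p = 0" if p: "p \<in> P_space D i" for p
    proof
      fix j
      show "p j = 0 j"
        using P_zero[OF p i(1), of j] P_out[OF p, of j] \<open>3 \<le> i\<close> by (cases "3 \<le> j") auto
    qed
    then show "P_space D i = {0}" using cvec.subspace_0[OF P_subspace[OF i(1)]] by blast
    then show "P' i = {0}" using P'[OF i(2)] cvec.subspace_0[OF P'(1)[OF i(2)]] by blast
  qed
  let ?a = "dimr ?A" and ?d = "dimr (?S \<otimes>\<^sub>S ?A) - dimr K"
  have V: "(\<Sum>i=1..rk D. al i * dimr (P' i)) = al 1 * (dimr M1 + dimr K) + al 2 * dimr M2"
    by (subst split) (simp_all add: Pi(1) dim_zero dimP1 dimP2)
  have U: "(\<Sum>i=1..rk D. lam i * dimr (M' i)) = lam 1 * dimr M1 + lam 2 * dimr ?S"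
    by (subst split) (simp_all add: M'_def dim_zero)
  have lam1: "lam 1 = al 1" using ass r1 dim_A_diag[OF order_refl r1] by (simp add: associated_polarization_def)
  have lam2: "lam 2 = ?a * al 1 + al 2"
  proof -
    have "{1..2::nat} = {1, 2}" by auto
    then show ?thesis using ass r dim_A_diag[of 2] by (simp add: associated_polarization_def)
  qed
  have pos: "0 < al 1" "0 < al 2" using al r by auto
  have dSA: "dimr (?S \<otimes>\<^sub>S ?A) = dimr ?S * ?a" using tspace_fin_dim(2)[OF fS fA] by simp
  have dM2A: "dimr (M2 \<otimes>\<^sub>S ?A) = dimr M2 * ?a" using tspace_fin_dim(2)[OF fM2' fA] by simp
  have d0: "0 \<le> ?d" using dim_mono[OF fSA KS] by simp
  have M2Kd: "dimr M2 * ?a \<le> dimr K" using dim_mono[OF fK M2K] dM2A by simp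
  have cd: "dimr ?X - dimr (prod_dual K) \<le> c1 D * ?d"
    by (rule codim_prod_dual_le[OF r _ K]) (rule M0)
  have n: "mu * dimr N' \<le> mu * dimr Q' + mu * (c1 D * ?d)"
  proof -
    have "dimr N' \<le> dimr Q' + c1 D * ?d"
      using dimN' cd by linarith
    then have "mu * dimr N' \<le> mu * (dimr Q' + c1 D * ?d)" using mu by (rule mult_left_mono)
    then show ?thesis by (simp add: distrib_left)
  qed
  let ?V = "family_value D al mu P' Q'"
  let ?U = "family_value D lam mu M' N'"
  \<comment> \<open>The defect \<open>?d\<close> enters twice: as the price on the side of N_1, and
    through dim K = a_21 dim (supp K) - d as a loss of weight of P'_1.\<close>
  have diff: "?V - ?U \<le> mu * (c1 D * ?d) - al 1 * ?d - al 2 * (dimr ?S - dimr M2)"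
    unfolding V U lam1 lam2 dSA using n by (simp add: algebra_simps dSA)
  have cmp: "?V < ?U \<or> ?V \<le> ?U \<and> (M', N') \<in> proper_families (rk D) (spM D) (spN D)"
  proof (cases "?d = 0")
    case False
    then have dpos: "0 < ?d" using d0 by simp
    have apos: "0 < ?a"
    proof (rule ccontr)
      assume "\<not> 0 < ?a"
      then have "?a = 0" by simp
      then show False using dpos dSA by simp
    qed
    \<comment> \<open>Equality would make \<open>K\<close> a full tensor product, with
      \<open>supp K\<close> inside \<open>M2\<close> and defect 0. So the inclusion is proper and
      the next dimension estimate is strict.\<close>
    have "M2 \<otimes>\<^sub>S ?A \<noteq> K"
    proof
      assume eq: "M2 \<otimes>\<^sub>S ?A = K"
      then have "?S \<subseteq> M2" using supp_least[OF _ M2(1), of K ?A] by simp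
      then have "?S \<otimes>\<^sub>S ?A \<subseteq> K" using tspace_mono[of ?S M2 ?A ?A] eq by simp
      then have "?S \<otimes>\<^sub>S ?A = K" using KS by simp
      then show False using dpos by simp
    qed
    then have "cvec.dim (M2 \<otimes>\<^sub>S ?A) < cvec.dim K"
      using dim_eq_imp_eq[OF fK tspace_subspace M2K] by fastforce
    then have lt: "?d < (dimr ?S - dimr M2) * ?a" using dM2A dSA by (simp add: algebra_simps)
    \<comment> \<open>Multiplication by a_21 brings in the bound on \<lambda>_2, which splits as
      a_21 \<alpha>_1 + \<alpha>_2; strictness comes from \<alpha>_2 > 0.\<close>
    have "?a * (mu * (c1 D * ?d)) = (?a * mu * c1 D) * ?d" by (simp add: mult_ac)
    also have "\<dots> \<le> lam 2 * ?d" using c1 d0 by (rule mult_right_mono)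
    also have "\<dots> = ?a * (al 1 * ?d) + al 2 * ?d" by (simp add: lam2 algebra_simps)
    also have "\<dots> < ?a * (al 1 * ?d) + al 2 * ((dimr ?S - dimr M2) * ?a)"
      using lt pos(2) by simp
    also have "\<dots> = ?a * (al 1 * ?d + al 2 * (dimr ?S - dimr M2))" by (simp add: algebra_simps)
    finally have "mu * (c1 D * ?d) < al 1 * ?d + al 2 * (dimr ?S - dimr M2)"
      using apos by (simp add: mult_less_cancel_left_pos)
    then show ?thesis using diff by linarith
  next
    case d: True
    \<comment> \<open>Cancelling a_21 in dim M2 a_21 \<le> dim (supp K) a_21 requires A_21 to be
      nonzero; otherwise M_2 itself is zero.\<close>
    have M2S: "dimr M2 \<le> dimr ?S"
    proof (cases "?A = {0}")
      case True
      then have "spM D 2 = {0}" using A by blast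
      then show ?thesis using dim_mono[OF _ M2(2)] by (simp add: fin_dim_zero dim_zero)
    next
      case False
      then have "0 < ?a" using dim_eq_0_imp[OF fA] by auto
      moreover have "dimr M2 * ?a \<le> dimr ?S * ?a" using M2Kd d dSA by simp
      ultimately show ?thesis by simp
    qed
    show ?thesis
    proof (cases "dimr M2 < dimr ?S")
      case True
      then have "0 < al 2 * (dimr ?S - dimr M2)" using pos by simp
      then show ?thesis using diff unfolding d by simp
    next
      \<comment> \<open>Here d = 0 and P'_2 has the dimension of \<open>supp K\<close>, so (M', N')
        determines the dimensions of all P'_i, and N' = Q'. A zero or full (M', N') would make (P',
        Q') zero or full.\<close>
      case False
      then have eqM2: "dimr M2 = dimr ?S" using M2S by simp
      have "?V \<le> ?U" using diff unfolding d eqM2 by simp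
      moreover have "(M', N') \<in> proper_families (rk D) (spM D) (spN D)"
      proof -
        have kS: "dimr K = dimr ?S * ?a" using d dSA by simp
        have "dimr N' \<le> dimr Q'"
          using dimN' cd unfolding d by simp
        then have QN: "Q' = N'"
          using dim_eq_imp_eq[OF fin_dim_subset[OF fin_dim_N N'(1,2)] Q'(1) N'(3)] by simp
        have zero: False if "\<forall>i\<in>{1..rk D}. M' i = {0}" "N' = {0}"
        proof -
          have "M1 = {0}" "?S = {0}" using bspec[OF that(1) i12(1)] bspec[OF that(1) i12(2)] by (simp_all add: M'_def)
          then have "dimr M1 = 0" "dimr ?S = 0" by (simp_all only: dim_zero of_nat_0)
          then have "cvec.dim (P' 1) = 0" "cvec.dim (P' 2) = 0" using dimP1 dimP2 kS eqM2 by simp_all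
          then have "P' 1 = {0}" "P' 2 = {0}" using dim_eq_0_imp fP' i12 by blast+
          then have "P' i = {0}" if "i \<in> {1..rk D}" for i
          proof -
            consider "i = 1" | "i = 2" | "3 \<le> i" using \<open>i \<in> {1..rk D}\<close> by force
            then show ?thesis using Pi(1)[of i] \<open>P' 1 = {0}\<close> \<open>P' 2 = {0}\<close> that by cases simp_all
          qed
          then show False using pf QN \<open>N' = {0}\<close> by (simp add: proper_families_def)
        qed
        have full: False if "\<forall>i\<in>{1..rk D}. M' i = spM D i" "N' = spN D"
        proof -
          have M12: "M1 = spM D 1" "?S = spM D 2" using bspec[OF that(1) i12(1)] bspec[OF that(1) i12(2)] by (simp_all add: M'_def)
          have "P' i = P_space D i" if i: "i \<in> {1..rk D}" for i
          proof -
            consider "i = 1" | "i = 2" | "3 \<le> i" using i by force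
            then show ?thesis
            proof cases
              case 1
              have "cvec.dim (P_space D 1) = (\<Sum>j=1..rk D. cvec.dim (spM D j) * cvec.dim (spA D j 1))"
                by (rule P_dim[OF order_refl])
              also have "\<dots> = (\<Sum>j\<in>{1, 2}. cvec.dim (spM D j) * cvec.dim (spA D j 1))"
                by (rule sum.mono_neutral_right) (use r M0 in \<open>auto simp: dim_zero\<close>)
              also have "\<dots> = cvec.dim (spM D 1) + cvec.dim (spM D 2) * cvec.dim ?A"
                using dim_A_diag[OF order_refl r1] by simp
              also have "\<dots> = cvec.dim (P' 1)"
                using dimP1 kS M12 by (metis of_nat_eq_iff of_nat_mult)
              finally show ?thesis
                using dim_eq_imp_eq[OF fin_dim_P P'(1)[OF i] P'(2)[OF i]] 1 by simp
            next
              case 2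
              have "cvec.dim (P_space D 2) = (\<Sum>j=2..rk D. cvec.dim (spM D j) * cvec.dim (spA D j 2))"
                by (rule P_dim[OF one_le_numeral])
              also have "\<dots> = (\<Sum>j\<in>{2}. cvec.dim (spM D j) * cvec.dim (spA D j 2))"
                by (rule sum.mono_neutral_right) (use r M0 in \<open>auto simp: dim_zero\<close>)
              also have "\<dots> = cvec.dim (P' 2)"
                using dim_A_diag[OF one_le_numeral r] dimP2 eqM2 M12 by simp
              finally show ?thesis
                using dim_eq_imp_eq[OF fin_dim_P P'(1)[OF i] P'(2)[OF i]] 2 by simp
            next
              case 3
              then show ?thesis using Pi[of i] i by simp
            qed
          qed
          then show False using pf QN \<open>N' = spN D\<close> by (simp add: proper_families_def)
        qed
        show ?thesis
          unfolding proper_families_def mem_Collect_eq prod.case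
          by (intro conjI ballI M' N'(1,2) notI) (auto dest: zero full)
      qed
      ultimately show ?thesis by blast
    qed
  qed
  show thesis by (rule that[OF s M' N'(1,2) invM cmp])
qed

section \<open>From families to semi-stability and stability\<close>

lemma Gred_stable_imp_semistable: "Gred_stable D lam mu w \<Longrightarrow> Gred_semistable D lam mu w"
  unfolding Gred_stable_def Gred_semistable_def by (auto intro: less_imp_le)

lemma shiftW_zero:
  assumes "w \<in> W_space D" "2 \<le> rk D"
  shows "shiftW D w 0 = w"
proof -
  have "ext_W D w 2 1 0 = 0"
    by (rule lin_on_zero[OF Hom_lin[OF ext_W_Hom[OF assms(1)]] tspace_subspace]) (use assms(2) in auto)
  then show ?thesis by (intro ext) (simp add: shiftW_def)
qed

text \<open>The condition on M_2 is asked only beyond rank 2, where there are M_j to be removed: it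
  provides the source of the graph behind the lower bound for c_1.\<close>

theorem zeta_semistable_iff:
  assumes r: "2 \<le> rk D" and M2: "2 < rk D \<Longrightarrow> spM D 2 \<noteq> {0}"
    and pol: "polarization D lam mu" and ass: "associated_polarization D lam al"
    and al: "\<And>i. 1 \<le> i \<Longrightarrow> i \<le> rk D \<Longrightarrow> 0 < al i"
    and c1: "dimr (spA D 2 1) * mu * c1 D \<le> lam 2" and mu: "0 \<le> mu" and w: "w \<in> W_space D"
  shows "zeta D w \<in> bW_semistable D al mu \<longleftrightarrow> w \<in> W_semistable D lam mu"
    and "zeta D w \<in> bW_stable D al mu \<longleftrightarrow> w \<in> W_stable D lam mu"
proof -
  have zero: "0 \<in> shift_maps D"
    by (rule cvec.subspace_0[OF Hom_subspace[OF tspace_subspace]])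
  have r1: "1 \<le> rk D" using r by simp
  \<comment> \<open>Semi-stability of \<open>w\<close> itself, the shift by 0, is enough, so both
    implications can use the vanishing.\<close>
  have M0: "spM D j = {0}" if "Gred_semistable D lam mu w" "3 \<le> j" "j \<le> rk D" for j
    by (rule semistable_imp_M_zero[OF r that(1) pol w mu ass al c1 M2 that(2,3)]) (use that in auto)
  \<comment> \<open>Stated for an arbitrary property so that it serves semi-stable and stable points
    alike.\<close>
  have orbit: "P (act D u w)" if "Gred_semistable D lam mu w" "u \<in> H_grp D"
    "\<And>s. s \<in> shift_maps D \<Longrightarrow> P (shiftW D w s)" for P u
  proof (rule H_orbit_cases[OF r w _ that(2)])
    show "spM D j = {0}" if "3 \<le> j" "j \<le> rk D" for j
      by (rule M0[OF \<open>Gred_semistable D lam mu w\<close> that])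
    fix s assume "s \<in> shift_maps D" "act D u w = shiftW D w s"
    then show "P (act D u w)" using that(3) by simp
  qed
  \<comment> \<open>Both bounds come from one family: semi-stability of the shifts gives the weak
    inequality and the vanishing of the M_j, and stability of the shifts then sharpens it.\<close>
  have comparison: "family_value D al mu P' Q' \<le> 0 \<and>
      ((\<forall>s\<in>shift_maps D. Gred_stable D lam mu (shiftW D w s)) \<longrightarrow>
        family_value D al mu P' Q' < 0)"
    if ss: "\<And>s. s \<in> shift_maps D \<Longrightarrow> Gred_semistable D lam mu (shiftW D w s)"
      and inv: "(P', Q') \<in> invariant_families_bW D (zeta D w)" for P' Q'
  proof -
    have ssw: "Gred_semistable D lam mu w" using ss[OF zero] by (simp add: shiftW_zero[OF w r])
    have A: "spA D 2 1 \<noteq> {0}" if "spM D 2 \<noteq> {0}"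
      by (rule semistable_A_nonzero[OF ssw pol w mu one_le_numeral r that lam_pos[OF ass al one_le_numeral r]])
    show ?thesis
    proof (rule family_comparison[OF r _ w mu ass al c1 A inv])
      show "spM D j = {0}" if "3 \<le> j" "j \<le> rk D" for j by (rule M0[OF ssw that])
    next
      fix s M' N'
      assume s: "s \<in> shift_maps D"
        and M': "\<And>i. i \<in> {1..rk D} \<Longrightarrow> cvec.subspace (M' i)" "\<And>i. i \<in> {1..rk D} \<Longrightarrow> M' i \<subseteq> spM D i"
        and N': "cvec.subspace N'" "N' \<subseteq> spN D"
        and Phi: "\<And>i m \<eta>. i \<in> {1..rk D} \<Longrightarrow> m \<in> M' i \<Longrightarrow> \<eta> \<in> dual (spH D i) \<Longrightarrow>
          Phi D (shiftW D w s) i (m \<otimes> \<eta>) \<in> N'"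
        and cmp: "family_value D al mu P' Q' <
            family_value D lam mu M' N' \<or>
          family_value D al mu P' Q' \<le>
            family_value D lam mu M' N' \<and>
          (M', N') \<in> proper_families (rk D) (spM D) (spN D)"
      let ?V = "family_value D al mu P' Q'"
      let ?U = "family_value D lam mu M' N'"
      have U: "?U \<le> 0"
        by (rule Gred_semistable_le[OF ss[OF s] pol shiftW_mem[OF w r s] M' N' Phi])
      have "?V < 0" if st: "Gred_stable D lam mu (shiftW D w s)"
      proof (cases "?V < ?U")
        case True
        then show ?thesis using U by linarith
      next
        case False
        then have le: "?V \<le> ?U" and fam: "(M', N') \<in> proper_families (rk D) (spM D) (spN D)"
          using cmp by simp_all
        have "(M', N') \<in> invariant_families_W D (shiftW D w s)"
          using fam Phi unfolding invariant_W_iff[OF shiftW_mem[OF w r s]] by simp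
        then have "?U < 0" using bspec[OF st[unfolded Gred_stable_def]] by fastforce
        then show ?thesis using le by linarith
      qed
      moreover have "?V \<le> 0" using U cmp by linarith
      ultimately show ?thesis using s by simp
    qed
  qed
  show "zeta D w \<in> bW_semistable D al mu \<longleftrightarrow> w \<in> W_semistable D lam mu"
  proof
    assume z: "zeta D w \<in> bW_semistable D al mu"
    note g = Gred_semistable_shiftW[OF ass r w _ z]
    have ssw: "Gred_semistable D lam mu w" using g[OF zero] by (simp add: shiftW_zero[OF w r])
    show "w \<in> W_semistable D lam mu"
      unfolding W_semistable_def using w orbit[OF ssw, of _ "Gred_semistable D lam mu"] g by simp
  next
    assume W: "w \<in> W_semistable D lam mu"
    have ss: "Gred_semistable D lam mu (shiftW D w s)" if s: "s \<in> shift_maps D" for s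
    proof -
      obtain u where "u \<in> H_grp D" "act D u w = shiftW D w s" by (rule H_orbit_shiftW[OF r w s])
      then show ?thesis using W by (auto simp: W_semistable_def)
    qed
    have "family_value D al mu P' Q' \<le> 0"
      if "(P', Q') \<in> invariant_families_bW D (zeta D w)" for P' Q'
      by (rule conjunct1[OF comparison[OF ss that]])
    then show "zeta D w \<in> bW_semistable D al mu"
      using zeta_mem[OF w r1] by (auto simp: bW_semistable_def)
  qed
  show "zeta D w \<in> bW_stable D al mu \<longleftrightarrow> w \<in> W_stable D lam mu"
  proof
    assume z: "zeta D w \<in> bW_stable D al mu"
    note g = Gred_stable_shiftW[OF ass r w _ z]
    have ssw: "Gred_semistable D lam mu w"
      using Gred_stable_imp_semistable[OF g[OF zero]] by (simp add: shiftW_zero[OF w r])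
    show "w \<in> W_stable D lam mu"
      unfolding W_stable_def using w orbit[OF ssw, of _ "Gred_stable D lam mu"] g by simp
  next
    assume W: "w \<in> W_stable D lam mu"
    have st: "Gred_stable D lam mu (shiftW D w s)" if s: "s \<in> shift_maps D" for s
    proof -
      obtain u where "u \<in> H_grp D" "act D u w = shiftW D w s" by (rule H_orbit_shiftW[OF r w s])
      then show ?thesis using W by (auto simp: W_stable_def)
    qed
    have "family_value D al mu P' Q' < 0"
      if "(P', Q') \<in> invariant_families_bW D (zeta D w)" for P' Q'
      using conjunct2[OF comparison[OF Gred_stable_imp_semistable[OF st] that]] st by simp
    then show "zeta D w \<in> bW_stable D al mu"
      using zeta_mem[OF w r1] by (auto simp: bW_stable_def)
  qed
qed

end

theorem corollary7p2p2:
  fixes D :: "('a::complex_vector, 'h::complex_vector, 'm::complex_vector, 'n::complex_vector)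
      comp_data"
    and lambda alpha :: "nat \<Rightarrow> real"
  assumes "comp_setting D"
    and "2 \<le> rk D"
    and "2 < rk D \<Longrightarrow> spM D 2 \<noteq> {0}"
    and "polarization D lambda (1 / dimr (spN D))"
    and "associated_polarization D lambda alpha"
    and "\<And>i. 1 \<le> i \<Longrightarrow> i \<le> rk D \<Longrightarrow> 0 < alpha i"
    and "dimr (spA D 2 1) / dimr (spN D) * c1 D \<le> lambda 2"
  shows "{w \<in> W_space D. zeta D w \<in> bW_semistable D alpha (1 / dimr (spN D))} =
      W_semistable D lambda (1 / dimr (spN D)) \<and>
    {w \<in> W_space D. zeta D w \<in> bW_stable D alpha (1 / dimr (spN D))} =
      W_stable D lambda (1 / dimr (spN D))"
proof -
  interpret comp_setting D by (rule assms(1))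
  have c1: "dimr (spA D 2 1) * (1 / dimr (spN D)) * c1 D \<le> lambda 2" using assms(7) by simp
  have iff: "zeta D w \<in> bW_semistable D alpha (1 / dimr (spN D)) \<longleftrightarrow> w \<in> W_semistable D lambda (1 / dimr (spN D))"
    "zeta D w \<in> bW_stable D alpha (1 / dimr (spN D)) \<longleftrightarrow> w \<in> W_stable D lambda (1 / dimr (spN D))"
    if "w \<in> W_space D" for w
    using zeta_semistable_iff[OF assms(2,3,4,5,6) c1 _ that] by simp_all
  have sub: "W_semistable D lambda (1 / dimr (spN D)) \<subseteq> W_space D"
    "W_stable D lambda (1 / dimr (spN D)) \<subseteq> W_space D"
    by (auto simp: W_semistable_def W_stable_def)
  show ?thesis using iff sub by blast
qed

end
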